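(* Let $0<p<\infty$ and $\alpha>-1$, let $\{X_n\}_{n\ge1}$ be a standard random sequence, and let $f\in\mathcal{D}$. Then (i) $\mathcal{R}f\in\mathscr{H}^p$ almost surely if and only if $f\in\mathscr{H}^2$; (ii) $\mathcal{R}f\in\mathcal{A}^p_\alpha$ almost surely if and only if $f\in\mathscr{H}^{2,p}_\alpha$.
   Context: A standard random sequence $\{X_n\}$ is a sequence of independent identically distributed random variables on a probability space, all of one of the following three types: Bernoulli ($\mathbb{P}(X_n=1)=\mathbb{P}(X_n=-1)=1/2$), Steinhaus (uniformly distributed on the unit circle), or Gaussian $N(0,1)$ (zero mean, unit variance). For $\theta\in\mathbb{R}$ let $\mathbb{C}_\theta=\{s\in\mathbb{C}:\Re s>\theta\}$. $\mathcal{D}$ is the space of Dirichlet series $\sum_{n\ge1}a_nn^{-s}$ ($a_n\in\mathbb{C}$) converging on some half plane $\mathbb{C}_\theta$, and $\mathcal{P}$ is the space of Dirichlet polynomials $\sum_{n=1}^Na_nn^{-s}$. For $f(s)=\sum_{n\ge1}a_nn^{-s}$ in $\mathcal{D}$, the randomization is $\mathcal{R}f(s)=\sum_{n\ge1}a_nX_nn^{-s}$. Let $p_j$ be the $j$th prime and write $n=\prod_j p_j^{\nu_j(n)}$. The Bohr lift of $P(s)=\sum_{n=1}^N a_nn^{-s}$ is $\mathscr{B}P(z)=\sum_{n=1}^N a_nz^{\nu(n)}$, where $z=(z_1,z_2,\dots)$ and $z^{\nu(n)}=\prod_jz_j^{\nu_j(n)}$. For $0<p<\infty$, $\mathscr{H}^p$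 is the completion of $\mathcal{P}$ with respect to the (quasi-)norm $\|P\|_{\mathscr{H}^p}=\left(\int_{\mathbb{T}^\infty}|\mathscr{B}P(z)|^p\,dm_\infty(z)\right)^{1/p}$, where $m_\infty$ is the Haar probability measure on the infinite torus $\mathbb{T}^\infty$. In particular $\mathscr{H}^2$ consists of the series $\sum a_nn^{-s}$ with $\sum|a_n|^2<\infty$. For $\sigma\ge0$, $P_\sigma(s)=P(s+\sigma)$. For $0<p,q<\infty$ and $\alpha>-1$, the mixed norm space $\mathscr{H}^{p,q}_\alpha$ is the completion of $\mathcal{P}$ with respect to the (quasi-)norm $\|P\|_{\mathscr{H}^{p,q}_\alpha}=\left(\int_0^{+\infty}\|P_\sigma\|_{\mathscr{H}^p}^q\,d\mu_\alpha(\sigma)\right)^{1/q}$, where $d\mu_\alpha(\sigma)=\frac{2^{\alpha+1}}{\Gamma(\alpha+1)}\sigma^\alpha e^{-2\sigma}d\sigma$. The Bergman space is $\mathcal{A}^p_\alpha=\mathscr{H}^{p,p}_\alpha$. Elements of all these spaces are identified with Dirichlet series in $\mathcal{D}$ converging on $\mathbb{C}_{1/2}$. *)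

theory Defs
  imports "HOL-Probability.Probability" "HOL-Number_Theory.Number_Theory"
begin

text \<open>
  A Dirichlet series \<open>\<Sum>n\<ge>1. a\<^sub>n n\<^sup>-\<^sup>s\<close> is represented by its coefficient sequence
  \<open>a :: nat \<Rightarrow> complex\<close>; the value \<open>a 0\<close> is never used (note that \<open>0 powr s = 0\<close>).
\<close>

definition dirichlet_converges :: "(nat \<Rightarrow> complex) \<Rightarrow> complex \<Rightarrow> bool" where
  "dirichlet_converges a s \<longleftrightarrow> summable (\<lambda>n. a n * of_nat n powr (- s))"

definition dirichlet_series_space :: "(nat \<Rightarrow> complex) set" where
  "dirichlet_series_space = {a. \<exists>\<theta>::real. \<forall>s. Re s > \<theta> \<longrightarrow> dirichlet_converges a s}"

definition dirichlet_polynomials :: "(nat \<Rightarrow> complex) set" where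
  "dirichlet_polynomials = {a. finite {n. 1 \<le> n \<and> a n \<noteq> 0}}"

text \<open>Coefficients of \<open>s \<mapsto> P (s + \<sigma>)\<close>, since \<open>n\<^sup>-\<^sup>(\<^sup>s\<^sup>+\<^sup>\<sigma>\<^sup>) = n\<^sup>-\<^sup>\<sigma> n\<^sup>-\<^sup>s\<close>.\<close>

definition dirichlet_shift :: "real \<Rightarrow> (nat \<Rightarrow> complex) \<Rightarrow> nat \<Rightarrow> complex" where
  "dirichlet_shift \<sigma> a n = a n * of_real (real n powr (- \<sigma>))"

text \<open>The primes are enumerated from index 0: \<open>nth_prime 0 = 2\<close>.\<close>

definition nth_prime :: "nat \<Rightarrow> nat" where
  "nth_prime = enumerate {p. prime p}"

definition bohr_monomial :: "nat \<Rightarrow> (nat \<Rightarrow> complex) \<Rightarrow> complex" where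
  "bohr_monomial n z = (\<Prod>j | nth_prime j dvd n. z j ^ multiplicity (nth_prime j) n)"

definition bohr_lift :: "(nat \<Rightarrow> complex) \<Rightarrow> (nat \<Rightarrow> complex) \<Rightarrow> complex" where
  "bohr_lift a z = (\<Sum>n | 1 \<le> n \<and> a n \<noteq> 0. a n * bohr_monomial n z)"

text \<open>
  The uniform law on the unit circle, as a Borel measure on the plane. The Haar probability
  measure on the infinite torus is the product of countably many copies of it.
\<close>

definition circle_law :: "complex measure" where
  "circle_law = distr (uniform_measure lborel {0..2 * pi}) borel cis"

definition torus_haar :: "(nat \<Rightarrow> complex) measure" where
  "torus_haar = Pi\<^sub>M UNIV (\<lambda>_. circle_law)"

definition hardy_norm :: "real \<Rightarrow> (nat \<Rightarrow> complex) \<Rightarrow> real" where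
  "hardy_norm p P = (LINT z|torus_haar. norm (bohr_lift P z) powr p) powr (1 / p)"

definition mu_measure :: "real \<Rightarrow> real measure" where
  "mu_measure \<alpha> = density lborel (\<lambda>\<sigma>. ennreal (indicator {0<..} \<sigma> *
     (2 powr (\<alpha> + 1) / Gamma (\<alpha> + 1) * \<sigma> powr \<alpha> * exp (- 2 * \<sigma>))))"

definition mixed_norm :: "real \<Rightarrow> real \<Rightarrow> real \<Rightarrow> (nat \<Rightarrow> complex) \<Rightarrow> real" where
  "mixed_norm p q \<alpha> P =
     (LINT \<sigma>|mu_measure \<alpha>. hardy_norm p (dirichlet_shift \<sigma> P) powr q) powr (1 / q)"

text \<open>
  The completion of the Dirichlet polynomials with respect to a (quasi-)norm \<open>N\<close>, realised as
  a space of Dirichlet series converging on \<open>Re s > 1/2\<close>: the element of the completion given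
  by an \<open>N\<close>-Cauchy sequence of polynomials is identified with the Dirichlet series whose
  coefficients are the limits of the coefficients of the polynomials.
\<close>

definition dirichlet_completion :: "((nat \<Rightarrow> complex) \<Rightarrow> real) \<Rightarrow> (nat \<Rightarrow> complex) set" where
  "dirichlet_completion N =
     {a. (\<forall>s. Re s > 1 / 2 \<longrightarrow> dirichlet_converges a s) \<and>
         (\<exists>P :: nat \<Rightarrow> nat \<Rightarrow> complex.
            (\<forall>k. P k \<in> dirichlet_polynomials) \<and>
            (\<forall>\<epsilon>>0. \<exists>K. \<forall>j\<ge>K. \<forall>k\<ge>K. N (\<lambda>n. P j n - P k n) < \<epsilon>) \<and>
            (\<forall>n\<ge>1. (\<lambda>k. P k n) \<longlonglongrightarrow> a n))}"

definition hardy_space :: "real \<Rightarrow> (nat \<Rightarrow> complex) set" where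
  "hardy_space p = dirichlet_completion (hardy_norm p)"

definition mixed_norm_space :: "real \<Rightarrow> real \<Rightarrow> real \<Rightarrow> (nat \<Rightarrow> complex) set" where
  "mixed_norm_space p q \<alpha> = dirichlet_completion (mixed_norm p q \<alpha>)"

definition bergman_space :: "real \<Rightarrow> real \<Rightarrow> (nat \<Rightarrow> complex) set" where
  "bergman_space p \<alpha> = mixed_norm_space p p \<alpha>"

text \<open>
  The three admissible laws of the random variables, all viewed as laws on the complex plane;
  the Gaussian one is the real standard normal law.
\<close>

definition bernoulli_law :: "complex measure" where
  "bernoulli_law = distr (measure_pmf (pmf_of_set {1, - 1})) borel (\<lambda>x. x)"

definition gaussian_law :: "complex measure" where
  "gaussian_law = distr (density lborel (\<lambda>x. ennreal (std_normal_density x))) borel complex_of_real"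

definition standard_random_sequence :: "'a measure \<Rightarrow> (nat \<Rightarrow> 'a \<Rightarrow> complex) \<Rightarrow> bool" where
  "standard_random_sequence M X \<longleftrightarrow>
     prob_space M \<and>
     prob_space.indep_vars M (\<lambda>_. borel) X {1..} \<and>
     (\<exists>L \<in> {bernoulli_law, circle_law, gaussian_law}. \<forall>n\<ge>1. distr M borel (X n) = L)"

definition randomization ::
    "(nat \<Rightarrow> 'a \<Rightarrow> complex) \<Rightarrow> (nat \<Rightarrow> complex) \<Rightarrow> 'a \<Rightarrow> nat \<Rightarrow> complex" where
  "randomization X a \<omega> = (\<lambda>n. a n * X n \<omega>)"

end

theory Submission
  imports Defs "HOL-Computational_Algebra.Fundamental_Theorem_Algebra"
begin

text \<open>
  Both statements are instances of one: for a finite measure \<open>\<kappa>\<close> on \<open>[0, \<infinity>)\<close> with 0 in its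
  support (the point mass at 0, respectively \<open>\<mu>\<^sub>\<alpha>\<close>), the randomized series lies almost surely in the
  completion for \<open>\<integral> \<parallel>P\<^sub>\<sigma>\<parallel>\<^sub>p\<^sup>p d\<kappa>(\<sigma>)\<close> if and only if the integral of \<open>(\<Sum>n. |a\<^sub>n|\<^sup>2 n\<^sup>-\<^sup>2\<^sup>\<sigma>)\<^bsup>p/2\<^esup>\<close>
  with respect to \<open>\<kappa>\<close> is finite.

  Khinchin's inequality and Fubini's theorem show that the partial sums of the randomized series are
  Cauchy in the mean, hence almost surely along a subsequence, which gives sufficiency.

  For necessity one needs finitely supported multipliers that tend to 1 and are uniformly bounded
  for the norm. For \<open>p < 1\<close> there is no duality, and only the analytic structure helps. Grading the
  monomials by the sum of the prime factors of \<open>n\<close> lets the circle act on the torus, preserving Haar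
  measure and with finite-dimensional isotypic components. Subharmonicity of \<open>|\<phi>|\<^sup>p\<close> on the orbits makes
  dilations contractive and bounds the homogeneous components polynomially, so dilations can be
  truncated. Applied to a randomized series that lies almost surely in the space, they give polynomials with
  norms bounded on an event of probability close to 1, and Khinchin's lower bound on that event concludes.
\<close>

section \<open>Rotation invariance and orthogonality on the torus\<close>

text \<open>Membership in a completion provides some Cauchy sequence of polynomials, depending on
  the random point in no controlled way. A finitely supported multiplier applied to its
  coefficientwise limit gives a polynomial in finitely many of the random variables: its norm is
  measurable in the random point and, by Fatou's lemma, controlled by the norms of the approximants.

  The norm of the randomized series has no expectation known to be finite. Khinchin's lower bound is
  therefore proved as a Paley-Zygmund estimate: a random sum reaches half of its L2 norm with
  probability at least 1/(2K), K being the fourth-moment constant. An event of probability at least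
  1 - 1/(4K) keeps 1/(4K) of this, and the same event serves all points of the torus and all shifts.

  Equal inner and outer exponents p make the p-th power of the norm a double integral, which
  Tonelli's theorem exchanges with the expectation. Subharmonicity comes from factoring polynomials:
  Jensen's formula for linear factors, with a Moebius map in place of the Poisson kernel.\<close>

lemma sets_circle_law [measurable_cong, simp]: "sets circle_law = sets borel"
  by (simp add: circle_law_def)

lemma space_circle_law [simp]: "space circle_law = UNIV"
  by (simp add: circle_law_def)

lemma borel_measurable_cis [measurable]: "cis \<in> borel_measurable borel"
  by (simp add: borel_measurable_continuous_onI continuous_on_cis continuous_on_id)

lemma prob_space_circle_law: "prob_space circle_law"
proof -
  have "prob_space (uniform_measure lborel {0..2 * pi})"
    by (rule prob_space_uniform_measure) auto
  moreover have "cis \<in> measurable (uniform_measure lborel {0..2 * pi}) borel"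
    by measurable
  ultimately show ?thesis
    unfolding circle_law_def by (intro prob_space.prob_space_distr)
qed

lemma borel_measurable_cnj [measurable]: "cnj \<in> borel_measurable borel"
  by (intro borel_measurable_continuous_onI continuous_intros)

lemma AE_circle_law: "AE x in circle_law. norm x = 1"
  unfolding circle_law_def by (subst AE_distr_iff) auto

text \<open>The half-open interval is what can be cut and wrapped around without overlap in the
  proof of rotation invariance.\<close>

lemma nn_integral_circle_law:
  assumes [measurable]: "g \<in> borel_measurable borel"
  shows "(\<integral>\<^sup>+x. g x \<partial>circle_law)
           = (\<integral>\<^sup>+\<theta>. g (cis \<theta>) * indicator {0..<2 * pi} \<theta> \<partial>lborel) / ennreal (2 * pi)"
proof -
  have "(\<integral>\<^sup>+x. g x \<partial>circle_law) = (\<integral>\<^sup>+\<theta>. g (cis \<theta>) \<partial>uniform_measure lborel {0..2 * pi})"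
    unfolding circle_law_def by (subst nn_integral_distr) auto
  also have "\<dots> = (\<integral>\<^sup>+\<theta>. g (cis \<theta>) * indicator {0..2 * pi} \<theta> \<partial>lborel) / ennreal (2 * pi)"
    by (subst nn_integral_uniform_measure) auto
  also have "(\<integral>\<^sup>+\<theta>. g (cis \<theta>) * indicator {0..2 * pi} \<theta> \<partial>lborel)
           = (\<integral>\<^sup>+\<theta>. g (cis \<theta>) * indicator {0..<2 * pi} \<theta> \<partial>lborel)"
  proof (intro nn_integral_cong_AE)
    show "AE \<theta> in lborel. g (cis \<theta>) * indicator {0..2 * pi} \<theta> = g (cis \<theta>) * indicator {0..<2 * pi} \<theta>"
      using AE_lborel_singleton[of "2 * pi"]
      by eventually_elim (auto simp: indicator_def)
  qed
  finally show ?thesis .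
qed

text \<open>Rotating by the angle \<open>t\<close> moves the window of integration to [t, t + 2 pi);
  the part beyond 2 pi is brought back by one period of \<open>cis\<close>.\<close>

lemma nn_integral_circle_law_rotate:
  fixes u :: complex
  assumes u: "norm u = 1" and [measurable]: "g \<in> borel_measurable borel"
  shows "(\<integral>\<^sup>+x. g (u * x) \<partial>circle_law) = (\<integral>\<^sup>+x. g x \<partial>circle_law)"
proof -
  define t where "t = Arg2pi u"
  have t: "0 \<le> t" "t < 2 * pi" "u = cis t"
    using Arg2pi[of u] u by (auto simp: t_def cis_conv_exp is_Arg_def mult.commute)
  let ?h = "\<lambda>\<theta>. g (cis \<theta>)"
  have shift: "(\<integral>\<^sup>+\<theta>. f (\<theta> + c) \<partial>lborel) = (\<integral>\<^sup>+\<theta>. f \<theta> \<partial>lborel)"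
    if [measurable]: "f \<in> borel_measurable borel" for f :: "real \<Rightarrow> ennreal" and c
    using nn_integral_real_affine[of f 1 c] by (simp add: add.commute)
  have "(\<integral>\<^sup>+\<theta>. g (u * cis \<theta>) * indicator {0..<2 * pi} \<theta> \<partial>lborel)
      = (\<integral>\<^sup>+\<theta>. ?h (\<theta> + t) * indicator {t..<t + 2 * pi} (\<theta> + t) \<partial>lborel)"
    by (intro nn_integral_cong) (auto simp: t cis_mult add.commute indicator_def)
  also have "\<dots> = (\<integral>\<^sup>+\<theta>. ?h \<theta> * indicator {t..<t + 2 * pi} \<theta> \<partial>lborel)"
    by (rule shift) measurable
  also have "\<dots> = (\<integral>\<^sup>+\<theta>. ?h \<theta> * indicator {t..<2 * pi} \<theta> + ?h \<theta> * indicator {2 * pi..<t + 2 * pi} \<theta> \<partial>lborel)"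
    using t by (intro nn_integral_cong) (auto simp: indicator_def)
  also have "\<dots> = (\<integral>\<^sup>+\<theta>. ?h \<theta> * indicator {t..<2 * pi} \<theta> \<partial>lborel)
                 + (\<integral>\<^sup>+\<theta>. ?h \<theta> * indicator {2 * pi..<t + 2 * pi} \<theta> \<partial>lborel)"
    by (subst nn_integral_add) auto
  also have "(\<integral>\<^sup>+\<theta>. ?h \<theta> * indicator {2 * pi..<t + 2 * pi} \<theta> \<partial>lborel)
      = (\<integral>\<^sup>+\<theta>. ?h (\<theta> + 2 * pi) * indicator {2 * pi..<t + 2 * pi} (\<theta> + 2 * pi) \<partial>lborel)"
    by (rule shift[symmetric]) measurable
  also have "\<dots> = (\<integral>\<^sup>+\<theta>. ?h \<theta> * indicator {0..<t} \<theta> \<partial>lborel)"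
    by (intro nn_integral_cong) (auto simp: indicator_def cis.ctr)
  also have "(\<integral>\<^sup>+\<theta>. ?h \<theta> * indicator {t..<2 * pi} \<theta> \<partial>lborel) + \<dots>
      = (\<integral>\<^sup>+\<theta>. ?h \<theta> * indicator {t..<2 * pi} \<theta> + ?h \<theta> * indicator {0..<t} \<theta> \<partial>lborel)"
    by (subst nn_integral_add) auto
  also have "\<dots> = (\<integral>\<^sup>+\<theta>. ?h \<theta> * indicator {0..<2 * pi} \<theta> \<partial>lborel)"
    using t by (intro nn_integral_cong) (auto simp: indicator_def)
  finally show ?thesis
    by (simp add: nn_integral_circle_law)
qed

lemma distr_circle_law_rotate:
  assumes "norm u = 1"
  shows "distr circle_law circle_law (\<lambda>x. u * x) = circle_law"
proof (rule measure_eqI)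
  fix A assume "A \<in> sets (distr circle_law circle_law ((*) u))"
  then have [measurable]: "A \<in> sets borel" by simp
  have "emeasure (distr circle_law circle_law ((*) u)) A = (\<integral>\<^sup>+x. indicator A (u * x) \<partial>circle_law)"
    by (subst nn_integral_indicator[symmetric], simp) (subst nn_integral_distr, auto)
  also have "\<dots> = emeasure circle_law A"
    by (subst nn_integral_circle_law_rotate) (auto simp: assms)
  finally show "emeasure (distr circle_law circle_law ((*) u)) A = emeasure circle_law A" .
qed simp

lemma prob_space_torus_haar: "prob_space torus_haar"
  unfolding torus_haar_def by (intro prob_space_PiM prob_space_circle_law)

lemma sets_torus_haar [measurable_cong]: "sets torus_haar = sets (Pi\<^sub>M UNIV (\<lambda>_. borel))"
  unfolding torus_haar_def by (intro sets_PiM_cong) auto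

lemma space_torus_haar [simp]: "space torus_haar = UNIV"
  by (simp add: torus_haar_def space_PiM PiE_UNIV_domain)

lemma AE_torus_haar: "AE z in torus_haar. \<forall>j. norm (z j) = 1"
  unfolding torus_haar_def AE_all_countable
  by (intro allI AE_PiM_component prob_space_circle_law AE_circle_law) auto

text \<open>A product measure is determined by its values on finite cylinders, where the claim
  reduces to invariance in each coordinate.\<close>

lemma distr_torus_haar_rotate:
  assumes u: "\<And>j. norm (u j) = 1"
  shows "distr torus_haar torus_haar (\<lambda>z j. u j * z j) = torus_haar"
proof -
  have "torus_haar = distr torus_haar torus_haar (\<lambda>z j. u j * z j)"
  proof (unfold torus_haar_def, rule measure_eqI_PiM_infinite[OF refl])
    show "finite_measure (Pi\<^sub>M (UNIV :: nat set) (\<lambda>_. circle_law))"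
      using prob_space_torus_haar unfolding torus_haar_def prob_space_def by blast
    fix J :: "nat set" and A :: "nat \<Rightarrow> complex set"
    assume J: "finite J" and A: "\<And>i. i \<in> J \<Longrightarrow> A i \<in> sets circle_law"
    let ?B = "\<lambda>i. (\<lambda>x. u i * x) -` A i"
    have B: "?B i \<in> sets circle_law" if "i \<in> J" for i
      using measurable_sets[of "\<lambda>x. u i * x" circle_law circle_law "A i"] A[OF that] by simp
    have pre: "(\<lambda>z j. u j * z j) -` prod_emb UNIV (\<lambda>_. circle_law) J (Pi\<^sub>E J A) \<inter> space (Pi\<^sub>M UNIV (\<lambda>_. circle_law))
        = prod_emb UNIV (\<lambda>_. circle_law) J (Pi\<^sub>E J ?B)"
      by (auto simp: prod_emb_def space_PiM PiE_iff)
    have "emeasure (distr (Pi\<^sub>M UNIV (\<lambda>_. circle_law)) (Pi\<^sub>M UNIV (\<lambda>_. circle_law)) (\<lambda>z j. u j * z j))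
            (prod_emb UNIV (\<lambda>_. circle_law) J (Pi\<^sub>E J A))
        = emeasure (Pi\<^sub>M UNIV (\<lambda>_. circle_law)) (prod_emb UNIV (\<lambda>_. circle_law) J (Pi\<^sub>E J ?B))"
      using J A by (subst emeasure_distr) (auto simp: pre intro!: sets_PiM_I measurable_PiM_single')
    also have "\<dots> = (\<Prod>i\<in>J. emeasure circle_law (?B i))"
      using J B by (intro emeasure_PiM_emb prob_space_circle_law) auto
    also have "\<dots> = (\<Prod>i\<in>J. emeasure (distr circle_law circle_law (\<lambda>x. u i * x)) (A i))"
      using A by (intro prod.cong) (auto simp: emeasure_distr)
    also have "\<dots> = (\<Prod>i\<in>J. emeasure circle_law (A i))"
      using u by (simp add: distr_circle_law_rotate)
    also have "\<dots> = emeasure (Pi\<^sub>M UNIV (\<lambda>_. circle_law)) (prod_emb UNIV (\<lambda>_. circle_law) J (Pi\<^sub>E J A))"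
      using J A by (intro emeasure_PiM_emb[symmetric] prob_space_circle_law) auto
    finally show "emeasure (Pi\<^sub>M UNIV (\<lambda>_. circle_law)) (prod_emb UNIV (\<lambda>_. circle_law) J (Pi\<^sub>E J A))
       = emeasure (distr (Pi\<^sub>M UNIV (\<lambda>_. circle_law)) (Pi\<^sub>M UNIV (\<lambda>_. circle_law)) (\<lambda>z j. u j * z j))
            (prod_emb UNIV (\<lambda>_. circle_law) J (Pi\<^sub>E J A))" ..
  qed simp
  then show ?thesis ..
qed

lemma measurable_rotate_torus_haar [measurable]:
  "(\<lambda>z j. u j * z j) \<in> measurable torus_haar torus_haar"
  unfolding torus_haar_def by (rule measurable_PiM_single') auto

lemma nn_integral_torus_haar_rotate:
  assumes "\<And>j. norm (u j) = 1" and [measurable]: "g \<in> borel_measurable torus_haar"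
  shows "(\<integral>\<^sup>+z. g (\<lambda>j. u j * z j) \<partial>torus_haar) = (\<integral>\<^sup>+z. g z \<partial>torus_haar)"
proof -
  have "(\<integral>\<^sup>+z. g z \<partial>torus_haar) = (\<integral>\<^sup>+z. g z \<partial>distr torus_haar torus_haar (\<lambda>z j. u j * z j))"
    by (simp add: distr_torus_haar_rotate assms)
  also have "\<dots> = (\<integral>\<^sup>+z. g (\<lambda>j. u j * z j) \<partial>torus_haar)"
    by (rule nn_integral_distr) auto
  finally show ?thesis ..
qed

lemma integral_torus_haar_rotate:
  fixes g :: "_ \<Rightarrow> complex"
  assumes "\<And>j. norm (u j) = 1" and [measurable]: "g \<in> borel_measurable torus_haar"
  shows "(\<integral>z. g (\<lambda>j. u j * z j) \<partial>torus_haar) = (\<integral>z. g z \<partial>torus_haar)"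
proof -
  have "(\<integral>z. g z \<partial>torus_haar) = (\<integral>z. g z \<partial>distr torus_haar torus_haar (\<lambda>z j. u j * z j))"
    by (simp add: distr_torus_haar_rotate assms)
  also have "\<dots> = (\<integral>z. g (\<lambda>j. u j * z j) \<partial>torus_haar)"
    by (rule integral_distr) auto
  finally show ?thesis ..
qed

section \<open>Bohr monomials as orthonormal characters of the torus\<close>

lemma prime_nth_prime: "prime (nth_prime j)"
  unfolding nth_prime_def using enumerate_in_set[OF primes_infinite, of j] by simp

lemma inj_nth_prime: "inj nth_prime"
  unfolding nth_prime_def by (intro strict_mono_imp_inj_on strict_mono_enumerate primes_infinite)

lemma prime_imp_nth_prime: "prime q \<Longrightarrow> \<exists>j. q = nth_prime j"
  unfolding nth_prime_def using enumerate_Ex[OF primes_infinite, of q] by (metis mem_Collect_eq)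

lemma bohr_monomial_rotate:
  "bohr_monomial n (\<lambda>j. u j * z j) = bohr_monomial n u * bohr_monomial n z"
  by (simp add: bohr_monomial_def power_mult_distrib prod.distrib)

lemma norm_bohr_monomial: "(\<And>j. norm (z j) = 1) \<Longrightarrow> norm (bohr_monomial n z) = 1"
  by (simp add: bohr_monomial_def prod_norm[symmetric] norm_power)

lemma bohr_monomial_prod:
  assumes "0 < n"
  shows "bohr_monomial n (\<lambda>j. h (nth_prime j)) = (\<Prod>q\<in>prime_factors n. h q ^ multiplicity q n)"
  unfolding bohr_monomial_def
proof (rule prod.reindex_bij_betw[of nth_prime _ _ "\<lambda>q. h q ^ multiplicity q n"], unfold bij_betw_def, intro conjI)
  show "inj_on nth_prime {j. nth_prime j dvd n}"
    using inj_nth_prime by (rule inj_on_subset) auto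
  show "nth_prime ` {j. nth_prime j dvd n} = prime_factors n"
    using assms prime_imp_nth_prime prime_nth_prime by (auto simp: prime_factors_dvd)
qed

text \<open>Gives the value of a monomial at the torus points used for rotations. It is applied to
  n^(it) for orthogonality and to \<open>w ^ grade n\<close> for the circle action.\<close>

lemma bohr_monomial_completely_multiplicative:
  fixes h :: "nat \<Rightarrow> complex"
  assumes h1: "h 1 = 1" and hm: "\<And>m n. 0 < m \<Longrightarrow> 0 < n \<Longrightarrow> h (m * n) = h m * h n" and "0 < n"
  shows "bohr_monomial n (\<lambda>j. h (nth_prime j)) = h n"
proof -
  have pow: "h (q ^ k) = h q ^ k" if "0 < q" for q k
    by (induction k) (use h1 hm that in auto)
  have pr: "h (\<Prod>q\<in>A. f q) = (\<Prod>q\<in>A. h (f q))" if "finite A" "\<And>q. q \<in> A \<Longrightarrow> 0 < f q" for A and f :: "nat \<Rightarrow> nat"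
    using that
  proof (induction A rule: finite_induct)
    case empty
    then show ?case using h1 by simp
  next
    case (insert x A)
    then have "h (f x * prod f A) = h (f x) * h (prod f A)"
      by (intro hm) (auto intro!: prod_pos)
    with insert show ?case by simp
  qed
  have "h n = h (\<Prod>q\<in>prime_factors n. q ^ multiplicity q n)"
    using prime_factorization_nat[OF \<open>0 < n\<close>] by simp
  also have "\<dots> = (\<Prod>q\<in>prime_factors n. h (q ^ multiplicity q n))"
    by (rule pr) (auto dest!: in_prime_factors_imp_prime prime_gt_0_nat)
  also have "\<dots> = (\<Prod>q\<in>prime_factors n. h q ^ multiplicity q n)"
    by (intro prod.cong refl pow) (auto dest!: in_prime_factors_imp_prime prime_gt_0_nat)
  finally show ?thesis
    using bohr_monomial_prod[OF \<open>0 < n\<close>, of h] by simp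
qed

lemma borel_measurable_bohr_monomial [measurable]: "bohr_monomial n \<in> borel_measurable torus_haar"
  unfolding bohr_monomial_def by measurable

lemma bohr_lift_sum:
  assumes "finite S" "S \<subseteq> {1..}" "\<And>n. 1 \<le> n \<Longrightarrow> n \<notin> S \<Longrightarrow> a n = 0"
  shows "bohr_lift a z = (\<Sum>n\<in>S. a n * bohr_monomial n z)"
  unfolding bohr_lift_def using assms by (intro sum.mono_neutral_left) auto

lemma borel_measurable_bohr_lift [measurable]: "bohr_lift a \<in> borel_measurable torus_haar"
  unfolding bohr_lift_def by measurable

text \<open>For distinct \<open>m\<close> and \<open>n\<close> the rotation by the values of n^(it)
  at the primes, with t making (m/n)^(it) = -1, preserves Haar measure and changes the sign of the
  integrand. The integral is thus its own negative.\<close>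

lemma integral_bohr_monomial:
  assumes "0 < m" "0 < n"
  shows "(\<integral>z. bohr_monomial m z * cnj (bohr_monomial n z) \<partial>torus_haar) = (if m = n then 1 else 0)"
proof (cases "m = n")
  case True
  interpret prob_space torus_haar by (rule prob_space_torus_haar)
  have "(\<integral>z. bohr_monomial m z * cnj (bohr_monomial n z) \<partial>torus_haar) = (\<integral>z. 1 \<partial>torus_haar)"
  proof (intro integral_cong_AE)
    show "AE z in torus_haar. bohr_monomial m z * cnj (bohr_monomial n z) = 1"
      using AE_torus_haar
    proof eventually_elim
      case (elim z)
      then have "norm (bohr_monomial n z) = 1" by (intro norm_bohr_monomial) auto
      then show ?case using True by (simp add: complex_norm_square[symmetric])
    qed
  qed auto
  also have "\<dots> = 1" using prob_space by simp
  finally show ?thesis using True by simp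
next
  case False
  define t where "t = pi / (ln m - ln n)"
  define h where "h k = cis (t * ln (real k))" for k :: nat
  define u where "u j = h (nth_prime j)" for j
  have mon: "bohr_monomial k u = h k" if "0 < k" for k
    unfolding u_def using that
    by (intro bohr_monomial_completely_multiplicative) (auto simp: h_def ln_mult ring_distribs cis_mult)
  have "ln (real m) - ln (real n) \<noteq> 0" using False assms by auto
  then have "t * ln m = t * ln n + pi" by (simp add: t_def field_simps)
  then have neg: "h m = - h n" by (simp add: h_def cis.ctr complex_eq_iff)
  have hn: "h n * cnj (h n) = 1" by (simp add: h_def cis_cnj cis_mult)
  let ?g = "\<lambda>z. bohr_monomial m z * cnj (bohr_monomial n z)"
  have "(\<integral>z. ?g z \<partial>torus_haar) = (\<integral>z. ?g (\<lambda>j. u j * z j) \<partial>torus_haar)"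
    by (rule integral_torus_haar_rotate[symmetric]) (auto simp: u_def h_def)
  also have "\<dots> = (\<integral>z. - ?g z \<partial>torus_haar)"
  proof (rule Bochner_Integration.integral_cong[OF refl])
    fix z
    have "?g (\<lambda>j. u j * z j) = - (h n * cnj (h n)) * ?g z"
      using assms by (simp add: bohr_monomial_rotate mon neg)
    then show "?g (\<lambda>j. u j * z j) = - ?g z" using hn by simp
  qed
  finally have "(\<integral>z. ?g z \<partial>torus_haar) = - (\<integral>z. ?g z \<partial>torus_haar)" by simp
  then show ?thesis using False by simp
qed

lemma integral_norm_bohr_lift_square:
  assumes S: "finite S" "S \<subseteq> {1..}" "\<And>n. 1 \<le> n \<Longrightarrow> n \<notin> S \<Longrightarrow> a n = 0"
  shows "(\<integral>z. (norm (bohr_lift a z))\<^sup>2 \<partial>torus_haar) = (\<Sum>n\<in>S. (norm (a n))\<^sup>2)"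
proof -
  interpret prob_space torus_haar by (rule prob_space_torus_haar)
  have int: "integrable torus_haar (\<lambda>z. bohr_monomial m z * cnj (bohr_monomial n z))" for m n
  proof (rule integrable_const_bound[of _ 1])
    show "AE z in torus_haar. norm (bohr_monomial m z * cnj (bohr_monomial n z)) \<le> 1"
      using AE_torus_haar by eventually_elim (simp add: norm_mult norm_bohr_monomial)
  qed auto
  have lift: "bohr_lift a z = (\<Sum>n\<in>S. a n * bohr_monomial n z)" for z
    using S by (intro bohr_lift_sum) auto
  have eq: "complex_of_real ((norm (bohr_lift a z))\<^sup>2)
     = (\<Sum>m\<in>S. \<Sum>n\<in>S. a m * cnj (a n) * (bohr_monomial m z * cnj (bohr_monomial n z)))" for z
    unfolding complex_norm_square lift cnj_sum sum_product by (simp add: algebra_simps)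
  have "complex_of_real (\<integral>z. (norm (bohr_lift a z))\<^sup>2 \<partial>torus_haar)
     = (\<integral>z. complex_of_real ((norm (bohr_lift a z))\<^sup>2) \<partial>torus_haar)"
    by (rule integral_complex_of_real[symmetric])
  also have "\<dots> = (\<Sum>m\<in>S. \<Sum>n\<in>S. a m * cnj (a n) * (if m = n then 1 else 0))"
  proof -
    have "0 < n" if "n \<in> S" for n using S(2) that by force
    then have "(\<integral>z. bohr_monomial m z * cnj (bohr_monomial n z) \<partial>torus_haar) = (if m = n then 1 else 0)"
      if "m \<in> S" "n \<in> S" for m n
      using that by (intro integral_bohr_monomial) auto
    then show ?thesis
      unfolding eq using int by (simp add: Bochner_Integration.integral_sum cong: sum.cong)
  qed
  also have "\<dots> = complex_of_real (\<Sum>n\<in>S. (norm (a n))\<^sup>2)"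
    using S(1) by (simp add: if_distrib sum.If_cases complex_norm_square[symmetric] cong: if_cong)
  finally show ?thesis by (simp only: of_real_eq_iff)
qed

section \<open>Subharmonicity in the unit disc\<close>

lemma one_plus_nonzero: "norm y < 1 \<Longrightarrow> 1 + y \<noteq> 0" for y :: complex
proof
  assume "norm y < 1" "1 + y = 0"
  then have "y = - 1" by (simp add: add_eq_0_iff)
  then show False using \<open>norm y < 1\<close> by simp
qed

lemma integral_circle_law_rotate:
  fixes g :: "complex \<Rightarrow> real"
  assumes "norm u = 1" and [measurable]: "g \<in> borel_measurable borel"
  shows "(\<integral>x. g (u * x) \<partial>circle_law) = (\<integral>x. g x \<partial>circle_law)"
proof -
  have "(\<integral>x. g x \<partial>circle_law) = (\<integral>x. g x \<partial>distr circle_law circle_law (\<lambda>x. u * x))"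
    by (simp add: distr_circle_law_rotate assms)
  also have "\<dots> = (\<integral>x. g (u * x) \<partial>circle_law)"
    by (rule integral_distr) auto
  finally show ?thesis ..
qed

lemma integrable_circle_law_bounded:
  fixes g :: "complex \<Rightarrow> real"
  assumes [measurable]: "g \<in> borel_measurable borel" and "\<And>x. norm x = 1 \<Longrightarrow> \<bar>g x\<bar> \<le> B"
  shows "integrable circle_law g"
proof -
  interpret prob_space circle_law by (rule prob_space_circle_law)
  show ?thesis
  proof (rule integrable_const_bound[of _ B])
    show "AE x in circle_law. norm (g x) \<le> B"
      using AE_circle_law by eventually_elim (use assms in auto)
  qed auto
qed

lemma abs_ln_norm_one_plus_le:
  fixes c y :: complex
  assumes "norm c \<le> \<rho>" "\<rho> < 1" "norm y = 1"
  shows "\<bar>ln (norm (1 + c * y))\<bar> \<le> ln 2 - ln (1 - \<rho>)"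
proof -
  have "norm (c * y) \<le> \<rho>" using assms by (simp add: norm_mult)
  moreover have "norm (1 + c * y) \<le> 1 + norm (c * y)" "1 - norm (c * y) \<le> norm (1 + c * y)"
    using norm_triangle_ineq[of 1 "c * y"] norm_diff_ineq[of 1 "c * y"] by auto
  ultimately have *: "1 - \<rho> \<le> norm (1 + c * y)" "norm (1 + c * y) \<le> 2" using assms by auto
  then have "ln (1 - \<rho>) \<le> ln (norm (1 + c * y))" "ln (norm (1 + c * y)) \<le> ln 2"
    using assms by (auto intro!: ln_mono simp del: ln_le_cancel_iff)
  moreover have "0 \<le> \<rho>" using assms(1) norm_ge_zero order_trans by blast
  then have "ln (1 - \<rho>) \<le> 0" "0 \<le> ln (2::real)" using assms by auto
  ultimately show ?thesis by linarith
qed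

text \<open>
  Replacing \<open>x\<close> by a rotation of it changes the sign of \<open>c x\<^sup>M\<close>, and the product of
  \<open>1 + c x\<^sup>M\<close> and \<open>1 - c x\<^sup>M\<close> has the same form with exponent \<open>2 M\<close>. Iterating, the mean is
  divided by 2 at each step while staying bounded.
\<close>

lemma integral_ln_norm_one_plus:
  assumes "norm b < 1"
  shows "(\<integral>x. ln (norm (1 + b * x)) \<partial>circle_law) = 0"
proof -
  define \<rho> where "\<rho> = norm b"
  have \<rho>: "0 \<le> \<rho>" "\<rho> < 1" using assms by (auto simp: \<rho>_def)
  define K where "K = ln 2 - ln (1 - \<rho>)"
  define I where "I c M = (\<integral>x. ln (norm (1 + c * x ^ M)) \<partial>circle_law)" for c and M :: nat
  have int: "integrable circle_law (\<lambda>x. ln (norm (1 + c * x ^ M)))" if "norm c \<le> \<rho>" for c M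
    by (rule integrable_circle_law_bounded[of _ K])
       (use that \<rho> in \<open>auto simp: K_def norm_power intro!: abs_ln_norm_one_plus_le\<close>)
  have half: "I c M = I (- c\<^sup>2) (2 * M) / 2" if c: "norm c \<le> \<rho>" and M: "0 < M" for c M
  proof -
    have "cis (pi / M) ^ M = - 1" using M by (simp add: Complex.DeMoivre)
    then have "I (- c) M = (\<integral>x. ln (norm (1 + c * (cis (pi / M) * x) ^ M)) \<partial>circle_law)"
      by (simp add: I_def power_mult_distrib)
    also have "\<dots> = I c M"
      unfolding I_def by (rule integral_circle_law_rotate) auto
    finally have "2 * I c M = I c M + I (- c) M" by simp
    also have "\<dots> = (\<integral>x. ln (norm (1 + c * x ^ M)) + ln (norm (1 + (- c) * x ^ M)) \<partial>circle_law)"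
      unfolding I_def using c by (intro Bochner_Integration.integral_add[symmetric] int) auto
    also have "\<dots> = I (- c\<^sup>2) (2 * M)"
      unfolding I_def
    proof (intro integral_cong_AE)
      show "AE x in circle_law. ln (norm (1 + c * x ^ M)) + ln (norm (1 + (- c) * x ^ M))
              = ln (norm (1 + - c\<^sup>2 * x ^ (2 * M)))"
        using AE_circle_law
      proof eventually_elim
        case (elim x)
        then have "norm (c * x ^ M) < 1" using c \<rho> by (simp add: norm_mult norm_power)
        then have "1 + c * x ^ M \<noteq> 0" "1 + (- c) * x ^ M \<noteq> 0"
          using one_plus_nonzero[of "c * x ^ M"] one_plus_nonzero[of "- c * x ^ M"] by auto
        then have "ln (norm (1 + c * x ^ M)) + ln (norm (1 + (- c) * x ^ M))
          = ln (norm ((1 + c * x ^ M) * (1 + (- c) * x ^ M)))"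
          by (simp add: norm_mult ln_mult)
        also have "(1 + c * x ^ M) * (1 + (- c) * x ^ M) = 1 + - c\<^sup>2 * x ^ (2 * M)"
          by (simp add: algebra_simps power2_eq_square mult_2_right power_add)
        finally show ?case .
      qed
    qed auto
    finally show ?thesis by simp
  qed
  have bound: "\<bar>I c M\<bar> \<le> K / 2 ^ k" if "norm c \<le> \<rho>" "0 < M" for c M k
    using that
  proof (induction k arbitrary: c M)
    case 0
    interpret prob_space circle_law by (rule prob_space_circle_law)
    have "\<bar>I c M\<bar> \<le> (\<integral>x. \<bar>ln (norm (1 + c * x ^ M))\<bar> \<partial>circle_law)"
      unfolding I_def by (rule integral_abs_bound)
    also have "\<dots> \<le> (\<integral>x. K \<partial>circle_law)"
    proof (intro integral_mono_AE)
      show "AE x in circle_law. \<bar>ln (norm (1 + c * x ^ M))\<bar> \<le> K"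
        using AE_circle_law
        by eventually_elim (use 0 \<rho> in \<open>auto simp: K_def norm_power intro!: abs_ln_norm_one_plus_le\<close>)
    qed (use 0 int in auto)
    finally show ?case using prob_space by simp
  next
    case (Suc k)
    \<comment> \<open>The new coefficient -c^2 again has modulus at most \<open>\<rho>\<close>, so
      the bound \<open>K\<close> of the base case serves at every depth of the iteration.\<close>
    have "\<rho> * \<rho> \<le> \<rho> * 1" using \<rho> by (intro mult_left_mono) auto
    then have "norm (- c\<^sup>2) \<le> \<rho>"
      using Suc.prems(1) \<rho> mult_mono[of "norm c" \<rho> "norm c" \<rho>] by (simp add: norm_power power2_eq_square norm_mult)
    then have "\<bar>I (- c\<^sup>2) (2 * M)\<bar> / 2 \<le> K / 2 ^ k / 2" using Suc by (intro divide_right_mono) auto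
    moreover have "\<bar>I c M\<bar> = \<bar>I (- c\<^sup>2) (2 * M)\<bar> / 2" using half[OF Suc.prems] by simp
    ultimately show ?case by (simp add: mult.commute)
  qed
  have "\<bar>I b 1\<bar> \<le> 0"
  proof (rule LIMSEQ_le_const[of "\<lambda>k. K / 2 ^ k"])
    show "(\<lambda>k. K / 2 ^ k) \<longlonglongrightarrow> 0"
      using tendsto_mult_right_zero[OF LIMSEQ_inverse_realpow_zero[of 2], of K] by (simp add: divide_inverse)
  qed (use bound in \<open>auto simp: \<rho>_def\<close>)
  then show ?thesis by (simp add: I_def)
qed

text \<open>Different moduli keep the linear factor away from 0 on the circle, so its logarithm is
  bounded there.\<close>

lemma integrable_ln_norm_linear:
  assumes "norm \<alpha> \<noteq> norm \<beta>"
  shows "integrable circle_law (\<lambda>x. ln (norm (\<alpha> + \<beta> * x)))"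
proof (rule integrable_circle_law_bounded)
  fix x :: complex assume x: "norm x = 1"
  have "norm (\<alpha> + \<beta> * x) \<le> norm \<alpha> + norm \<beta>"
    using norm_triangle_ineq[of \<alpha> "\<beta> * x"] x by (simp add: norm_mult)
  moreover have "\<bar>norm \<alpha> - norm \<beta>\<bar> \<le> norm (\<alpha> + \<beta> * x)"
    using norm_triangle_ineq3[of \<alpha> "- \<beta> * x"] x by (simp add: norm_mult)
  ultimately have "ln \<bar>norm \<alpha> - norm \<beta>\<bar> \<le> ln (norm (\<alpha> + \<beta> * x))" "ln (norm (\<alpha> + \<beta> * x)) \<le> ln (norm \<alpha> + norm \<beta>)"
    using assms by (auto intro!: ln_mono simp del: ln_le_cancel_iff)
  then show "\<bar>ln (norm (\<alpha> + \<beta> * x))\<bar> \<le> \<bar>ln \<bar>norm \<alpha> - norm \<beta>\<bar>\<bar> + \<bar>ln (norm \<alpha> + norm \<beta>)\<bar>"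
    by linarith
qed auto

lemma integral_ln_norm_linear:
  assumes "norm \<beta> < norm \<alpha>"
  shows "(\<integral>x. ln (norm (\<alpha> + \<beta> * x)) \<partial>circle_law) = ln (norm \<alpha>)"
proof -
  interpret prob_space circle_law by (rule prob_space_circle_law)
  have \<alpha>: "\<alpha> \<noteq> 0" using assms by auto
  have lt: "norm (\<beta> / \<alpha>) < 1" using assms \<alpha> by (simp add: norm_divide field_simps)
  have "(\<integral>x. ln (norm (\<alpha> + \<beta> * x)) \<partial>circle_law) = (\<integral>x. ln (norm \<alpha>) + ln (norm (1 + (\<beta> / \<alpha>) * x)) \<partial>circle_law)"
  proof (intro integral_cong_AE)
    show "AE x in circle_law. ln (norm (\<alpha> + \<beta> * x)) = ln (norm \<alpha>) + ln (norm (1 + (\<beta> / \<alpha>) * x))"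
      using AE_circle_law
    proof eventually_elim
      case (elim x)
      have "norm ((\<beta> / \<alpha>) * x) < 1" using lt elim by (simp only: norm_mult)
      then have "1 + (\<beta> / \<alpha>) * x \<noteq> 0" by (rule one_plus_nonzero)
      then have "ln (norm \<alpha>) + ln (norm (1 + (\<beta> / \<alpha>) * x)) = ln (norm (\<alpha> * (1 + (\<beta> / \<alpha>) * x)))"
        using \<alpha> by (simp add: norm_mult ln_mult)
      also have "\<alpha> * (1 + (\<beta> / \<alpha>) * x) = \<alpha> + \<beta> * x" using \<alpha> by (simp add: field_simps)
      finally show ?case ..
    qed
  qed auto
  also have "\<dots> = ln (norm \<alpha>)"
    using integrable_ln_norm_linear[of 1 "\<beta> / \<alpha>"] integral_ln_norm_one_plus[OF lt] lt prob_space by simp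
  finally show ?thesis .
qed

text \<open>Jensen's inequality for one linear factor. If the zero lies inside the disc, conjugation
  reflects it to the outside without changing the modulus on the circle; the mean is then ln
  |\<beta>|, which exceeds ln |\<alpha>|.\<close>

lemma ln_norm_le_integral_ln_norm_linear:
  assumes "norm \<alpha> \<noteq> norm \<beta>" "\<alpha> \<noteq> 0"
  shows "ln (norm \<alpha>) \<le> (\<integral>x. ln (norm (\<alpha> + \<beta> * x)) \<partial>circle_law)"
proof (cases "norm \<beta> < norm \<alpha>")
  case True
  then show ?thesis by (simp add: integral_ln_norm_linear)
next
  case False
  then have lt: "norm (cnj \<alpha>) < norm (cnj \<beta>)" using assms by simp
  have "(\<integral>x. ln (norm (\<alpha> + \<beta> * x)) \<partial>circle_law) = (\<integral>x. ln (norm (cnj \<beta> + cnj \<alpha> * x)) \<partial>circle_law)"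
  proof (intro integral_cong_AE)
    show "AE x in circle_law. ln (norm (\<alpha> + \<beta> * x)) = ln (norm (cnj \<beta> + cnj \<alpha> * x))"
      using AE_circle_law
    proof eventually_elim
      case (elim x)
      then have "x * cnj x = 1" by (simp add: complex_norm_square[symmetric])
      then have "cnj x * (\<alpha> + \<beta> * x) = cnj (cnj \<beta> + cnj \<alpha> * x)"
        by (simp add: algebra_simps)
      then have "norm (cnj x * (\<alpha> + \<beta> * x)) = norm (cnj \<beta> + cnj \<alpha> * x)"
        by (simp only: complex_mod_cnj)
      then have "norm (\<alpha> + \<beta> * x) = norm (cnj \<beta> + cnj \<alpha> * x)"
        using elim by (simp add: norm_mult)
      then show ?case by simp
    qed
  qed auto
  also have "\<dots> = ln (norm \<beta>)" using integral_ln_norm_linear[OF lt] by simp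
  finally show ?thesis using lt assms ln_mono[of "norm \<alpha>" "norm \<beta>"] by simp
qed

text \<open>For 0 <= r < 1 this is the Moebius map of the disc that sends 0 to r. The image of
  \<open>circle_law\<close> under it is harmonic measure at r, so averaging over
  \<open>circle_law\<close> after composition is a Poisson integral without a kernel.\<close>

definition disc_automorphism :: "real \<Rightarrow> complex \<Rightarrow> complex" where
  "disc_automorphism r x = (of_real r + x) / (1 + of_real r * x)"

lemma disc_automorphism_denom:
  fixes x :: complex
  assumes "0 \<le> r" "r < 1" "norm x = 1"
  shows "1 + of_real r * x \<noteq> 0"
proof
  assume "1 + of_real r * x = 0"
  moreover have "norm (of_real r * x) < 1" using assms by (simp add: norm_mult)
  ultimately show False using one_plus_nonzero by blast
qed

lemma norm_disc_automorphism:
  fixes x :: complex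
  assumes "0 \<le> r" "r < 1" "norm x = 1"
  shows "norm (disc_automorphism r x) = 1"
proof -
  have "x * cnj x = 1" using assms by (simp add: complex_norm_square[symmetric])
  then have "x * cnj (1 + of_real r * x) = of_real r + x" by (simp add: algebra_simps)
  then have "norm (of_real r + x) = norm (x * cnj (1 + of_real r * x))" by simp
  also have "\<dots> = norm (1 + of_real r * x)"
    using assms by (simp add: norm_mult complex_mod_cnj del: complex_cnj_add complex_cnj_mult)
  finally have "norm (of_real r + x) = norm (1 + of_real r * x)" .
  then show ?thesis
    using disc_automorphism_denom[OF assms] by (simp add: disc_automorphism_def norm_divide)
qed

lemma borel_measurable_disc_automorphism [measurable]: "disc_automorphism r \<in> borel_measurable borel"
  unfolding disc_automorphism_def by measurable

lemma borel_measurable_poly [measurable]: "poly \<phi> \<in> borel_measurable borel" for \<phi> :: "complex poly"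
  by (intro borel_measurable_continuous_onI continuous_intros)

lemma integrable_norm_poly_powr:
  assumes "0 \<le> r" "r < 1" "0 < p"
  shows "integrable circle_law (\<lambda>x. norm (poly \<phi> (disc_automorphism r x)) powr p)"
proof -
  obtain B where B: "B > 0" "\<And>z. norm z \<le> 1 \<Longrightarrow> norm (poly \<phi> z) \<le> B"
    using poly_bound_exists[of 1 \<phi>] by blast
  show ?thesis
    by (rule integrable_circle_law_bounded[of _ "B powr p"])
       (use B assms in \<open>auto intro!: powr_mono2 simp: norm_disc_automorphism\<close>)
qed

text \<open>Composed with the automorphism, each factor z - w becomes a quotient of two linear
  functions of x. Jensen's inequality bounds the mean of the log of the numerator from below, and
  the log of the denominator has mean 0. This gives subharmonicity of ln |\<phi>|, and convexity of
  exp transfers it to the power p, for small p as well.\<close>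

lemma norm_poly_powr_le_integral_aux:
  fixes \<phi> :: "complex poly"
  assumes r: "0 \<le> r" "r < 1" and p: "0 < p"
    and nz: "\<And>x. norm x = 1 \<Longrightarrow> poly \<phi> x \<noteq> 0"
  shows "norm (poly \<phi> (of_real r)) powr p
           \<le> (\<integral>x. norm (poly \<phi> (disc_automorphism r x)) powr p \<partial>circle_law)"
proof (cases "poly \<phi> (of_real r) = 0")
  case True
  then show ?thesis using p by (simp add: integral_nonneg_AE)
next
  case False
  interpret prob_space circle_law by (rule prob_space_circle_law)
  obtain w where w: "\<phi> = Polynomial.smult (lead_coeff \<phi>) (\<Prod>i<degree \<phi>. [:- w i, 1:])"
    using complex_poly_decompose'[of \<phi>] by metis
  define c where "c = lead_coeff \<phi>"
  define d where "d = degree \<phi>"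
  define \<alpha> where "\<alpha> i = of_real r - w i" for i
  define \<beta> where "\<beta> i = 1 - of_real r * w i" for i
  have poly: "poly \<phi> z = c * (\<Prod>i<d. z - w i)" for z
    by (subst w) (simp add: poly_prod c_def d_def)
  have c: "c \<noteq> 0" using False poly by auto
  have \<alpha>0: "\<alpha> i \<noteq> 0" if "i < d" for i
    using False that by (auto simp: poly \<alpha>_def)
  \<comment> \<open>The identity |1 - r w|^2 - |r - w|^2 = (1 - r^2)(1 - |w|^2) shows that equality
    would put a root on the unit circle.\<close>
  have ab: "norm (\<alpha> i) \<noteq> norm (\<beta> i)" if "i < d" for i
  proof
    assume "norm (\<alpha> i) = norm (\<beta> i)"
    then have "(norm (\<alpha> i))\<^sup>2 = (norm (\<beta> i))\<^sup>2" by simp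
    then have "(1 - r\<^sup>2) * (1 - (norm (w i))\<^sup>2) = 0"
      unfolding cmod_power2 \<alpha>_def \<beta>_def by (simp add: power2_eq_square algebra_simps)
    then have "r\<^sup>2 = 1 \<or> (norm (w i))\<^sup>2 = 1" by auto
    moreover have "r\<^sup>2 < 1" using r by (simp add: power_less_one_iff)
    ultimately have "norm (w i) = 1" using norm_ge_zero[of "w i"] by (auto simp: power2_eq_1_iff)
    then have "poly \<phi> (w i) \<noteq> 0" by (rule nz)
    then show False using that by (auto simp: poly)
  qed
  have norm1r: "norm (of_real r :: complex) < norm (1 :: complex)" using r by simp
  note intr = integrable_ln_norm_linear[OF less_imp_neq[OF norm1r, symmetric]]
  \<comment> \<open>On the circle \<open>Y x\<close> is the logarithm of |\<phi>| at
    \<open>disc_automorphism r x\<close>, written as a sum of terms whose means are known.\<close>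
  define Y where "Y x = ln (norm c) + (\<Sum>i<d. ln (norm (\<alpha> i + \<beta> i * x)) - ln (norm (1 + of_real r * x)))" for x
  have intY: "integrable circle_law Y"
    unfolding Y_def using ab intr
    by (intro Bochner_Integration.integrable_add Bochner_Integration.integrable_sum
        Bochner_Integration.integrable_diff integrable_ln_norm_linear) (use norm1r in auto)
  have EY: "ln (norm (poly \<phi> (of_real r))) \<le> (\<integral>x. Y x \<partial>circle_law)"
  proof -
    have "ln (\<Prod>i<d. norm (\<alpha> i)) = (\<Sum>i<d. ln (norm (\<alpha> i)))"
      using \<alpha>0 by (intro Transcendental.ln_prod) auto
    then have "ln (norm (poly \<phi> (of_real r))) = ln (norm c) + (\<Sum>i<d. ln (norm (\<alpha> i)))"
      using c \<alpha>0 by (simp add: poly \<alpha>_def[symmetric] norm_mult prod_norm[symmetric] ln_mult Transcendental.ln_prod)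
    also have "\<dots> \<le> ln (norm c) + (\<Sum>i<d. (\<integral>x. ln (norm (\<alpha> i + \<beta> i * x)) \<partial>circle_law) - 0)"
      using \<alpha>0 ab by (intro add_left_mono sum_mono) (auto intro!: ln_norm_le_integral_ln_norm_linear)
    also have "0 = (\<integral>x. ln (norm (1 + of_real r * x)) \<partial>circle_law)"
      using integral_ln_norm_linear[OF norm1r] by simp
    also have "ln (norm c) + (\<Sum>i<d. (\<integral>x. ln (norm (\<alpha> i + \<beta> i * x)) \<partial>circle_law) - \<dots>) = (\<integral>x. Y x \<partial>circle_law)"
    proof -
      have int: "integrable circle_law (\<lambda>x. ln (norm (\<alpha> i + \<beta> i * x)))"
        "integrable circle_law (\<lambda>x. ln (norm (\<alpha> i + \<beta> i * x)) - ln (norm (1 + of_real r * x)))" if "i < d" for i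
        using that ab norm1r
        by (auto intro!: Bochner_Integration.integrable_diff integrable_ln_norm_linear simp del: norm_one)
      have "(\<integral>x. Y x \<partial>circle_law) = ln (norm c)
          + (\<integral>x. (\<Sum>i<d. ln (norm (\<alpha> i + \<beta> i * x)) - ln (norm (1 + of_real r * x))) \<partial>circle_law)"
        unfolding Y_def using prob_space int
        by (subst Bochner_Integration.integral_add) (auto intro!: Bochner_Integration.integrable_sum)
      also have "(\<integral>x. (\<Sum>i<d. ln (norm (\<alpha> i + \<beta> i * x)) - ln (norm (1 + of_real r * x))) \<partial>circle_law)
          = (\<Sum>i<d. (\<integral>x. ln (norm (\<alpha> i + \<beta> i * x)) \<partial>circle_law) - (\<integral>x. ln (norm (1 + of_real r * x)) \<partial>circle_law))"
        using int norm1r intr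
        by (subst Bochner_Integration.integral_sum)
           (auto intro!: sum.cong Bochner_Integration.integral_diff)
      finally show ?thesis ..
    qed
    finally show ?thesis .
  qed
  define L where "L = ln (norm (poly \<phi> (of_real r)))"
  have "norm (poly \<phi> (of_real r)) powr p = exp (p * L)"
    using False by (simp add: powr_def L_def)
  \<comment> \<open>Jensen's inequality by the tangent line of exp at \<open>p * L\<close>: the mean
    of \<open>Y\<close> is at least \<open>L\<close>, so inserting the linear term does not decrease
    the value.\<close>
  also have "\<dots> \<le> exp (p * L) * (1 + p * ((\<integral>x. Y x \<partial>circle_law) - L))"
    using EY p by (simp add: L_def)
  also have "\<dots> = (\<integral>x. exp (p * L) * (1 + p * (Y x - L)) \<partial>circle_law)"
    using intY prob_space by simp
  also have "\<dots> \<le> (\<integral>x. norm (poly \<phi> (disc_automorphism r x)) powr p \<partial>circle_law)"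
  proof (rule integral_mono_AE)
    show "AE x in circle_law. exp (p * L) * (1 + p * (Y x - L)) \<le> norm (poly \<phi> (disc_automorphism r x)) powr p"
      using AE_circle_law
    proof eventually_elim
      case (elim x)
      let ?D = "1 + of_real r * x"
      have D: "?D \<noteq> 0" using elim r by (rule_tac disc_automorphism_denom) auto
      have nz': "\<alpha> i + \<beta> i * x \<noteq> 0" if "i < d" for i
      proof
        assume "\<alpha> i + \<beta> i * x = 0"
        then have "\<alpha> i = - (\<beta> i * x)" by (simp add: add_eq_0_iff2)
        then have "norm (\<alpha> i) = norm (\<beta> i * x)" by simp
        then show False using ab[OF that] elim by (simp add: norm_mult)
      qed
      have "disc_automorphism r x - w i = (\<alpha> i + \<beta> i * x) / ?D" for i
        using D by (simp add: disc_automorphism_def \<alpha>_def \<beta>_def field_simps)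
      then have eq: "norm (poly \<phi> (disc_automorphism r x)) = norm c * (\<Prod>i<d. norm (\<alpha> i + \<beta> i * x) / norm ?D)"
        by (simp add: poly norm_mult prod_norm[symmetric] norm_divide)
      moreover have "ln (\<Prod>i<d. norm (\<alpha> i + \<beta> i * x) / norm ?D) = (\<Sum>i<d. ln (norm (\<alpha> i + \<beta> i * x) / norm ?D))"
        using D nz' by (intro Transcendental.ln_prod) auto
      moreover have "\<dots> = (\<Sum>i<d. ln (norm (\<alpha> i + \<beta> i * x)) - ln (norm ?D))"
        using D nz' by (intro sum.cong refl) (simp add: Transcendental.ln_div)
      ultimately have "ln (norm (poly \<phi> (disc_automorphism r x))) = Y x"
        using c D nz' by (simp add: Y_def ln_mult)
      moreover have "norm (poly \<phi> (disc_automorphism r x)) \<noteq> 0"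
        using c D nz' by (simp add: eq)
      ultimately have "norm (poly \<phi> (disc_automorphism r x)) powr p = exp (p * L) * exp (p * (Y x - L))"
        by (simp add: powr_def exp_add[symmetric] algebra_simps)
      then show ?case by (simp add: exp_ge_add_one_self)
    qed
  qed (use intY integrable_norm_poly_powr[OF r p] in auto)
  finally show ?thesis .
qed

text \<open>Roots on the circle are avoided by replacing \<phi>(z) with \<phi>(R z) for R below 1;
  only finitely many radii are bad, and dominated convergence lets R tend to 1.\<close>

lemma norm_poly_powr_le_integral:
  fixes \<phi> :: "complex poly"
  assumes r: "0 \<le> r" "r < 1" and p: "0 < p"
  shows "norm (poly \<phi> (of_real r)) powr p
           \<le> (\<integral>x. norm (poly \<phi> (disc_automorphism r x)) powr p \<partial>circle_law)"
proof (cases "\<phi> = 0")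
  case True
  then show ?thesis using p by simp
next
  case False
  interpret prob_space circle_law by (rule prob_space_circle_law)
  define R where "R i = 1 - inverse (real (Suc i))" for i
  have R1: "R \<longlonglongrightarrow> 1"
    unfolding R_def using tendsto_diff[OF tendsto_const LIMSEQ_inverse_real_of_nat, of 1] by simp
  have R: "0 \<le> R i" "R i < 1" for i by (auto simp: R_def field_simps)
  \<comment> \<open>\<open>F\<close> collects the bad radii. The value 1 is removed so that the
    limit of \<open>R\<close> lies in the open complement; this loses nothing, since
    \<open>R i\<close> is never 1.\<close>
  define F where "F = norm ` {z. poly \<phi> z = 0} - {1}"
  have "finite F" using poly_roots_finite[OF False] by (simp add: F_def)
  then have "open (- F)" by (simp add: finite_imp_closed open_Compl)
  then have ev: "\<forall>\<^sub>F i in sequentially. R i \<in> - F"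
    using R1 by (rule_tac topological_tendstoD) (auto simp: F_def)
  obtain B where B: "B > 0" "\<And>z. norm z \<le> 1 \<Longrightarrow> norm (poly \<phi> z) \<le> B"
    using poly_bound_exists[of 1 \<phi>] by blast
  have lim: "(\<lambda>i. norm (poly \<phi> (of_real (R i) * z)) powr p) \<longlonglongrightarrow> norm (poly \<phi> z) powr p" for z
  proof -
    have "(\<lambda>i. norm (poly \<phi> (of_real (R i) * z))) \<longlonglongrightarrow> norm (poly \<phi> (of_real 1 * z))"
      by (intro tendsto_intros R1)
    then show ?thesis using p by (intro tendsto_powr') auto
  qed
  show ?thesis
  proof (rule LIMSEQ_le[OF lim[of "of_real r"]])
    show "(\<lambda>i. \<integral>x. norm (poly \<phi> (of_real (R i) * disc_automorphism r x)) powr p \<partial>circle_law)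
       \<longlonglongrightarrow> (\<integral>x. norm (poly \<phi> (disc_automorphism r x)) powr p \<partial>circle_law)"
    proof (rule integral_dominated_convergence[where w = "\<lambda>_. B powr p"])
      fix i
      show "AE x in circle_law. norm (norm (poly \<phi> (of_real (R i) * disc_automorphism r x)) powr p) \<le> B powr p"
        using AE_circle_law
      proof eventually_elim
        case (elim x)
        then have "norm (of_real (R i) * disc_automorphism r x) \<le> 1"
          using R[of i] r by (simp add: norm_mult norm_disc_automorphism)
        then show ?case using B p by (auto intro!: powr_mono2)
      qed
    qed (use lim in auto)
    show "\<exists>N. \<forall>i\<ge>N. norm (poly \<phi> (of_real (R i) * of_real r)) powr p
        \<le> (\<integral>x. norm (poly \<phi> (of_real (R i) * disc_automorphism r x)) powr p \<partial>circle_law)"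
      unfolding eventually_sequentially[symmetric] using ev
    proof eventually_elim
      case (elim i)
      let ?\<psi> = "pcompose \<phi> [:0, of_real (R i):]"
      have "poly ?\<psi> x \<noteq> 0" if "norm x = 1" for x
      proof
        assume "poly ?\<psi> x = 0"
        then have "poly \<phi> (of_real (R i) * x) = 0" by (simp add: poly_pcompose mult.commute)
        moreover have "norm (of_real (R i) * x) = R i" using that R[of i] by (simp add: norm_mult)
        ultimately have "R i \<in> F" using R(2)[of i] by (force simp: F_def)
        then show False using elim by simp
      qed
      from norm_poly_powr_le_integral_aux[OF r p this] show ?case
        by (simp add: poly_pcompose mult.commute)
    qed
  qed
qed

section \<open>Multipliers on the infinite torus\<close>

text \<open>Comparing every term with the largest one replaces convexity, so a single argument
  covers all p > 0. The constant depends on the total weight only, not on the number of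
  terms.\<close>

lemma weighted_sum_powr_le:
  fixes s y :: "'b \<Rightarrow> real"
  assumes "finite I" "\<And>i. i \<in> I \<Longrightarrow> 0 \<le> s i" "\<And>i. i \<in> I \<Longrightarrow> 0 \<le> y i" "sum s I \<le> A" "0 < p"
  shows "(\<Sum>i\<in>I. s i * y i) powr p \<le> A powr p * (\<Sum>i\<in>I. y i powr p)"
proof (cases "I = {}")
  case True
  then show ?thesis using assms by simp
next
  case False
  define Y where "Y = Max (y ` I)"
  have Y: "y i \<le> Y" if "i \<in> I" for i using that assms(1) by (simp add: Y_def)
  obtain k where k: "k \<in> I" "Y = y k"
    using Max_in[of "y ` I"] assms(1) False unfolding Y_def by blast
  have A: "0 \<le> A" using assms by (meson order_trans sum_nonneg)
  have "(\<Sum>i\<in>I. s i * y i) \<le> (\<Sum>i\<in>I. s i * Y)"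
    using assms Y by (intro sum_mono mult_left_mono) auto
  also have "\<dots> \<le> A * Y"
    using assms k by (auto simp: sum_distrib_right[symmetric] intro!: mult_right_mono)
  finally have "(\<Sum>i\<in>I. s i * y i) powr p \<le> (A * Y) powr p"
    using assms by (intro powr_mono2) (auto intro!: sum_nonneg)
  also have "\<dots> = A powr p * y k powr p"
    using A assms k by (simp add: powr_mult)
  also have "\<dots> \<le> A powr p * (\<Sum>i\<in>I. y i powr p)"
    using k assms(1) by (intro mult_left_mono member_le_sum) auto
  finally show ?thesis .
qed

lemma add_powr_le:
  fixes x y :: real
  assumes "0 \<le> x" "0 \<le> y" "0 < p"
  shows "(x + y) powr p \<le> 2 powr p * (x powr p + y powr p)"
  using weighted_sum_powr_le[of "UNIV :: bool set" "\<lambda>_. 1" "\<lambda>b. if b then x else y" 2 p] assms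
  by (simp add: UNIV_bool add.commute)

lemma norm_add_powr_le:
  assumes "0 < p"
  shows "norm (x + y) powr p \<le> 2 powr p * (norm x powr p + norm y powr p)"
proof -
  have "norm (x + y) powr p \<le> (norm x + norm y) powr p"
    using assms by (intro powr_mono2 norm_triangle_ineq) auto
  also have "\<dots> \<le> 2 powr p * (norm x powr p + norm y powr p)"
    using assms by (intro add_powr_le) auto
  finally show ?thesis .
qed

text \<open>
  Any completely additive function with finite fibres would do: through it the infinite torus
  carries a circle action whose isotypic components are spanned by finitely many monomials.
\<close>

definition grade :: "nat \<Rightarrow> nat" where
  "grade n = sum_mset (prime_factorization n)"

lemma grade_1 [simp]: "grade 1 = 0" "grade (Suc 0) = 0"
  by (simp_all add: grade_def)

lemma grade_mult: "0 < m \<Longrightarrow> 0 < n \<Longrightarrow> grade (m * n) = grade m + grade n"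
  by (simp add: grade_def prime_factorization_mult)

text \<open>Every prime factor q is below 2^q. The bound makes the level sets of
  \<open>grade\<close> finite.\<close>

lemma le_two_power_grade:
  assumes "0 < n"
  shows "n \<le> 2 ^ grade n"
proof -
  have "prod_mset A \<le> 2 ^ sum_mset A" for A :: "nat multiset"
  proof (induction A)
    case (add x A)
    have "x * prod_mset A \<le> 2 ^ x * 2 ^ sum_mset A"
      using add less_exp[of x] by (intro mult_le_mono) auto
    then show ?case by (simp add: power_add)
  qed simp
  from this[of "prime_factorization n"] show ?thesis
    using assms by (simp add: grade_def prod_mset_prime_factorization_nat)
qed

lemma finite_grade_le: "finite {n. 1 \<le> n \<and> grade n \<le> M}"
proof (rule finite_subset)
  show "{n. 1 \<le> n \<and> grade n \<le> M} \<subseteq> {..2 ^ M}"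
  proof
    fix n assume n: "n \<in> {n. 1 \<le> n \<and> grade n \<le> M}"
    then have "n \<le> 2 ^ grade n" by (intro le_two_power_grade) simp
    also have "(2::nat) ^ grade n \<le> 2 ^ M" using n by (intro power_increasing) auto
    finally show "n \<in> {..2 ^ M}" by simp
  qed
qed simp

text \<open>Complete additivity of \<open>grade\<close> makes each monomial an eigenvector of the
  circle action, with weight \<open>grade n\<close>.\<close>

lemma bohr_monomial_grade_rotate:
  assumes "1 \<le> n"
  shows "bohr_monomial n (\<lambda>j. w ^ grade (nth_prime j) * z j) = w ^ grade n * bohr_monomial n z"
proof -
  have "bohr_monomial n (\<lambda>j. w ^ grade (nth_prime j)) = w ^ grade n"
    using assms by (intro bohr_monomial_completely_multiplicative) (auto simp: grade_mult power_add)
  then show ?thesis by (simp add: bohr_monomial_rotate)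
qed

text \<open>Subharmonicity along one orbit of the circle action, stated in \<open>ennreal\<close> so
  that Tonelli's theorem applies directly. The exponents are arbitrary because both
  \<open>grade n\<close> and \<open>grade n - m\<close> are needed.\<close>

lemma norm_power_sum_powr_le:
  fixes c :: "nat \<Rightarrow> complex"
  assumes "finite S" "0 \<le> r" "r < 1" "0 < p"
  shows "ennreal (norm (\<Sum>n\<in>S. c n * of_real r ^ k n) powr p)
     \<le> (\<integral>\<^sup>+x. ennreal (norm (\<Sum>n\<in>S. c n * disc_automorphism r x ^ k n) powr p) \<partial>circle_law)"
proof -
  define \<phi> where "\<phi> = (\<Sum>n\<in>S. Polynomial.monom (c n) (k n))"
  have \<phi>: "poly \<phi> w = (\<Sum>n\<in>S. c n * w ^ k n)" for w
    by (simp add: \<phi>_def poly_sum poly_monom)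
  have "ennreal (norm (poly \<phi> (of_real r)) powr p)
      \<le> ennreal (\<integral>x. norm (poly \<phi> (disc_automorphism r x)) powr p \<partial>circle_law)"
    using assms by (intro ennreal_leI norm_poly_powr_le_integral) auto
  also have "\<dots> = (\<integral>\<^sup>+x. ennreal (norm (poly \<phi> (disc_automorphism r x)) powr p) \<partial>circle_law)"
    using assms by (intro nn_integral_eq_integral[symmetric] integrable_norm_poly_powr) auto
  finally show ?thesis by (simp add: \<phi>)
qed

text \<open>The p-th power of \<open>hardy_norm\<close> before conversion to a real number: extended
  values let Tonelli and Fatou act without integrability conditions.\<close>

definition hardy_mass :: "real \<Rightarrow> (nat \<Rightarrow> complex) \<Rightarrow> ennreal" where
  "hardy_mass p a = (\<integral>\<^sup>+z. ennreal (norm (bohr_lift a z) powr p) \<partial>torus_haar)"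

definition dirichlet_support :: "(nat \<Rightarrow> complex) \<Rightarrow> nat set" where
  "dirichlet_support a = {n. 1 \<le> n \<and> a n \<noteq> 0}"

lemma finite_dirichlet_support: "a \<in> dirichlet_polynomials \<Longrightarrow> finite (dirichlet_support a)"
  by (simp add: dirichlet_polynomials_def dirichlet_support_def)

lemma bohr_lift_multiplier:
  assumes "a \<in> dirichlet_polynomials"
  shows "bohr_lift (\<lambda>n. m n * a n) z = (\<Sum>n\<in>dirichlet_support a. m n * a n * bohr_monomial n z)"
  using finite_dirichlet_support[OF assms]
  by (intro bohr_lift_sum) (auto simp: dirichlet_support_def)

lemma multiplier_dirichlet_polynomials:
  "a \<in> dirichlet_polynomials \<Longrightarrow> (\<lambda>n. m n * a n) \<in> dirichlet_polynomials"
  unfolding dirichlet_polynomials_def by (auto elim: rev_finite_subset)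

lemma nn_integral_bohr_lift_grade_rotate:
  assumes "a \<in> dirichlet_polynomials" "norm w = 1"
  shows "(\<integral>\<^sup>+z. ennreal (norm (\<Sum>n\<in>dirichlet_support a. a n * bohr_monomial n z * w ^ grade n) powr p) \<partial>torus_haar)
           = hardy_mass p a"
proof -
  have "bohr_lift a (\<lambda>j. w ^ grade (nth_prime j) * z j)
      = (\<Sum>n\<in>dirichlet_support a. a n * bohr_monomial n z * w ^ grade n)" for z
    using bohr_lift_multiplier[OF assms(1), of "\<lambda>_. 1"]
    by (auto simp: bohr_monomial_grade_rotate dirichlet_support_def intro!: sum.cong)
  then have "(\<integral>\<^sup>+z. ennreal (norm (\<Sum>n\<in>dirichlet_support a. a n * bohr_monomial n z * w ^ grade n) powr p) \<partial>torus_haar)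
    = (\<integral>\<^sup>+z. ennreal (norm (bohr_lift a (\<lambda>j. w ^ grade (nth_prime j) * z j)) powr p) \<partial>torus_haar)"
    by simp
  also have "\<dots> = hardy_mass p a"
    unfolding hardy_mass_def using assms(2)
    by (intro nn_integral_torus_haar_rotate[where g = "\<lambda>z. ennreal (norm (bohr_lift a z) powr p)"])
       (auto simp: norm_power)
  finally show ?thesis .
qed

lemma pair_sigma_finite_torus_circle: "pair_sigma_finite torus_haar circle_law"
  using prob_space_torus_haar prob_space_circle_law
  by (simp add: pair_sigma_finite_def prob_space_imp_sigma_finite)

text \<open>
  The point \<open>disc_automorphism r x\<close> is unimodular, so after exchanging the integrals each inner
  integral is the one of \<open>a\<close> itself, by rotation invariance.
\<close>

lemma hardy_mass_dilation_le:
  assumes a: "a \<in> dirichlet_polynomials" and r: "0 \<le> r" "r < 1" and p: "0 < p"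
  shows "hardy_mass p (\<lambda>n. of_real r ^ grade n * a n) \<le> hardy_mass p a"
proof -
  interpret pair_sigma_finite torus_haar circle_law by (rule pair_sigma_finite_torus_circle)
  interpret C: prob_space circle_law by (rule prob_space_circle_law)
  let ?S = "dirichlet_support a"
  have "hardy_mass p (\<lambda>n. of_real r ^ grade n * a n)
     = (\<integral>\<^sup>+z. ennreal (norm (\<Sum>n\<in>?S. a n * bohr_monomial n z * of_real r ^ grade n) powr p) \<partial>torus_haar)"
    unfolding hardy_mass_def bohr_lift_multiplier[OF a] by (simp add: mult_ac)
  also have "\<dots> \<le> (\<integral>\<^sup>+z. (\<integral>\<^sup>+x. ennreal (norm (\<Sum>n\<in>?S. a n * bohr_monomial n z
       * disc_automorphism r x ^ grade n) powr p) \<partial>circle_law) \<partial>torus_haar)"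
    using a r p by (intro nn_integral_mono norm_power_sum_powr_le finite_dirichlet_support)
  also have "\<dots> = (\<integral>\<^sup>+x. (\<integral>\<^sup>+z. ennreal (norm (\<Sum>n\<in>?S. a n * bohr_monomial n z
       * disc_automorphism r x ^ grade n) powr p) \<partial>torus_haar) \<partial>circle_law)"
    by (rule Fubini'[symmetric]) measurable
  also have "\<dots> = (\<integral>\<^sup>+x. hardy_mass p a \<partial>circle_law)"
  proof (intro nn_integral_cong_AE)
    show "AE x in circle_law. (\<integral>\<^sup>+z. ennreal (norm (\<Sum>n\<in>?S. a n * bohr_monomial n z
       * disc_automorphism r x ^ grade n) powr p) \<partial>torus_haar) = hardy_mass p a"
      using AE_circle_law by eventually_elim
        (use a r in \<open>auto intro!: nn_integral_bohr_lift_grade_rotate norm_disc_automorphism\<close>)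
  qed
  also have "\<dots> = hardy_mass p a" by (simp add: C.emeasure_space_1[simplified])
  finally show ?thesis .
qed

text \<open>The extra factor \<zeta>^i raises the exponent by one, so the geometric sum over i
  survives exactly when m + 1 divides k + 1, that is, when k is congruent to m modulo m + 1.\<close>

lemma sum_roots_of_unity_filter:
  fixes c :: "nat \<Rightarrow> complex" and m :: nat
  defines "\<zeta> \<equiv> cis (2 * pi / real (Suc m))"
  assumes "finite S"
  shows "(\<Sum>i<Suc m. of_real (1 / real (Suc m)) * (\<zeta> ^ i * (\<Sum>n\<in>S. c n * (\<zeta> ^ i * x) ^ k n)))
       = (\<Sum>n\<in>{n \<in> S. Suc m dvd Suc (k n)}. c n * x ^ k n)"
proof -
  have \<zeta>N: "\<zeta> ^ Suc m = 1"
    unfolding \<zeta>_def by (subst Complex.DeMoivre) (simp del: of_nat_Suc)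
  have geo: "(\<Sum>i<Suc m. (\<zeta> ^ Suc j) ^ i) = (if Suc m dvd Suc j then of_nat (Suc m) else 0)" for j
  proof (cases "Suc m dvd Suc j")
    case True
    then obtain l where "Suc j = Suc m * l" by (elim dvdE)
    then have "\<zeta> ^ Suc j = 1" by (simp only: power_mult \<zeta>N power_one)
    then show ?thesis using True by (simp only: power_one) simp
  next
    case False
    have "\<zeta> ^ Suc j \<noteq> 1"
    proof
      assume "\<zeta> ^ Suc j = 1"
      then have "cis (real (Suc j) * (2 * pi / real (Suc m))) = 1"
        unfolding \<zeta>_def by (simp only: Complex.DeMoivre)
      from arg_cong[OF this, of Re] have "cos (real (Suc j) * (2 * pi / real (Suc m))) = 1"
        by (simp only: cis.sel one_complex.sel)
      then obtain l :: int where "real (Suc j) * (2 * pi / real (Suc m)) = real_of_int l * 2 * pi"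
        using cos_one_2pi_int by blast
      then have "real (Suc j) = real_of_int l * real (Suc m)"
        by (simp add: divide_simps del: of_nat_Suc)
      then have "real_of_int (int (Suc j)) = real_of_int (l * int (Suc m))"
        by (simp only: of_int_mult of_int_of_nat_eq)
      then have "int (Suc j) = l * int (Suc m)" by (simp only: of_int_eq_iff)
      then have "int (Suc m) dvd int (Suc j)" by simp
      then show False using False by (simp only: int_dvd_int_iff)
    qed
    moreover have "(\<zeta> ^ Suc j) ^ Suc m = (\<zeta> ^ Suc m) ^ Suc j"
      by (simp only: power_mult[symmetric] mult.commute)
    then have "(\<zeta> ^ Suc j) ^ Suc m = 1" by (simp only: \<zeta>N power_one)
    ultimately show ?thesis using False geometric_sum[of "\<zeta> ^ Suc j" "Suc m"]
      by (simp del: sum.lessThan_Suc power_Suc)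
  qed
  have "(\<Sum>i<Suc m. of_real (1 / real (Suc m)) * (\<zeta> ^ i * (\<Sum>n\<in>S. c n * (\<zeta> ^ i * x) ^ k n)))
     = (\<Sum>n\<in>S. c n * x ^ k n * (of_real (1 / real (Suc m)) * (\<Sum>i<Suc m. (\<zeta> ^ Suc (k n)) ^ i)))"
    unfolding sum_distrib_left
  proof (subst sum.swap, intro sum.cong refl)
    fix n i
    have "(\<zeta> ^ Suc (k n)) ^ i = (\<zeta> ^ i) ^ Suc (k n)"
      by (simp only: power_mult[symmetric] mult.commute)
    also have "\<dots> = \<zeta> ^ i * (\<zeta> ^ i) ^ k n" by simp
    finally have "(\<zeta> ^ Suc (k n)) ^ i = \<zeta> ^ i * (\<zeta> ^ i) ^ k n" .
    then show "of_real (1 / real (Suc m)) * (\<zeta> ^ i * (c n * (\<zeta> ^ i * x) ^ k n))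
        = c n * x ^ k n * (of_real (1 / real (Suc m)) * (\<zeta> ^ Suc (k n)) ^ i)"
      by (simp only: power_mult_distrib mult_ac)
  qed
  also have "\<dots> = (\<Sum>n\<in>S. if Suc m dvd Suc (k n) then c n * x ^ k n else 0)"
    unfolding geo by (intro sum.cong refl) (simp del: of_nat_Suc)
  also have "\<dots> = (\<Sum>n\<in>{n \<in> S. Suc m dvd Suc (k n)}. c n * x ^ k n)"
    using assms(2) by (simp add: sum.inter_filter)
  finally show ?thesis .
qed

text \<open>
  After averaging over the \<open>(m + 1)\<close>-st roots of unity only exponents congruent to \<open>m\<close> modulo
  \<open>m + 1\<close> remain. The smallest of them is \<open>m\<close> itself, so the component of degree \<open>m\<close> is the
  value at 0 of a polynomial.
\<close>

lemma hardy_mass_homogeneous_le: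
  assumes a: "a \<in> dirichlet_polynomials" and p: "0 < p"
  shows "hardy_mass p (\<lambda>n. of_bool (grade n = m) * a n) \<le> ennreal (real (Suc m)) * hardy_mass p a"
proof -
  interpret pair_sigma_finite torus_haar circle_law by (rule pair_sigma_finite_torus_circle)
  interpret C: prob_space circle_law by (rule prob_space_circle_law)
  let ?S = "dirichlet_support a"
  have S: "finite ?S" using a by (rule finite_dirichlet_support)
  define S' where "S' = {n \<in> ?S. Suc m dvd Suc (grade n)}"
  have S': "finite S'" using S by (simp add: S'_def)
  have le: "m \<le> grade n" if "n \<in> S'" for n
    using that dvd_imp_le[of "Suc m" "Suc (grade n)"] by (auto simp: S'_def)
  define \<zeta> where "\<zeta> = cis (2 * pi / real (Suc m))"
  let ?b = "\<lambda>n z. a n * bohr_monomial n z"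
  \<comment> \<open>Since 0^0 = 1, evaluation at 0 keeps exactly the terms of grade
    \<open>m\<close>.\<close>
  have eq: "bohr_lift (\<lambda>n. of_bool (grade n = m) * a n) z = (\<Sum>n\<in>S'. ?b n z * of_real 0 ^ (grade n - m))" for z
  proof -
    have "bohr_lift (\<lambda>n. of_bool (grade n = m) * a n) z = (\<Sum>n\<in>S'. of_bool (grade n = m) * a n * bohr_monomial n z)"
      unfolding bohr_lift_multiplier[OF a] using S by (intro sum.mono_neutral_right) (auto simp: S'_def)
    also have "\<dots> = (\<Sum>n\<in>S'. ?b n z * of_real 0 ^ (grade n - m))"
      using le by (intro sum.cong refl) (force simp: of_bool_def power_0_left)
    finally show ?thesis .
  qed
  have bound: "norm (\<Sum>n\<in>S'. ?b n z * x ^ (grade n - m)) powr p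
      \<le> (\<Sum>i<Suc m. norm (\<Sum>n\<in>?S. ?b n z * (\<zeta> ^ i * x) ^ grade n) powr p)"
    if x: "norm x = 1" for x z
  proof -
    let ?y = "\<lambda>i. \<Sum>n\<in>?S. ?b n z * (\<zeta> ^ i * x) ^ grade n"
    have "x ^ m * (\<Sum>n\<in>S'. ?b n z * x ^ (grade n - m)) = (\<Sum>n\<in>S'. ?b n z * x ^ grade n)"
      unfolding sum_distrib_left
    proof (intro sum.cong refl)
      fix n assume "n \<in> S'"
      then have "x ^ grade n = x ^ m * x ^ (grade n - m)" using le by (simp add: power_add[symmetric])
      then show "x ^ m * (?b n z * x ^ (grade n - m)) = ?b n z * x ^ grade n" by simp
    qed
    also have "\<dots> = (\<Sum>i<Suc m. of_real (1 / real (Suc m)) * (\<zeta> ^ i * ?y i))"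
      unfolding S'_def \<zeta>_def by (rule sum_roots_of_unity_filter[OF S, symmetric])
    finally have "norm (x ^ m * (\<Sum>n\<in>S'. ?b n z * x ^ (grade n - m)))
        = norm (\<Sum>i<Suc m. of_real (1 / real (Suc m)) * (\<zeta> ^ i * ?y i))"
      by simp
    then have "norm (\<Sum>n\<in>S'. ?b n z * x ^ (grade n - m))
        = norm (\<Sum>i<Suc m. of_real (1 / real (Suc m)) * (\<zeta> ^ i * ?y i))"
      using x by (simp only: norm_mult norm_power) simp
    also have "\<dots> \<le> (\<Sum>i<Suc m. norm (of_real (1 / real (Suc m)) * (\<zeta> ^ i * ?y i)))"
      by (rule norm_sum)
    also have "\<dots> = (\<Sum>i<Suc m. 1 / real (Suc m) * norm (?y i))"
      by (intro sum.cong refl) (simp add: norm_mult norm_power \<zeta>_def norm_divide del: of_nat_Suc)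
    finally have "norm (\<Sum>n\<in>S'. ?b n z * x ^ (grade n - m)) powr p \<le> (\<Sum>i<Suc m. 1 / real (Suc m) * norm (?y i)) powr p"
      using p by (intro powr_mono2) auto
    \<comment> \<open>Bounding the mean over the roots of unity by the sum of all p-th powers costs
      the factor \<open>Suc m\<close>, but is valid for every p > 0.\<close>
    also have "\<dots> \<le> 1 powr p * (\<Sum>i<Suc m. norm (?y i) powr p)"
      using p by (intro weighted_sum_powr_le) (auto simp del: sum.lessThan_Suc of_nat_Suc)
    finally show ?thesis by simp
  qed
  \<comment> \<open>The automorphism with r = 0 is the identity, so this is the sub-mean value
    property at the centre of the disc.\<close>
  have "hardy_mass p (\<lambda>n. of_bool (grade n = m) * a n)
      \<le> (\<integral>\<^sup>+z. (\<integral>\<^sup>+x. ennreal (norm (\<Sum>n\<in>S'. ?b n z * disc_automorphism 0 x ^ (grade n - m)) powr p) \<partial>circle_law) \<partial>torus_haar)"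
    unfolding hardy_mass_def eq using S' p by (intro nn_integral_mono norm_power_sum_powr_le) auto
  also have "\<dots> \<le> (\<integral>\<^sup>+z. (\<integral>\<^sup>+x. (\<Sum>i<Suc m. ennreal (norm (\<Sum>n\<in>?S. ?b n z * (\<zeta> ^ i * x) ^ grade n) powr p)) \<partial>circle_law) \<partial>torus_haar)"
  proof (rule nn_integral_mono, rule nn_integral_mono_AE)
    fix z
    show "AE x in circle_law. ennreal (norm (\<Sum>n\<in>S'. ?b n z * disc_automorphism 0 x ^ (grade n - m)) powr p)
        \<le> (\<Sum>i<Suc m. ennreal (norm (\<Sum>n\<in>?S. ?b n z * (\<zeta> ^ i * x) ^ grade n) powr p))"
      using AE_circle_law
    proof eventually_elim
      case (elim x)
      from ennreal_leI[OF bound[OF elim, of z]] show ?case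
        by (simp add: disc_automorphism_def sum_ennreal del: sum.lessThan_Suc)
    qed
  qed
  also have "\<dots> = (\<integral>\<^sup>+x. (\<integral>\<^sup>+z. (\<Sum>i<Suc m. ennreal (norm (\<Sum>n\<in>?S. ?b n z * (\<zeta> ^ i * x) ^ grade n) powr p)) \<partial>torus_haar) \<partial>circle_law)"
    by (rule Fubini'[symmetric]) measurable
  also have "\<dots> = (\<integral>\<^sup>+x. ennreal (real (Suc m)) * hardy_mass p a \<partial>circle_law)"
  proof (intro nn_integral_cong_AE)
    show "AE x in circle_law. (\<integral>\<^sup>+z. (\<Sum>i<Suc m. ennreal (norm (\<Sum>n\<in>?S. ?b n z * (\<zeta> ^ i * x) ^ grade n) powr p)) \<partial>torus_haar)
        = ennreal (real (Suc m)) * hardy_mass p a"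
      using AE_circle_law
    proof eventually_elim
      case (elim x)
      have "(\<integral>\<^sup>+z. ennreal (norm (\<Sum>n\<in>?S. ?b n z * (\<zeta> ^ i * x) ^ grade n) powr p) \<partial>torus_haar) = hardy_mass p a" for i
        using elim by (intro nn_integral_bohr_lift_grade_rotate a) (simp add: norm_mult norm_power \<zeta>_def)
      then show ?case
        by (subst nn_integral_sum) (auto simp del: sum.lessThan_Suc of_nat_Suc simp: ennreal_of_nat_eq_real_of_nat)
    qed
  qed
  also have "\<dots> = ennreal (real (Suc m)) * hardy_mass p a" by (simp add: C.emeasure_space_1[simplified])
  finally show ?thesis .
qed

text \<open>A quasi-triangle inequality whose constant does not see the number of summands: the
  geometric weights have bounded total.\<close>

lemma norm_geometric_sum_powr_le:
  fixes y :: "nat \<Rightarrow> 'b :: real_normed_algebra_1"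
  assumes "finite I" "0 \<le> s" "s < 1" "0 < p"
  shows "norm (\<Sum>m\<in>I. of_real s ^ m * y m) powr p \<le> (1 / (1 - s)) powr p * (\<Sum>m\<in>I. norm (y m) powr p)"
proof -
  have "norm (\<Sum>m\<in>I. of_real s ^ m * y m) \<le> (\<Sum>m\<in>I. s ^ m * norm (y m))"
  proof (rule order_trans[OF norm_sum], rule sum_mono)
    fix m
    have "norm (of_real s ^ m * y m) = norm (of_real (s ^ m) * y m)" by simp
    also have "\<dots> \<le> norm (of_real (s ^ m) :: 'b) * norm (y m)" by (rule norm_mult_ineq)
    also have "\<dots> = s ^ m * norm (y m)" using assms by (simp only: norm_of_real) simp
    finally show "norm (of_real s ^ m * y m) \<le> s ^ m * norm (y m)" .
  qed
  then have "norm (\<Sum>m\<in>I. of_real s ^ m * y m) powr p \<le> (\<Sum>m\<in>I. s ^ m * norm (y m)) powr p"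
    using assms by (intro powr_mono2) auto
  also have "\<dots> \<le> (1 / (1 - s)) powr p * (\<Sum>m\<in>I. norm (y m) powr p)"
  proof (rule weighted_sum_powr_le)
    have "(\<Sum>m\<in>I. s ^ m) \<le> (\<Sum>m. s ^ m)"
      using assms by (intro sum_le_suminf) auto
    then show "(\<Sum>m\<in>I. s ^ m) \<le> 1 / (1 - s)" using assms by (simp add: suminf_geometric)
  qed (use assms in auto)
  finally show ?thesis .
qed

text \<open>
  Dilations act contractively and the tail beyond \<open>M\<close> of a dilated series is controlled by the
  polynomial bound on the homogeneous components. So dilating and then truncating at a suitable \<open>M\<close>
  is bounded uniformly, although truncation alone is not bounded when \<open>p \<le> 1\<close>.
\<close>

lemma hardy_mass_truncated_dilation_le:
  assumes s: "0 < s" "s < 1" and p: "0 < p"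
  obtains M where "i \<le> M"
    "\<And>a. a \<in> dirichlet_polynomials \<Longrightarrow>
       hardy_mass p (\<lambda>n. of_real (if grade n \<le> M then (s * s) ^ grade n else 0) * a n)
         \<le> ennreal (2 powr p * 2) * hardy_mass p a"
proof -
  \<comment> \<open>The dilation radius is \<open>s * s\<close> because one factor s^k feeds the
    geometric weights of the quasi-triangle inequality, while the other, raised to the power p,
    yields the \<open>x ^ k\<close> that beats the growth of the components.\<close>
  define x where "x = s powr p"
  have x: "0 < x" "x < 1" using s p powr_less_mono2[of p s 1] by (auto simp: x_def)
  define A where "A = (1 / (1 - s)) powr p"
  have A: "0 < A" using s by (simp add: A_def)
  \<comment> \<open>The coefficients \<open>Suc m\<close> are the constants of
    \<open>hardy_mass_homogeneous_le\<close>. A far enough cutoff makes \<open>A\<close> times the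
    tail at most 1, so the discarded components cost no more than one further copy of the mass;
    hence the factor 2 beside \<open>2 powr p\<close>.\<close>
  have "summable (\<lambda>m. of_nat (Suc m) * x ^ m)"
    using geometric_deriv_sums[of x] x by (auto simp: summable_def)
  then have "\<exists>N. \<forall>m\<ge>N. \<forall>n. norm (\<Sum>k=m..<n. of_nat (Suc k) * x ^ k) < 1 / A"
    using A by (subst (asm) summable_Cauchy) auto
  then obtain N where N: "\<And>m n. N \<le> m \<Longrightarrow> norm (\<Sum>k=m..<n. of_nat (Suc k) * x ^ k) < 1 / A"
    by blast
  define M where "M = max i N"
  have tail: "A * (\<Sum>k\<in>F. x ^ k * real (Suc k)) \<le> 1" if F: "finite F" "\<And>k. k \<in> F \<Longrightarrow> M < k" for F
  proof -
    have "F \<subseteq> {M..<Suc (Max (insert M F))}"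
      using F by (auto simp: le_Suc_eq less_Suc_eq_le less_imp_le)
    then have "(\<Sum>k\<in>F. x ^ k * real (Suc k)) \<le> (\<Sum>k=M..<Suc (Max (insert M F)). x ^ k * real (Suc k))"
      using x by (intro sum_mono2) auto
    also have "\<dots> \<le> norm (\<Sum>k=M..<Suc (Max (insert M F)). of_nat (Suc k) * x ^ k)"
      by (simp add: mult.commute)
    also have "\<dots> < 1 / A" by (rule N) (simp add: M_def)
    finally have "A * (\<Sum>k\<in>F. x ^ k * real (Suc k)) \<le> A * (1 / A)"
      using A by (intro mult_left_mono) auto
    then show ?thesis using A by simp
  qed
  show ?thesis
  proof (rule that[of M])
    show "i \<le> M" by (simp add: M_def)
    fix a assume a: "a \<in> dirichlet_polynomials"
    let ?S = "dirichlet_support a"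
    have S: "finite ?S" using a by (rule finite_dirichlet_support)
    define F where "F = grade ` ?S \<inter> {M<..}"
    have F: "finite F" "\<And>k. k \<in> F \<Longrightarrow> M < k" using S by (auto simp: F_def)
    let ?b = "\<lambda>n z. a n * bohr_monomial n z"
    let ?Q = "\<lambda>k z. bohr_lift (\<lambda>n. of_bool (grade n = k) * a n) z"
    let ?t = "\<lambda>n. of_real (if grade n \<le> M then (s * s) ^ grade n else 0) :: complex"
    let ?D = "\<lambda>z. bohr_lift (\<lambda>n. of_real (s * s) ^ grade n * a n) z"
    have split: "bohr_lift (\<lambda>n. ?t n * a n) z = ?D z + - (\<Sum>k\<in>F. of_real s ^ k * (of_real s ^ k * ?Q k z))" for z
    proof -
      have "(\<Sum>k\<in>F. of_real s ^ k * (of_real s ^ k * ?Q k z))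
          = (\<Sum>k\<in>F. \<Sum>n\<in>?S. of_bool (grade n = k) * (of_real (s * s) ^ k * ?b n z))"
        unfolding bohr_lift_multiplier[OF a] sum_distrib_left
        by (intro sum.cong refl) (simp add: power_mult_distrib mult_ac)
      also have "\<dots> = (\<Sum>n\<in>?S. \<Sum>k\<in>F. of_bool (grade n = k) * (of_real (s * s) ^ k * ?b n z))"
        by (rule sum.swap)
      also have "\<dots> = (\<Sum>n\<in>?S. if grade n \<le> M then 0 else of_real (s * s) ^ grade n * ?b n z)"
      proof (intro sum.cong refl)
        fix n assume n: "n \<in> ?S"
        have "(\<Sum>k\<in>F. of_bool (grade n = k) * (of_real (s * s) ^ k * ?b n z))
            = (\<Sum>k\<in>F. if grade n = k then of_real (s * s) ^ k * ?b n z else 0)"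
          by (intro sum.cong refl) simp
        also have "\<dots> = (if grade n \<in> F then of_real (s * s) ^ grade n * ?b n z else 0)"
          using F(1) by simp
        also have "grade n \<in> F \<longleftrightarrow> \<not> grade n \<le> M" using n by (auto simp: F_def)
        finally show "(\<Sum>k\<in>F. of_bool (grade n = k) * (of_real (s * s) ^ k * ?b n z))
            = (if grade n \<le> M then 0 else of_real (s * s) ^ grade n * ?b n z)" by simp
      qed
      finally show ?thesis
        unfolding bohr_lift_multiplier[OF a] by (auto simp: sum_subtractf[symmetric] intro!: sum.cong)
    qed
    have bound: "norm (bohr_lift (\<lambda>n. ?t n * a n) z) powr p
       \<le> 2 powr p * (norm (?D z) powr p + A * (\<Sum>k\<in>F. x ^ k * norm (?Q k z) powr p))" for z
    proof -
      have "norm (of_real s ^ k * ?Q k z) powr p = x ^ k * norm (?Q k z) powr p" for k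
      proof -
        have "(s ^ k) powr p = x ^ k"
          using s by (induction k) (simp_all add: powr_mult x_def)
        then show ?thesis using s by (simp add: norm_mult norm_power powr_mult)
      qed
      then have "norm (\<Sum>k\<in>F. of_real s ^ k * (of_real s ^ k * ?Q k z)) powr p
          \<le> A * (\<Sum>k\<in>F. x ^ k * norm (?Q k z) powr p)"
        using norm_geometric_sum_powr_le[of F s p "\<lambda>k. of_real s ^ k * ?Q k z"] F s p by (simp add: A_def)
      moreover have "norm (bohr_lift (\<lambda>n. ?t n * a n) z) powr p
         \<le> 2 powr p * (norm (?D z) powr p + norm (\<Sum>k\<in>F. of_real s ^ k * (of_real s ^ k * ?Q k z)) powr p)"
        unfolding split using norm_add_powr_le[OF p, of "?D z"
          "- (\<Sum>k\<in>F. of_real s ^ k * (of_real s ^ k * ?Q k z))"] by (simp only: norm_minus_cancel)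
      ultimately show ?thesis
        by (elim order_trans) (intro mult_left_mono add_left_mono, auto)
    qed
    have "hardy_mass p (\<lambda>n. ?t n * a n)
       \<le> (\<integral>\<^sup>+z. ennreal (2 powr p * (norm (?D z) powr p + A * (\<Sum>k\<in>F. x ^ k * norm (?Q k z) powr p))) \<partial>torus_haar)"
      unfolding hardy_mass_def by (intro nn_integral_mono ennreal_leI bound)
    also have "\<dots> = (\<integral>\<^sup>+z. ennreal (2 powr p) * (ennreal (norm (?D z) powr p)
         + ennreal A * (\<Sum>k\<in>F. ennreal (x ^ k) * ennreal (norm (?Q k z) powr p))) \<partial>torus_haar)"
    proof (intro nn_integral_cong)
      fix z
      have "(\<Sum>k\<in>F. ennreal (x ^ k) * ennreal (norm (?Q k z) powr p)) = ennreal (\<Sum>k\<in>F. x ^ k * norm (?Q k z) powr p)"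
        using x by (simp add: sum_ennreal[symmetric] ennreal_mult)
      then show "ennreal (2 powr p * (norm (?D z) powr p + A * (\<Sum>k\<in>F. x ^ k * norm (?Q k z) powr p)))
        = ennreal (2 powr p) * (ennreal (norm (?D z) powr p)
         + ennreal A * (\<Sum>k\<in>F. ennreal (x ^ k) * ennreal (norm (?Q k z) powr p)))"
        using A x by (simp add: ennreal_mult ennreal_plus sum_nonneg del: sum_ennreal)
    qed
    also have "\<dots> = ennreal (2 powr p) * (hardy_mass p (\<lambda>n. of_real (s * s) ^ grade n * a n)
         + ennreal A * (\<Sum>k\<in>F. ennreal (x ^ k) * hardy_mass p (\<lambda>n. of_bool (grade n = k) * a n)))"
      unfolding hardy_mass_def by (simp add: nn_integral_cmult nn_integral_add nn_integral_sum)
    also have "\<dots> \<le> ennreal (2 powr p) * (hardy_mass p a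
         + ennreal A * (\<Sum>k\<in>F. ennreal (x ^ k) * (ennreal (real (Suc k)) * hardy_mass p a)))"
    proof (intro mult_left_mono add_mono sum_mono zero_le)
      have "s * s < 1 * 1" using s by (intro mult_strict_mono) auto
      then show "hardy_mass p (\<lambda>n. of_real (s * s) ^ grade n * a n) \<le> hardy_mass p a"
        using s by (intro hardy_mass_dilation_le a p) auto
    qed (use a p in \<open>auto intro: hardy_mass_homogeneous_le simp del: of_nat_Suc\<close>)
    also have "\<dots> = ennreal (2 powr p) * (1 + ennreal (A * (\<Sum>k\<in>F. x ^ k * real (Suc k)))) * hardy_mass p a"
      using A x by (simp add: ennreal_mult sum_nonneg sum_ennreal[symmetric] sum_distrib_right distrib_left
          distrib_right mult.assoc del: of_nat_Suc)
    also have "\<dots> \<le> ennreal (2 powr p) * (1 + ennreal 1) * hardy_mass p a"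
      using tail[OF F] by (intro mult_right_mono mult_left_mono add_left_mono ennreal_leI) auto
    also have "ennreal (2 powr p) * (1 + ennreal 1) = ennreal (2 powr p * 2)"
      by (simp add: ennreal_mult)
    finally show "hardy_mass p (\<lambda>n. ?t n * a n) \<le> ennreal (2 powr p * 2) * hardy_mass p a" .
  qed
qed

text \<open>The radius \<open>s i\<close> tends to 1 and the cutoff \<open>M i\<close> adapts to it;
  closeness of the radius to 1 is paid for by the cutoff and not by the constant.
  \<open>i \<le> M i\<close> brings every fixed index eventually inside the window.\<close>

lemma bounded_summation_method:
  assumes p: "0 < p"
  obtains w :: "nat \<Rightarrow> nat \<Rightarrow> real" where
    "\<And>i. finite {n. 1 \<le> n \<and> w i n \<noteq> 0}"
    "\<And>n. (\<lambda>i. w i n) \<longlonglongrightarrow> 1"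
    "\<And>i a. a \<in> dirichlet_polynomials \<Longrightarrow>
       hardy_mass p (\<lambda>n. of_real (w i n) * a n) \<le> ennreal (2 powr p * 2) * hardy_mass p a"
proof -
  define s where "s i = 1 - inverse (real (Suc (Suc i)))" for i
  have s: "0 < s i" "s i < 1" for i by (auto simp: s_def field_simps)
  have s1: "s \<longlonglongrightarrow> 1"
    unfolding s_def using tendsto_diff[OF tendsto_const LIMSEQ_Suc[OF LIMSEQ_inverse_real_of_nat], of 1] by simp
  have "\<exists>M\<ge>i. \<forall>a\<in>dirichlet_polynomials.
       hardy_mass p (\<lambda>n. of_real (if grade n \<le> M then (s i * s i) ^ grade n else 0) * a n)
         \<le> ennreal (2 powr p * 2) * hardy_mass p a" for i
    by (rule hardy_mass_truncated_dilation_le[OF s p, of i i]) blast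
  then have "\<exists>M. \<forall>i. i \<le> M i \<and> (\<forall>a\<in>dirichlet_polynomials.
       hardy_mass p (\<lambda>n. of_real (if grade n \<le> M i then (s i * s i) ^ grade n else 0) * a n)
         \<le> ennreal (2 powr p * 2) * hardy_mass p a)"
    by (intro choice allI)
  then obtain M where M: "\<And>i. i \<le> M i" "\<And>i a. a \<in> dirichlet_polynomials \<Longrightarrow>
       hardy_mass p (\<lambda>n. of_real (if grade n \<le> M i then (s i * s i) ^ grade n else 0) * a n)
         \<le> ennreal (2 powr p * 2) * hardy_mass p a"
    by blast
  show ?thesis
  proof (rule that[of "\<lambda>i n. if grade n \<le> M i then (s i * s i) ^ grade n else 0"])
    fix i n
    show "finite {n. 1 \<le> n \<and> (if grade n \<le> M i then (s i * s i) ^ grade n else 0) \<noteq> 0}"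
      by (rule finite_subset[OF _ finite_grade_le[of "M i"]]) auto
    show "(\<lambda>i. if grade n \<le> M i then (s i * s i) ^ grade n else 0) \<longlonglongrightarrow> 1"
    proof (rule Lim_transform_eventually)
      show "(\<lambda>i. (s i * s i) ^ grade n) \<longlonglongrightarrow> 1"
        using tendsto_power[OF tendsto_mult[OF s1 s1], of "grade n"] by simp
      show "\<forall>\<^sub>F i in sequentially. (s i * s i) ^ grade n = (if grade n \<le> M i then (s i * s i) ^ grade n else 0)"
        using eventually_ge_at_top[of "grade n"]
        by eventually_elim (use M(1) order_trans in auto)
    qed
  qed (use M in auto)
qed

section \<open>Khinchin inequalities\<close>

text \<open>What the three laws share: centring and unit variance give orthonormality, hence the
  second moment; the sub-Gaussian bound in every complex direction gives all higher moments.\<close>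

definition standard_law :: "complex measure \<Rightarrow> bool" where
  "standard_law L \<longleftrightarrow> prob_space L \<and> sets L = sets borel
     \<and> integrable L (\<lambda>x. (norm x)\<^sup>2) \<and> (\<integral>x. x \<partial>L) = 0 \<and> (\<integral>x. (norm x)\<^sup>2 \<partial>L) = 1
     \<and> (\<forall>c. (\<integral>\<^sup>+x. ennreal (exp (Re (c * x))) \<partial>L) \<le> ennreal (exp ((norm c)\<^sup>2 / 2)))"

text \<open>Re (c x) lies in an interval of length 2 |c|, so Hoeffding's lemma gives the exponent (2
  |c|)^2 / 8 = |c|^2 / 2.\<close>

lemma standard_law_unimodular:
  assumes "prob_space L" and sets [measurable_cong]: "sets L = sets borel"
    and AE: "AE x in L. norm x = 1" and mean: "(\<integral>x. x \<partial>L) = 0"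
  shows "standard_law L"
  unfolding standard_law_def
proof (intro conjI allI)
  interpret prob_space L by fact
  have int: "integrable L (\<lambda>x. x)"
    by (rule integrable_const_bound[of _ 1]) (use AE in \<open>auto elim: eventually_mono\<close>)
  show "integrable L (\<lambda>x. (norm x)\<^sup>2)"
    by (rule integrable_const_bound[of _ 1]) (use AE in \<open>auto elim: eventually_mono\<close>)
  have "(\<integral>x. (norm x)\<^sup>2 \<partial>L) = (\<integral>x. 1 \<partial>L)"
    by (intro integral_cong_AE) (use AE in \<open>auto elim: eventually_mono\<close>)
  then show "(\<integral>x. (norm x)\<^sup>2 \<partial>L) = 1" using prob_space by simp
  fix c :: complex
  interpret interval_bounded_random_variable L "\<lambda>x. Re (c * x)" "- norm c" "norm c"
  proof unfold_locales
    show "AE x in L. Re (c * x) \<in> {- norm c..norm c}"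
      using AE
    proof eventually_elim
      case (elim x)
      then show ?case using abs_Re_le_cmod[of "c * x"] by (auto simp: norm_mult abs_le_iff)
    qed
  qed measurable
  have "expectation (\<lambda>x. Re (c * x)) = Re (expectation (\<lambda>x. c * x))"
    using int by (intro integral_Re) auto
  also have "\<dots> = 0" using int mean by simp
  finally have "(\<integral>\<^sup>+x. ennreal (exp (1 * Re (c * x))) \<partial>L) \<le> ennreal (exp (1\<^sup>2 * (norm c - - norm c)\<^sup>2 / 8))"
    by (intro Hoeffdings_lemma_nn_integral_0) auto
  then show "(\<integral>\<^sup>+x. ennreal (exp (Re (c * x))) \<partial>L) \<le> ennreal (exp ((norm c)\<^sup>2 / 2))"
    by (simp add: power2_eq_square)
qed (use assms in auto)

lemma standard_law_bernoulli: "standard_law bernoulli_law"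
proof (rule standard_law_unimodular)
  show "prob_space bernoulli_law"
    unfolding bernoulli_law_def by (intro prob_space.prob_space_distr prob_space_measure_pmf) auto
  show "sets bernoulli_law = sets borel" by (simp add: bernoulli_law_def)
  show "AE x in bernoulli_law. norm x = 1"
    unfolding bernoulli_law_def by (subst AE_distr_iff) (auto simp: AE_measure_pmf_iff)
  show "(\<integral>x. x \<partial>bernoulli_law) = 0"
  proof -
    have "(\<integral>x. x \<partial>bernoulli_law) = (\<integral>x. x \<partial>measure_pmf (pmf_of_set {1, - 1 :: complex}))"
      unfolding bernoulli_law_def by (subst integral_distr) auto
    also have "\<dots> = (\<Sum>x\<in>{1, - 1}. pmf (pmf_of_set {1, - 1 :: complex}) x *\<^sub>R x)"
      by (rule integral_measure_pmf) auto
    also have "\<dots> = 0" by simp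
    finally show ?thesis .
  qed
qed

lemma standard_law_circle: "standard_law circle_law"
proof (rule standard_law_unimodular)
  have "(\<integral>x. x \<partial>circle_law) = (\<integral>x. x \<partial>distr circle_law circle_law (\<lambda>x. - 1 * x))"
    by (subst distr_circle_law_rotate) auto
  also have "\<dots> = - (\<integral>x. x \<partial>circle_law)"
    by (subst integral_distr) auto
  finally show "(\<integral>x. x \<partial>circle_law) = 0" by simp
qed (auto simp: prob_space_circle_law AE_circle_law)

text \<open>The exponential moment follows by completing the square. The law lives on the real line,
  so only Re c enters, and |Re c| is at most |c|.\<close>

lemma standard_law_gaussian: "standard_law gaussian_law"
  unfolding standard_law_def
proof (intro conjI allI)
  show "prob_space gaussian_law"
    unfolding gaussian_law_def by (intro prob_space.prob_space_distr prob_space_normal_density) auto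
  show "sets gaussian_law = sets borel" by (simp add: gaussian_law_def)
  have 1: "has_bochner_integral lborel (\<lambda>x. std_normal_density x * x) 0"
    using std_normal_moment_odd[of 0] by simp
  have 2: "has_bochner_integral lborel (\<lambda>x. std_normal_density x * x\<^sup>2) 1"
    using std_normal_moment_even[of 1] by (simp add: fact_numeral)
  show "integrable gaussian_law (\<lambda>x. (norm x)\<^sup>2)"
    unfolding gaussian_law_def using 2
    by (subst integrable_distr_eq) (auto simp: integrable_density has_bochner_integral_iff)
  show "(\<integral>x. (norm x)\<^sup>2 \<partial>gaussian_law) = 1"
    unfolding gaussian_law_def using 2
    by (subst integral_distr) (auto simp: integral_density has_bochner_integral_iff)
  have "(\<integral>x. x \<partial>gaussian_law) = (\<integral>x. complex_of_real (std_normal_density x * x) \<partial>lborel)"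
    unfolding gaussian_law_def
    by (subst integral_distr) (auto simp: integral_density scaleR_conv_of_real simp del: integral_complex_of_real)
  also have "\<dots> = 0" using 1 by (simp only: integral_complex_of_real has_bochner_integral_iff of_real_0)
  finally show "(\<integral>x. x \<partial>gaussian_law) = 0" .
  fix c :: complex
  define a where "a = Re c"
  have "(\<integral>\<^sup>+x. ennreal (exp (Re (c * x))) \<partial>gaussian_law)
      = (\<integral>\<^sup>+x. ennreal (std_normal_density x) * ennreal (exp (a * x)) \<partial>lborel)"
    unfolding gaussian_law_def by (subst nn_integral_distr) (auto simp: nn_integral_density a_def)
  also have "\<dots> = (\<integral>\<^sup>+x. ennreal (exp (a\<^sup>2 / 2)) * ennreal (normal_density a 1 x) \<partial>lborel)"
  proof (intro nn_integral_cong)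
    fix x :: real
    have "- x\<^sup>2 / 2 + a * x = a\<^sup>2 / 2 + - (x - a)\<^sup>2 / 2"
      by (simp add: power2_eq_square field_simps)
    then have "exp (- x\<^sup>2 / 2) * exp (a * x) = exp (a\<^sup>2 / 2) * exp (- (x - a)\<^sup>2 / 2)"
      by (simp only: exp_add[symmetric])
    then have "std_normal_density x * exp (a * x) = exp (a\<^sup>2 / 2) * normal_density a 1 x"
      by (simp add: normal_density_def field_simps)
    then show "ennreal (std_normal_density x) * ennreal (exp (a * x))
        = ennreal (exp (a\<^sup>2 / 2)) * ennreal (normal_density a 1 x)"
      by (simp add: ennreal_mult[symmetric])
  qed
  also have "\<dots> = ennreal (exp (a\<^sup>2 / 2)) * (\<integral>\<^sup>+x. ennreal (normal_density a 1 x) \<partial>lborel)"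
    by (rule nn_integral_cmult) auto
  also have "(\<integral>\<^sup>+x. ennreal (normal_density a 1 x) \<partial>lborel) = 1"
    by (subst nn_integral_eq_integral) auto
  also have "ennreal (exp (a\<^sup>2 / 2)) * 1 \<le> ennreal (exp ((norm c)\<^sup>2 / 2))"
    using abs_Re_le_cmod[of c] by (auto simp: a_def abs_le_square_iff[symmetric] intro!: ennreal_leI)
  finally show "(\<integral>\<^sup>+x. ennreal (exp (Re (c * x))) \<partial>gaussian_law) \<le> ennreal (exp ((norm c)\<^sup>2 / 2))" .
qed

text \<open>Apply t <= exp t to t = |x| / p and raise to the power p; this is the origin of the
  constant p^p.\<close>

lemma powr_le_exp:
  fixes x :: real
  assumes "0 < p"
  shows "\<bar>x\<bar> powr p \<le> p powr p * (exp x + exp (- x))"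
proof -
  have "\<bar>x\<bar> / p \<le> exp (\<bar>x\<bar> / p)" using exp_ge_add_one_self[of "\<bar>x\<bar> / p"] by linarith
  then have "\<bar>x\<bar> \<le> p * exp (\<bar>x\<bar> / p)" using assms by (simp add: field_simps)
  then have "\<bar>x\<bar> powr p \<le> (p * exp (\<bar>x\<bar> / p)) powr p" using assms by (intro powr_mono2) auto
  also have "\<dots> = p powr p * exp \<bar>x\<bar>"
    using assms by (simp add: powr_mult exp_powr_real)
  also have "exp \<bar>x\<bar> \<le> exp x + exp (- x)" by (simp add: abs_if)
  finally show ?thesis using assms by (simp add: mult_left_mono)
qed

text \<open>The factor 2^p separates real and imaginary parts, p^p comes from
  \<open>powr_le_exp\<close>, and four exponentials have mean at most exp (1/2) each for a sum of
  unit variance.\<close>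

definition khinchin_const :: "real \<Rightarrow> real" where
  "khinchin_const p = 2 powr p * (p powr p * (4 * exp (1 / 2)))"

locale standard_sequence = prob_space M for M :: "'a measure" +
  fixes X :: "nat \<Rightarrow> 'a \<Rightarrow> complex" and L :: "complex measure"
  assumes law: "standard_law L"
    and indep: "indep_vars (\<lambda>_. borel) X {1..}"
    and distr_X: "\<And>n. 1 \<le> n \<Longrightarrow> distr M borel (X n) = L"
begin

lemma measurable_X: "1 \<le> n \<Longrightarrow> X n \<in> borel_measurable M"
  using indep by (auto simp: indep_vars_def)

lemma borel_measurable_random_sum:
  assumes "S \<subseteq> {1..}"
  shows "(\<lambda>\<omega>. \<Sum>n\<in>S. c n * X n \<omega>) \<in> borel_measurable M"
  using assms measurable_X by (intro borel_measurable_sum borel_measurable_times borel_measurable_const) auto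

lemma nn_integral_exp_random_sum_le:
  assumes S: "finite S" "S \<subseteq> {1..}"
  shows "(\<integral>\<^sup>+\<omega>. ennreal (exp (Re (\<Sum>n\<in>S. c n * X n \<omega>))) \<partial>M) \<le> ennreal (exp ((\<Sum>n\<in>S. (norm (c n))\<^sup>2) / 2))"
proof -
  have "(\<integral>\<^sup>+\<omega>. ennreal (exp (Re (\<Sum>n\<in>S. c n * X n \<omega>))) \<partial>M)
      = (\<integral>\<^sup>+\<omega>. (\<Prod>n\<in>S. ennreal (exp (Re (c n * X n \<omega>)))) \<partial>M)"
    using S by (simp add: Re_sum exp_sum prod_ennreal)
  also have "\<dots> = (\<Prod>n\<in>S. \<integral>\<^sup>+\<omega>. ennreal (exp (Re (c n * X n \<omega>))) \<partial>M)"
  proof (rule indep_vars_nn_integral)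
    show "indep_vars (\<lambda>_. borel) (\<lambda>n \<omega>. ennreal (exp (Re (c n * X n \<omega>)))) S"
      by (rule indep_vars_compose2[OF indep_vars_subset[OF indep S(2)]]) auto
  qed (use S in auto)
  also have "\<dots> = (\<Prod>n\<in>S. \<integral>\<^sup>+x. ennreal (exp (Re (c n * x))) \<partial>L)"
  proof (intro prod.cong refl)
    fix n assume "n \<in> S"
    then have "1 \<le> n" using S(2) by auto
    then show "(\<integral>\<^sup>+\<omega>. ennreal (exp (Re (c n * X n \<omega>))) \<partial>M) = (\<integral>\<^sup>+x. ennreal (exp (Re (c n * x))) \<partial>L)"
      using measurable_X[of n] by (subst distr_X[of n, symmetric]) (auto simp: nn_integral_distr)
  qed
  also have "\<dots> \<le> (\<Prod>n\<in>S. ennreal (exp ((norm (c n))\<^sup>2 / 2)))"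
    using law by (intro prod_mono_ennreal) (auto simp: standard_law_def)
  also have "\<dots> = ennreal (exp ((\<Sum>n\<in>S. (norm (c n))\<^sup>2) / 2))"
    using S by (simp add: prod_ennreal exp_sum[symmetric] sum_divide_distrib)
  finally show ?thesis .
qed

lemma khinchin_upper_normalized:
  assumes S: "finite S" "S \<subseteq> {1..}" and p: "0 < p" and c: "(\<Sum>n\<in>S. (norm (c n))\<^sup>2) = 1"
  shows "(\<integral>\<^sup>+\<omega>. ennreal (norm (\<Sum>n\<in>S. c n * X n \<omega>) powr p) \<partial>M) \<le> ennreal (khinchin_const p)"
proof -
  let ?Z = "\<lambda>\<omega>. \<Sum>n\<in>S. c n * X n \<omega>"
  \<comment> \<open>Multiplying the coefficients by u = 1, -1, -i, i turns the real part into Re,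
    -Re, Im, -Im of the sum, so one exponential bound handles all four.\<close>
  define E where "E u \<omega> = ennreal (exp (Re (\<Sum>n\<in>S. (u * c n) * X n \<omega>)))" for u \<omega>
  have uZ: "(\<Sum>n\<in>S. (u * c n) * X n \<omega>) = u * ?Z \<omega>" for u \<omega>
    by (simp add: sum_distrib_left mult.assoc)
  have E_le: "(\<integral>\<^sup>+\<omega>. E u \<omega> \<partial>M) \<le> ennreal (exp (1 / 2))" if "norm u = 1" for u
    using nn_integral_exp_random_sum_le[OF S, of "\<lambda>n. u * c n"] c that by (simp add: E_def norm_mult)
  have [measurable]: "?Z \<in> borel_measurable M" using S(2) by (rule borel_measurable_random_sum)
  have [measurable]: "(\<lambda>\<omega>. \<Sum>n\<in>S. (u * c n) * X n \<omega>) \<in> borel_measurable M" for u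
    using S(2) by (rule borel_measurable_random_sum)
  have [measurable]: "E u \<in> borel_measurable M" for u unfolding E_def by measurable
  have "(\<integral>\<^sup>+\<omega>. ennreal (norm (?Z \<omega>) powr p) \<partial>M)
      \<le> (\<integral>\<^sup>+\<omega>. ennreal (2 powr p * p powr p) * (E 1 \<omega> + E (- 1) \<omega> + E (- \<i>) \<omega> + E \<i> \<omega>) \<partial>M)"
  proof (intro nn_integral_mono)
    fix \<omega>
    let ?x = "Re (?Z \<omega>)" and ?y = "Im (?Z \<omega>)"
    have "norm (?Z \<omega>) powr p \<le> (\<bar>?x\<bar> + \<bar>?y\<bar>) powr p"
      using p by (intro powr_mono2 cmod_le) auto
    also have "\<dots> \<le> 2 powr p * (\<bar>?x\<bar> powr p + \<bar>?y\<bar> powr p)"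
      using p by (intro add_powr_le) auto
    also have "\<dots> \<le> 2 powr p * (p powr p * (exp ?x + exp (- ?x)) + p powr p * (exp ?y + exp (- ?y)))"
      using p by (intro mult_left_mono add_mono powr_le_exp) auto
    also have "\<dots> = 2 powr p * p powr p * (exp ?x + exp (- ?x) + exp ?y + exp (- ?y))"
      by (simp add: algebra_simps)
    finally have "ennreal (norm (?Z \<omega>) powr p) \<le> ennreal \<dots>" by (rule ennreal_leI)
    also have "\<dots> = ennreal (2 powr p * p powr p) * (ennreal (exp ?x) + ennreal (exp (- ?x)) + ennreal (exp ?y) + ennreal (exp (- ?y)))"
      by (simp add: ennreal_mult ennreal_plus)
    finally show "ennreal (norm (?Z \<omega>) powr p)
        \<le> ennreal (2 powr p * p powr p) * (E 1 \<omega> + E (- 1) \<omega> + E (- \<i>) \<omega> + E \<i> \<omega>)"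
      unfolding E_def by (simp only: uZ) simp
  qed
  also have "\<dots> = ennreal (2 powr p * p powr p) * ((\<integral>\<^sup>+\<omega>. E 1 \<omega> \<partial>M) + (\<integral>\<^sup>+\<omega>. E (- 1) \<omega> \<partial>M)
      + (\<integral>\<^sup>+\<omega>. E (- \<i>) \<omega> \<partial>M) + (\<integral>\<^sup>+\<omega>. E \<i> \<omega> \<partial>M))"
    by (simp add: nn_integral_cmult nn_integral_add)
  also have "\<dots> \<le> ennreal (2 powr p * p powr p) * (ennreal (exp (1 / 2)) + ennreal (exp (1 / 2))
      + ennreal (exp (1 / 2)) + ennreal (exp (1 / 2)))"
    by (intro mult_left_mono add_mono E_le) auto
  also have "\<dots> = ennreal (khinchin_const p)"
    by (simp add: khinchin_const_def ennreal_plus[symmetric] ennreal_mult[symmetric] mult.assoc del: ennreal_plus)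
  finally show ?thesis .
qed

lemma khinchin_upper:
  assumes S: "finite S" "S \<subseteq> {1..}" and p: "0 < p"
  shows "(\<integral>\<^sup>+\<omega>. ennreal (norm (\<Sum>n\<in>S. c n * X n \<omega>) powr p) \<partial>M)
       \<le> ennreal (khinchin_const p * (\<Sum>n\<in>S. (norm (c n))\<^sup>2) powr (p / 2))"
proof (cases "(\<Sum>n\<in>S. (norm (c n))\<^sup>2) = 0")
  case True
  then have "c n = 0" if "n \<in> S" for n
    using S that by (simp add: sum_nonneg_eq_0_iff)
  then have "(\<Sum>n\<in>S. c n * X n \<omega>) = 0" for \<omega> by simp
  then show ?thesis using p by simp
next
  case False
  define v where "v = (\<Sum>n\<in>S. (norm (c n))\<^sup>2)"
  have v: "0 < v" using False sum_nonneg[of S "\<lambda>n. (norm (c n))\<^sup>2"] by (simp add: v_def less_le)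
  define d where "d n = c n / of_real (sqrt v)" for n
  have d: "(\<Sum>n\<in>S. (norm (d n))\<^sup>2) = 1"
    using v by (simp add: d_def norm_divide power_divide sum_divide_distrib[symmetric] v_def[symmetric])
  have eq: "norm (\<Sum>n\<in>S. c n * X n \<omega>) powr p = v powr (p / 2) * norm (\<Sum>n\<in>S. d n * X n \<omega>) powr p" for \<omega>
  proof -
    have "(\<Sum>n\<in>S. c n * X n \<omega>) = of_real (sqrt v) * (\<Sum>n\<in>S. d n * X n \<omega>)"
      using v by (simp add: d_def sum_distrib_left)
    then show ?thesis
      using v by (simp add: norm_mult powr_mult powr_half_sqrt[symmetric] powr_powr)
  qed
  have [measurable]: "(\<lambda>\<omega>. \<Sum>n\<in>S. d n * X n \<omega>) \<in> borel_measurable M"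
    using S(2) by (rule borel_measurable_random_sum)
  have "(\<integral>\<^sup>+\<omega>. ennreal (norm (\<Sum>n\<in>S. c n * X n \<omega>) powr p) \<partial>M)
      = ennreal (v powr (p / 2)) * (\<integral>\<^sup>+\<omega>. ennreal (norm (\<Sum>n\<in>S. d n * X n \<omega>) powr p) \<partial>M)"
    unfolding eq by (simp add: ennreal_mult nn_integral_cmult)
  also have "\<dots> \<le> ennreal (v powr (p / 2)) * ennreal (khinchin_const p)"
    by (intro mult_left_mono khinchin_upper_normalized[OF S p d]) auto
  finally show ?thesis by (simp add: ennreal_mult[symmetric] khinchin_const_def v_def mult.commute)
qed

lemma
  assumes "1 \<le> n"
  shows integrable_norm_X_square: "integrable M (\<lambda>\<omega>. (norm (X n \<omega>))\<^sup>2)"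
    and integral_norm_X_square: "(\<integral>\<omega>. (norm (X n \<omega>))\<^sup>2 \<partial>M) = 1"
    and integrable_X: "integrable M (X n)"
    and integral_X: "(\<integral>\<omega>. X n \<omega> \<partial>M) = 0"
proof -
  note [measurable] = measurable_X[OF assms]
  show sq: "integrable M (\<lambda>\<omega>. (norm (X n \<omega>))\<^sup>2)"
    using law integrable_distr[of "X n" M borel "\<lambda>x. (norm x)\<^sup>2"]
    by (simp add: distr_X[OF assms] standard_law_def)
  show "(\<integral>\<omega>. (norm (X n \<omega>))\<^sup>2 \<partial>M) = 1"
    using law integral_distr[of "X n" M borel "\<lambda>x. (norm x)\<^sup>2"]
    by (simp add: distr_X[OF assms] standard_law_def)
  have "(\<integral>\<omega>. X n \<omega> \<partial>M) = (\<integral>x. x \<partial>distr M borel (X n))"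
    by (rule integral_distr[symmetric]) auto
  also have "\<dots> = 0"
    unfolding distr_X[OF assms] using law by (simp only: standard_law_def)
  finally show "(\<integral>\<omega>. X n \<omega> \<partial>M) = 0" .
  show "integrable M (X n)"
  proof (rule Bochner_Integration.integrable_bound)
    show "integrable M (\<lambda>\<omega>. 1 + (norm (X n \<omega>))\<^sup>2)" using sq by simp
    have "t \<le> 1 + t\<^sup>2" for t :: real
      using zero_le_power2[of "t - 1 / 2"] by (simp add: power2_eq_square algebra_simps)
    then show "AE \<omega> in M. norm (X n \<omega>) \<le> norm (1 + (norm (X n \<omega>))\<^sup>2)" by simp
  qed auto
qed

lemma
  assumes "1 \<le> m" "1 \<le> n"
  shows integrable_X_cnj_X: "integrable M (\<lambda>\<omega>. X m \<omega> * cnj (X n \<omega>))" (is ?int)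
    and integral_X_cnj_X: "(\<integral>\<omega>. X m \<omega> * cnj (X n \<omega>) \<partial>M) = (if m = n then 1 else 0)" (is ?eq)
proof -
  have "?int \<and> ?eq"
  proof (cases "m = n")
    case True
    have "integrable M (\<lambda>\<omega>. complex_of_real ((norm (X n \<omega>))\<^sup>2))"
      "(\<integral>\<omega>. complex_of_real ((norm (X n \<omega>))\<^sup>2) \<partial>M) = 1"
      using integrable_norm_X_square[OF assms(2)] integral_norm_X_square[OF assms(2)]
      by (auto simp del: of_real_power)
    then show ?thesis using True by (simp only: complex_norm_square) simp
  next
    case False
    \<comment> \<open>The product rule for independent variables takes one function per index; the
      conjugation is attached to the index \<open>n\<close>.\<close>
    define Y where "Y i = (if i = m then (\<lambda>x. x) else cnj)" for i
    have ind: "indep_vars (\<lambda>_. borel) (\<lambda>i \<omega>. Y i (X i \<omega>)) {m, n}"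
      by (rule indep_vars_compose2[OF indep_vars_subset[OF indep]]) (use assms in \<open>auto simp: Y_def\<close>)
    have int: "integrable M (\<lambda>\<omega>. Y i (X i \<omega>))" if "i \<in> {m, n}" for i
      using that assms integrable_X by (auto simp: Y_def)
    have prod: "(\<Prod>i\<in>{m, n}. Y i (X i \<omega>)) = X m \<omega> * cnj (X n \<omega>)" for \<omega>
      using False by (simp add: Y_def)
    have ?int
      using indep_vars_integrable[OF _ ind int] by (simp add: prod)
    moreover have "(\<integral>\<omega>. X m \<omega> * cnj (X n \<omega>) \<partial>M) = (\<Prod>i\<in>{m, n}. \<integral>\<omega>. Y i (X i \<omega>) \<partial>M)"
      using indep_vars_lebesgue_integral[OF _ ind int] by (simp add: prod)
    moreover have "\<dots> = 0" using False integral_X[OF assms(1)] by (simp add: Y_def)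
    ultimately show ?thesis using False by simp
  qed
  then show ?int ?eq by auto
qed

lemma
  assumes S: "finite S" "S \<subseteq> {1..}"
  shows integrable_norm_random_sum_square: "integrable M (\<lambda>\<omega>. (norm (\<Sum>n\<in>S. c n * X n \<omega>))\<^sup>2)" (is ?int)
    and integral_norm_random_sum_square:
      "(\<integral>\<omega>. (norm (\<Sum>n\<in>S. c n * X n \<omega>))\<^sup>2 \<partial>M) = (\<Sum>n\<in>S. (norm (c n))\<^sup>2)" (is ?eq)
proof -
  let ?Z = "\<lambda>\<omega>. \<Sum>n\<in>S. c n * X n \<omega>"
  have eq: "complex_of_real ((norm (?Z \<omega>))\<^sup>2)
      = (\<Sum>m\<in>S. \<Sum>n\<in>S. c m * cnj (c n) * (X m \<omega> * cnj (X n \<omega>)))" for \<omega>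
    unfolding complex_norm_square cnj_sum sum_product by (simp add: algebra_simps)
  have S1: "1 \<le> n" if "n \<in> S" for n using S(2) that by auto
  have int: "integrable M (\<lambda>\<omega>. complex_of_real ((norm (?Z \<omega>))\<^sup>2))"
    unfolding eq using S1 by (intro Bochner_Integration.integrable_sum integrable_mult_right integrable_X_cnj_X) auto
  then show ?int by (simp only: complex_of_real_integrable_eq)
  have "complex_of_real (\<integral>\<omega>. (norm (?Z \<omega>))\<^sup>2 \<partial>M) = (\<integral>\<omega>. complex_of_real ((norm (?Z \<omega>))\<^sup>2) \<partial>M)"
    by (rule integral_complex_of_real[symmetric])
  also have "\<dots> = (\<Sum>m\<in>S. \<Sum>n\<in>S. c m * cnj (c n) * (if m = n then 1 else 0))"
    unfolding eq using S1
    by (simp add: Bochner_Integration.integral_sum integrable_X_cnj_X integral_X_cnj_X cong: sum.cong)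
  also have "\<dots> = complex_of_real (\<Sum>n\<in>S. (norm (c n))\<^sup>2)"
    using S(1) by (simp add: if_distrib sum.If_cases complex_norm_square[symmetric] cong: if_cong)
  finally show ?eq by (simp only: of_real_eq_iff)
qed

text \<open>A Paley-Zygmund argument comparing the second moment v with the fourth moment, which is
  at most K v^2.\<close>

lemma khinchin_lower:
  assumes S: "finite S" "S \<subseteq> {1..}"
  shows "1 / (2 * khinchin_const 4) \<le> prob {\<omega> \<in> space M. sqrt (\<Sum>n\<in>S. (norm (c n))\<^sup>2) / 2 \<le> norm (\<Sum>n\<in>S. c n * X n \<omega>)}"
proof -
  let ?Z = "\<lambda>\<omega>. \<Sum>n\<in>S. c n * X n \<omega>"
  define v where "v = (\<Sum>n\<in>S. (norm (c n))\<^sup>2)"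
  define K where "K = khinchin_const 4"
  define A where "A = {\<omega> \<in> space M. sqrt v / 2 \<le> norm (?Z \<omega>)}"
  have K: "1 \<le> K"
  proof -
    have "1 * (1 * (4 * 1)) \<le> (2::real) powr 4 * (4 powr 4 * (4 * exp (1 / 2)))"
      by (intro mult_mono) auto
    then show ?thesis by (simp add: K_def khinchin_const_def)
  qed
  have v0: "0 \<le> v" by (simp add: v_def sum_nonneg)
  have [measurable]: "?Z \<in> borel_measurable M" using S(2) by (rule borel_measurable_random_sum)
  have A: "A \<in> events" unfolding A_def by measurable
  have "1 / (2 * K) \<le> prob A"
  proof (cases "v = 0")
    case True
    then have "A = space M" by (auto simp: A_def)
    then show ?thesis using K by (simp add: prob_space field_simps)
  next
    case False
    then have v: "0 < v" using v0 by simp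
    have m4: "(\<integral>\<^sup>+\<omega>. ennreal ((norm (?Z \<omega>)) ^ 4) \<partial>M) \<le> ennreal (K * v\<^sup>2)"
      using khinchin_upper[OF S, of 4 c] v by (simp add: K_def v_def)
    have i4: "integrable M (\<lambda>\<omega>. (norm (?Z \<omega>)) ^ 4)"
      by (rule integrableI_nonneg) (use m4 in \<open>auto simp: top_unique less_top[symmetric] intro: le_less_trans\<close>)
    have I4: "(\<integral>\<omega>. (norm (?Z \<omega>)) ^ 4 \<partial>M) \<le> K * v\<^sup>2"
      using m4 K by (subst (asm) nn_integral_eq_integral[OF i4]) auto
    have iA: "integrable M (indicator A :: _ \<Rightarrow> real)"
      using A by (auto simp: integrable_indicator_iff less_top[symmetric])
    have "v = (\<integral>\<omega>. (norm (?Z \<omega>))\<^sup>2 \<partial>M)"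
      by (simp add: integral_norm_random_sum_square[OF S] v_def)
    \<comment> \<open>Off \<open>A\<close> the square is at most v/4; on \<open>A\<close> the
      arithmetic-geometric mean inequality bounds it. The weight 1/(2 K v) is chosen so that the
      fourth-moment term integrates to at most v/2, leaving v/4 to be carried by the probability of
      \<open>A\<close>.\<close>
    also have "\<dots> \<le> (\<integral>\<omega>. v / 4 + (1 / (2 * K * v) * (norm (?Z \<omega>)) ^ 4 + K * v / 2 * indicator A \<omega>) \<partial>M)"
    proof (intro integral_mono integrable_norm_random_sum_square S)
      show "integrable M (\<lambda>\<omega>. v / 4 + (1 / (2 * K * v) * (norm (?Z \<omega>)) ^ 4 + K * v / 2 * indicator A \<omega>))"
        using i4 iA by (intro Bochner_Integration.integrable_add integrable_mult_right integrable_const)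
      fix \<omega> assume \<omega>: "\<omega> \<in> space M"
      define t where "t = (norm (?Z \<omega>))\<^sup>2"
      have t4: "(norm (?Z \<omega>)) ^ 4 = t\<^sup>2" by (simp add: t_def)
      show "(norm (?Z \<omega>))\<^sup>2 \<le> v / 4 + (1 / (2 * K * v) * (norm (?Z \<omega>)) ^ 4 + K * v / 2 * indicator A \<omega>)"
      proof (cases "\<omega> \<in> A")
        case True
        have "0 \<le> (t - K * v)\<^sup>2" by simp
        then have "2 * (K * v) * t \<le> t\<^sup>2 + (K * v)\<^sup>2" by (simp add: power2_eq_square algebra_simps)
        then have "t \<le> (t\<^sup>2 + (K * v)\<^sup>2) / (2 * (K * v))" using K v by (simp add: field_simps)
        also have "\<dots> = 1 / (2 * K * v) * t\<^sup>2 + K * v / 2"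
          using K v by (simp add: field_simps power2_eq_square)
        finally show ?thesis using True v unfolding t4 t_def[symmetric] by simp
      next
        case False
        then have "norm (?Z \<omega>) \<le> sqrt v / 2" using \<omega> by (auto simp: A_def)
        then have "t \<le> (sqrt v / 2)\<^sup>2" unfolding t_def by (intro power_mono) auto
        also have "\<dots> = v / 4" using v by (simp add: power_divide)
        finally show ?thesis using False K v unfolding t4 t_def[symmetric] by (simp add: add_increasing2)
      qed
    qed
    also have "\<dots> = v / 4 + (1 / (2 * K * v) * (\<integral>\<omega>. (norm (?Z \<omega>)) ^ 4 \<partial>M) + K * v / 2 * prob A)"
    proof -
      have "integrable M (\<lambda>\<omega>. 1 / (2 * K * v) * (norm (?Z \<omega>)) ^ 4)" "integrable M (\<lambda>\<omega>. K * v / 2 * indicator A \<omega>)"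
        using i4 iA by (auto intro!: integrable_mult_right)
      then have "(\<integral>\<omega>. v / 4 + (1 / (2 * K * v) * (norm (?Z \<omega>)) ^ 4 + K * v / 2 * indicator A \<omega>) \<partial>M)
         = (\<integral>\<omega>. v / 4 \<partial>M) + ((\<integral>\<omega>. 1 / (2 * K * v) * (norm (?Z \<omega>)) ^ 4 \<partial>M) + (\<integral>\<omega>. K * v / 2 * indicator A \<omega> \<partial>M))"
        by (simp only: Bochner_Integration.integral_add Bochner_Integration.integrable_add integrable_const)
      also have "(\<integral>\<omega>. v / 4 \<partial>M) = v / 4" by (simp add: prob_space)
      also have "(\<integral>\<omega>. K * v / 2 * indicator A \<omega> \<partial>M) = K * v / 2 * prob A"
        using A by simp
      also have "(\<integral>\<omega>. 1 / (2 * K * v) * (norm (?Z \<omega>)) ^ 4 \<partial>M) = 1 / (2 * K * v) * (\<integral>\<omega>. (norm (?Z \<omega>)) ^ 4 \<partial>M)"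
        by (rule integral_mult_right_zero)
      finally show ?thesis .
    qed
    also have "\<dots> \<le> v / 4 + (1 / (2 * K * v) * (K * v\<^sup>2) + K * v / 2 * prob A)"
      using I4 K v by (intro add_mono mult_left_mono order_refl) auto
    also have "1 / (2 * K * v) * (K * v\<^sup>2) = v / 2" using K v by (simp add: power2_eq_square)
    finally have "v / 4 \<le> K * v / 2 * prob A" by simp
    then have "v * 1 \<le> v * (2 * K * prob A)" by (simp add: algebra_simps)
    then have "1 \<le> 2 * K * prob A" using v by (simp only: mult_le_cancel_left_pos)
    then show ?thesis using K by (simp add: field_simps)
  qed
  then show ?thesis by (simp add: A_def K_def v_def)
qed

text \<open>The sum is large with probability at least 1/(2K) and \<open>B\<close> misses at most
  1/(4K), so 1/(4K) is left on \<open>B\<close>. The condition on \<open>B\<close> does not involve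
  the coefficients.\<close>

lemma khinchin_lower_restricted:
  assumes S: "finite S" "S \<subseteq> {1..}" and p: "0 < p"
    and B: "B \<in> events" "1 - 1 / (4 * khinchin_const 4) \<le> prob B"
  shows "ennreal (1 / (4 * khinchin_const 4) / 2 powr p * (\<Sum>n\<in>S. (norm (c n))\<^sup>2) powr (p / 2))
      \<le> (\<integral>\<^sup>+\<omega>. ennreal (norm (\<Sum>n\<in>S. c n * X n \<omega>) powr p) * indicator B \<omega> \<partial>M)"
proof -
  let ?Z = "\<lambda>\<omega>. \<Sum>n\<in>S. c n * X n \<omega>"
  define v where "v = (\<Sum>n\<in>S. (norm (c n))\<^sup>2)"
  define A where "A = {\<omega> \<in> space M. sqrt v / 2 \<le> norm (?Z \<omega>)}"
  define K where "K = khinchin_const 4"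
  have v: "0 \<le> v" by (simp add: v_def sum_nonneg)
  have [measurable]: "?Z \<in> borel_measurable M" using S(2) by (rule borel_measurable_random_sum)
  have A: "A \<in> events" unfolding A_def by measurable
  have "prob A + prob B = prob (A \<union> B) + prob (A \<inter> B)"
    using A B by (simp add: finite_measure_Union' measure_Un3 fmeasurable_eq_sets)
  moreover have "prob (A \<union> B) \<le> 1" by (rule prob_le_1)
  moreover have "1 / (2 * K) \<le> prob A" unfolding A_def v_def K_def using S by (rule khinchin_lower)
  moreover have "1 / (2 * K) = 2 * (1 / (4 * K))" by simp
  moreover have "1 - 1 / (4 * K) \<le> prob B" using B by (simp add: K_def)
  ultimately have "1 / (4 * K) \<le> prob (A \<inter> B)" by linarith
  then have "ennreal ((sqrt v / 2) powr p * (1 / (4 * K))) \<le> ennreal ((sqrt v / 2) powr p * prob (A \<inter> B))"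
    by (intro ennreal_leI mult_left_mono) auto
  also have "\<dots> = (\<integral>\<^sup>+\<omega>. ennreal ((sqrt v / 2) powr p) * indicator (A \<inter> B) \<omega> \<partial>M)"
    using A B by (subst nn_integral_cmult_indicator) (auto simp: emeasure_eq_measure ennreal_mult)
  also have "\<dots> \<le> (\<integral>\<^sup>+\<omega>. ennreal (norm (?Z \<omega>) powr p) * indicator B \<omega> \<partial>M)"
  proof (intro nn_integral_mono)
    fix \<omega>
    show "ennreal ((sqrt v / 2) powr p) * indicator (A \<inter> B) \<omega> \<le> ennreal (norm (?Z \<omega>) powr p) * indicator B \<omega>"
      using p v by (auto simp: A_def indicator_def intro!: ennreal_leI powr_mono2)
  qed
  also have "(sqrt v / 2) powr p = v powr (p / 2) / 2 powr p"
    using v by (simp add: powr_divide powr_half_sqrt[symmetric] powr_powr)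
  finally show ?thesis by (simp add: v_def K_def mult.commute)
qed

end

section \<open>Weighted norms and square functions\<close>

text \<open>Fatou's lemma. The bound is required only eventually, since a Cauchy sequence is bounded
  here only from some index on.\<close>

lemma nn_integral_le_of_tendsto:
  fixes g :: "nat \<Rightarrow> 'b \<Rightarrow> ennreal"
  assumes [measurable]: "\<And>k. g k \<in> borel_measurable N"
    and lim: "AE x in N. (\<lambda>k. g k x) \<longlonglongrightarrow> h x"
    and le: "\<forall>\<^sub>F k in sequentially. (\<integral>\<^sup>+x. g k x \<partial>N) \<le> B"
  shows "(\<integral>\<^sup>+x. h x \<partial>N) \<le> B"
proof -
  have "(\<integral>\<^sup>+x. h x \<partial>N) = (\<integral>\<^sup>+x. liminf (\<lambda>k. g k x) \<partial>N)"
    by (intro nn_integral_cong_AE eventually_mono[OF lim]) (auto dest!: lim_imp_Liminf[rotated])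
  also have "\<dots> \<le> liminf (\<lambda>k. \<integral>\<^sup>+x. g k x \<partial>N)"
    by (rule nn_integral_liminf) measurable
  also have "\<dots> \<le> B" using le by (intro Liminf_le) auto
  finally show ?thesis .
qed

lemma dirichlet_shift_altdef: "dirichlet_shift \<sigma> a = (\<lambda>n. of_real (real n powr (- \<sigma>)) * a n)"
  by (simp add: dirichlet_shift_def fun_eq_iff mult.commute)

abbreviation sq_shift :: "real \<Rightarrow> (nat \<Rightarrow> complex) \<Rightarrow> nat \<Rightarrow> real" where
  "sq_shift \<sigma> a n \<equiv> (norm (dirichlet_shift \<sigma> a n))\<^sup>2"

abbreviation square_fun :: "real \<Rightarrow> (nat \<Rightarrow> complex) \<Rightarrow> nat set \<Rightarrow> real \<Rightarrow> ennreal" where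
  "square_fun q a S \<sigma> \<equiv> ennreal ((\<Sum>n\<in>S. sq_shift \<sigma> a n) powr (q / 2))"

lemma dirichlet_shift_polynomials:
  "a \<in> dirichlet_polynomials \<Longrightarrow> dirichlet_shift \<sigma> a \<in> dirichlet_polynomials"
  unfolding dirichlet_shift_altdef by (rule multiplier_dirichlet_polynomials)

lemma dirichlet_shift_add: "dirichlet_shift \<sigma> (\<lambda>n. a n + b n) = (\<lambda>n. dirichlet_shift \<sigma> a n + dirichlet_shift \<sigma> b n)"
  by (simp add: dirichlet_shift_def fun_eq_iff ring_distribs)

text \<open>An index set independent of \<sigma> makes joint measurability in (\<sigma>, z) visible.
  The value 0 is the convention for sums over infinite sets.\<close>

lemma bohr_lift_shift:
  "bohr_lift (dirichlet_shift \<sigma> a) z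
     = (if finite (dirichlet_support a) then \<Sum>n\<in>dirichlet_support a. of_real (real n powr (- \<sigma>)) * a n * bohr_monomial n z else 0)"
proof (cases "finite (dirichlet_support a)")
  case True
  then have "a \<in> dirichlet_polynomials" by (simp add: dirichlet_polynomials_def dirichlet_support_def)
  then show ?thesis using True unfolding dirichlet_shift_altdef by (simp add: bohr_lift_multiplier)
next
  case False
  have "{n. 1 \<le> n \<and> dirichlet_shift \<sigma> a n \<noteq> 0} = dirichlet_support a"
    by (auto simp: dirichlet_shift_def dirichlet_support_def)
  with False show ?thesis by (simp add: bohr_lift_def)
qed

lemma borel_measurable_bohr_lift_shift [measurable]:
  "(\<lambda>(\<sigma>, z). bohr_lift (dirichlet_shift \<sigma> a) z) \<in> borel_measurable (borel \<Otimes>\<^sub>M torus_haar)"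
  unfolding bohr_lift_shift by measurable

lemma hardy_norm_eq: "hardy_norm p a = enn2real (hardy_mass p a) powr (1 / p)"
  unfolding hardy_norm_def hardy_mass_def by (subst integral_eq_nn_integral) auto

lemma borel_measurable_hardy_mass_shift [measurable]:
  "(\<lambda>\<sigma>. hardy_mass p (dirichlet_shift \<sigma> a)) \<in> borel_measurable borel"
proof -
  interpret prob_space torus_haar by (rule prob_space_torus_haar)
  show ?thesis unfolding hardy_mass_def by measurable
qed

lemma borel_measurable_hardy_norm_shift [measurable]:
  "(\<lambda>\<sigma>. hardy_norm p (dirichlet_shift \<sigma> a)) \<in> borel_measurable borel"
  unfolding hardy_norm_eq by measurable

text \<open>A crude bound by absolute values: it makes masses of polynomials finite, so that
  \<open>enn2real\<close> loses nothing, and leads to a bound uniform in nonnegative shifts.\<close>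

lemma hardy_mass_le:
  assumes a: "a \<in> dirichlet_polynomials" and p: "0 < p"
  shows "hardy_mass p a \<le> ennreal ((\<Sum>n\<in>dirichlet_support a. norm (a n)) powr p)"
proof -
  interpret prob_space torus_haar by (rule prob_space_torus_haar)
  have "hardy_mass p a \<le> (\<integral>\<^sup>+z. ennreal ((\<Sum>n\<in>dirichlet_support a. norm (a n)) powr p) \<partial>torus_haar)"
    unfolding hardy_mass_def
  proof (rule nn_integral_mono_AE)
    show "AE z in torus_haar. ennreal (norm (bohr_lift a z) powr p) \<le> ennreal ((\<Sum>n\<in>dirichlet_support a. norm (a n)) powr p)"
      using AE_torus_haar
    proof eventually_elim
      case (elim z)
      have "norm (bohr_lift a z) = norm (\<Sum>n\<in>dirichlet_support a. a n * bohr_monomial n z)"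
        using bohr_lift_multiplier[OF a, of "\<lambda>_. 1"] by simp
      also have "\<dots> \<le> (\<Sum>n\<in>dirichlet_support a. norm (a n))"
        using elim by (intro sum_norm_le) (simp add: norm_mult norm_bohr_monomial)
      finally show ?case using p by (intro ennreal_leI powr_mono2) auto
    qed
  qed
  also have "\<dots> = ennreal ((\<Sum>n\<in>dirichlet_support a. norm (a n)) powr p)"
    using emeasure_space_1 by simp
  finally show ?thesis .
qed

lemma hardy_mass_finite: "a \<in> dirichlet_polynomials \<Longrightarrow> 0 < p \<Longrightarrow> hardy_mass p a < \<top>"
  using hardy_mass_le[of a p] by (auto intro: le_less_trans)

lemma hardy_norm_powr:
  assumes "0 < p"
  shows "hardy_norm p a powr p = enn2real (hardy_mass p a)"
  using assms by (simp add: hardy_norm_eq powr_powr)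

lemma hardy_norm_nonneg: "0 \<le> hardy_norm p a"
  by (simp add: hardy_norm_eq)

lemma hardy_norm_le:
  assumes a: "a \<in> dirichlet_polynomials" and p: "0 < p"
  shows "hardy_norm p a \<le> (\<Sum>n\<in>dirichlet_support a. norm (a n))"
proof -
  have "enn2real (hardy_mass p a) \<le> (\<Sum>n\<in>dirichlet_support a. norm (a n)) powr p"
    using hardy_mass_le[OF a p] by (intro enn2real_leI) auto
  then have "hardy_norm p a \<le> ((\<Sum>n\<in>dirichlet_support a. norm (a n)) powr p) powr (1 / p)"
    unfolding hardy_norm_eq using p by (intro powr_mono2) auto
  then show ?thesis using p by (simp add: powr_powr sum_nonneg)
qed

lemma bohr_lift_add:
  assumes "a \<in> dirichlet_polynomials" "b \<in> dirichlet_polynomials"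
  shows "bohr_lift (\<lambda>n. a n + b n) z = bohr_lift a z + bohr_lift b z"
proof -
  let ?S = "dirichlet_support a \<union> dirichlet_support b"
  have S: "finite ?S" "?S \<subseteq> {1..}"
    using assms by (auto simp: finite_dirichlet_support) (auto simp: dirichlet_support_def)
  have "bohr_lift a z = (\<Sum>n\<in>?S. a n * bohr_monomial n z)" "bohr_lift b z = (\<Sum>n\<in>?S. b n * bohr_monomial n z)"
    "bohr_lift (\<lambda>n. a n + b n) z = (\<Sum>n\<in>?S. (a n + b n) * bohr_monomial n z)"
    using S by (intro bohr_lift_sum; force simp: dirichlet_support_def)+
  then show ?thesis by (simp add: sum.distrib ring_distribs)
qed

lemma add_dirichlet_polynomials:
  assumes "a \<in> dirichlet_polynomials" "b \<in> dirichlet_polynomials"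
  shows "(\<lambda>n. a n + b n) \<in> dirichlet_polynomials"
proof -
  have "{n. 1 \<le> n \<and> a n + b n \<noteq> 0} \<subseteq> {n. 1 \<le> n \<and> a n \<noteq> 0} \<union> {n. 1 \<le> n \<and> b n \<noteq> 0}" by auto
  then show ?thesis using assms unfolding dirichlet_polynomials_def by (auto intro: finite_subset)
qed

lemma diff_dirichlet_polynomials:
  assumes "a \<in> dirichlet_polynomials" "b \<in> dirichlet_polynomials"
  shows "(\<lambda>n. a n - b n) \<in> dirichlet_polynomials"
proof -
  have "{n. 1 \<le> n \<and> a n - b n \<noteq> 0} \<subseteq> {n. 1 \<le> n \<and> a n \<noteq> 0} \<union> {n. 1 \<le> n \<and> b n \<noteq> 0}" by auto
  then show ?thesis using assms unfolding dirichlet_polynomials_def by (auto intro: finite_subset)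
qed

text \<open>The factor 2^p for p-th powers becomes 2 after taking the root; separating the two
  masses under the root costs another 2^(1/p). No distinction between p below and above 1 is
  made.\<close>

lemma hardy_norm_add_le:
  assumes ab: "a \<in> dirichlet_polynomials" "b \<in> dirichlet_polynomials" and p: "0 < p"
  shows "hardy_norm p (\<lambda>n. a n + b n) \<le> 2 * 2 powr (1 / p) * (hardy_norm p a + hardy_norm p b)"
proof -
  let ?A = "enn2real (hardy_mass p a)" and ?B = "enn2real (hardy_mass p b)"
  have fin: "hardy_mass p a < \<top>" "hardy_mass p b < \<top>" using ab p by (auto intro: hardy_mass_finite)
  have "hardy_mass p (\<lambda>n. a n + b n)
      \<le> (\<integral>\<^sup>+z. ennreal (2 powr p) * (ennreal (norm (bohr_lift a z) powr p) + ennreal (norm (bohr_lift b z) powr p)) \<partial>torus_haar)"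
    unfolding hardy_mass_def
  proof (intro nn_integral_mono)
    fix z
    have "ennreal (norm (bohr_lift (\<lambda>n. a n + b n) z) powr p)
        \<le> ennreal (2 powr p * (norm (bohr_lift a z) powr p + norm (bohr_lift b z) powr p))"
      unfolding bohr_lift_add[OF ab] by (intro ennreal_leI norm_add_powr_le p)
    then show "ennreal (norm (bohr_lift (\<lambda>n. a n + b n) z) powr p)
        \<le> ennreal (2 powr p) * (ennreal (norm (bohr_lift a z) powr p) + ennreal (norm (bohr_lift b z) powr p))"
      by (simp add: ennreal_mult)
  qed
  also have "\<dots> = ennreal (2 powr p) * (hardy_mass p a + hardy_mass p b)"
    unfolding hardy_mass_def by (simp add: nn_integral_cmult nn_integral_add)
  also have "\<dots> = ennreal (2 powr p * (?A + ?B))"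
    using fin by (simp add: ennreal_mult)
  finally have "enn2real (hardy_mass p (\<lambda>n. a n + b n)) \<le> 2 powr p * (?A + ?B)"
    by (intro enn2real_leI) auto
  then have "hardy_norm p (\<lambda>n. a n + b n) \<le> (2 powr p * (?A + ?B)) powr (1 / p)"
    unfolding hardy_norm_eq using p by (intro powr_mono2) auto
  also have "\<dots> = 2 * (?A + ?B) powr (1 / p)"
    using p by (simp add: powr_mult powr_powr)
  also have "\<dots> \<le> 2 * (2 powr (1 / p) * (?A powr (1 / p) + ?B powr (1 / p)))"
    using p by (intro mult_left_mono add_powr_le) auto
  finally show ?thesis by (simp add: hardy_norm_eq mult.assoc)
qed

lemma hardy_norm_2_powr:
  assumes S: "finite S" "S \<subseteq> {1..}" "\<And>n. 1 \<le> n \<Longrightarrow> n \<notin> S \<Longrightarrow> a n = 0"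
  shows "hardy_norm 2 a powr q = (\<Sum>n\<in>S. (norm (a n))\<^sup>2) powr (q / 2)"
proof -
  have "hardy_norm 2 a = (\<integral>z. (norm (bohr_lift a z))\<^sup>2 \<partial>torus_haar) powr (1 / 2)"
    unfolding hardy_norm_def by simp
  also have "(\<integral>z. (norm (bohr_lift a z))\<^sup>2 \<partial>torus_haar) = (\<Sum>n\<in>S. (norm (a n))\<^sup>2)"
    using S by (intro integral_norm_bohr_lift_square) auto
  finally show ?thesis by (simp add: powr_powr)
qed

lemma summable_dirichlet_shift_mono:
  assumes "summable (\<lambda>n. sq_shift \<tau> a n)" "\<tau> \<le> \<sigma>"
  shows "summable (\<lambda>n. sq_shift \<sigma> a n)"
proof (rule summable_comparison_test'[OF assms(1), of 0])
  fix n
  have "real n powr - \<sigma> \<le> real n powr - \<tau>" if "n \<noteq> 0" using assms(2) that by (intro powr_mono) auto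
  then have "norm (dirichlet_shift \<sigma> a n) \<le> norm (dirichlet_shift \<tau> a n)"
    by (cases "n = 0") (auto simp: dirichlet_shift_def norm_mult intro!: mult_left_mono)
  then show "norm (sq_shift \<sigma> a n) \<le> sq_shift \<tau> a n"
    by (simp add: power_mono)
qed

text \<open>With Re s = 1/2 + 2 \<sigma>, half of the excess over 1/2 goes to the square-summable
  coefficients and half makes n^-(1/2 + \<sigma>) square summable; u v <= u^2 + v^2 then gives
  absolute convergence.\<close>

lemma dirichlet_converges_of_square_summable:
  assumes sq: "\<And>\<sigma>. 0 < \<sigma> \<Longrightarrow> summable (\<lambda>n. sq_shift \<sigma> a n)" and s: "1 / 2 < Re s"
  shows "dirichlet_converges a s"
  unfolding dirichlet_converges_def
proof (rule summable_norm_cancel, rule summable_comparison_test_ev)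
  define \<sigma> where "\<sigma> = (Re s - 1 / 2) / 2"
  have \<sigma>: "0 < \<sigma>" "Re s = 1 / 2 + 2 * \<sigma>" using s by (auto simp: \<sigma>_def field_simps)
  show "summable (\<lambda>n. sq_shift \<sigma> a n + real n powr (- (1 + 2 * \<sigma>)))"
    using \<sigma> by (intro summable_add sq) (auto simp: summable_real_powr_iff)
  show "\<forall>\<^sub>F n in sequentially. norm (norm (a n * of_nat n powr (- s)))
      \<le> sq_shift \<sigma> a n + real n powr (- (1 + 2 * \<sigma>))"
    using eventually_gt_at_top[of 0]
  proof eventually_elim
    case (elim n)
    define u where "u = norm (dirichlet_shift \<sigma> a n)"
    define v where "v = real n powr (- (1 / 2 + \<sigma>))"
    have "norm (a n * of_nat n powr (- s)) = norm (a n) * real n powr (- Re s)"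
      using norm_powr_real_powr[of "of_nat n" "- s"] by (simp add: norm_mult)
    also have "real n powr (- Re s) = real n powr (- \<sigma>) * v"
      unfolding v_def \<sigma>(2) by (simp add: powr_add[symmetric] algebra_simps)
    finally have "norm (a n * of_nat n powr (- s)) = u * v"
      by (simp add: u_def dirichlet_shift_def norm_mult)
    also have "\<dots> \<le> u\<^sup>2 + v\<^sup>2"
    proof -
      have "0 \<le> u * v" by (simp add: u_def v_def)
      then show ?thesis using sum_squares_bound[of u v] by linarith
    qed
    also have "v\<^sup>2 = real n powr (- (1 + 2 * \<sigma>))"
      unfolding v_def power2_eq_square by (simp add: powr_add[symmetric])
    finally show ?case by (simp add: u_def)
  qed
qed

section \<open>The common form of Hardy and mixed norms, and its energy criterion for inner exponent
  2\<close>

definition weighted_norm :: "real \<Rightarrow> real \<Rightarrow> real measure \<Rightarrow> (nat \<Rightarrow> complex) \<Rightarrow> real" where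
  "weighted_norm p q \<kappa> P = (LINT \<sigma>|\<kappa>. hardy_norm p (dirichlet_shift \<sigma> P) powr q) powr (1 / q)"

definition weighted_mass :: "real \<Rightarrow> real \<Rightarrow> real measure \<Rightarrow> (nat \<Rightarrow> complex) \<Rightarrow> ennreal" where
  "weighted_mass p q \<kappa> P = (\<integral>\<^sup>+\<sigma>. ennreal (hardy_norm p (dirichlet_shift \<sigma> P) powr q) \<partial>\<kappa>)"

text \<open>
  The point mass at 0 gives the Hardy spaces and \<open>mu_measure\<close> gives the mixed norm spaces. The
  support condition is what makes the series converge to the right of \<open>1 / 2\<close>.
\<close>

locale shift_weight = finite_measure \<kappa> for \<kappa> :: "real measure" +
  assumes sets_\<kappa> [measurable_cong]: "sets \<kappa> = sets borel"
    and AE_nonneg: "AE \<sigma> in \<kappa>. 0 \<le> \<sigma>"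
    and zero_in_support: "\<And>\<epsilon>. 0 < \<epsilon> \<Longrightarrow> emeasure \<kappa> {..<\<epsilon>} \<noteq> 0"
begin

lemma weighted_norm_eq: "weighted_norm p q \<kappa> P = enn2real (weighted_mass p q \<kappa> P) powr (1 / q)"
  unfolding weighted_norm_def weighted_mass_def by (subst integral_eq_nn_integral) auto

lemma weighted_mass_finite:
  assumes P: "P \<in> dirichlet_polynomials" and pq: "0 < p" "0 < q"
  shows "weighted_mass p q \<kappa> P < \<top>"
proof -
  let ?C = "\<Sum>n\<in>dirichlet_support P. norm (P n)"
  have "weighted_mass p q \<kappa> P \<le> (\<integral>\<^sup>+\<sigma>. ennreal (?C powr q) \<partial>\<kappa>)"
    unfolding weighted_mass_def
  proof (rule nn_integral_mono_AE)
    show "AE \<sigma> in \<kappa>. ennreal (hardy_norm p (dirichlet_shift \<sigma> P) powr q) \<le> ennreal (?C powr q)"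
      using AE_nonneg
    proof eventually_elim
      case (elim \<sigma>)
      have "hardy_norm p (dirichlet_shift \<sigma> P) \<le> (\<Sum>n\<in>dirichlet_support (dirichlet_shift \<sigma> P). norm (dirichlet_shift \<sigma> P n))"
        using P pq by (intro hardy_norm_le dirichlet_shift_polynomials)
      also have "dirichlet_support (dirichlet_shift \<sigma> P) = dirichlet_support P"
        by (auto simp: dirichlet_support_def dirichlet_shift_def)
      also have "(\<Sum>n\<in>dirichlet_support P. norm (dirichlet_shift \<sigma> P n)) \<le> ?C"
      proof (rule sum_mono)
        fix n assume "n \<in> dirichlet_support P"
        then have "real n powr - \<sigma> \<le> 1" using elim powr_mono[of "- \<sigma>" 0 "real n"] by (auto simp: dirichlet_support_def)
        then show "norm (dirichlet_shift \<sigma> P n) \<le> norm (P n)"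
          by (simp add: dirichlet_shift_def norm_mult mult_left_le)
      qed
      finally show ?case using pq by (intro ennreal_leI powr_mono2 hardy_norm_nonneg) auto
    qed
  qed
  also have "\<dots> < \<top>" by (simp add: ennreal_mult_less_top emeasure_eq_measure)
  finally show ?thesis .
qed

lemma weighted_mass_add_le:
  assumes ab: "a \<in> dirichlet_polynomials" "b \<in> dirichlet_polynomials" and pq: "0 < p" "0 < q"
  shows "weighted_mass p q \<kappa> (\<lambda>n. a n + b n)
     \<le> ennreal ((2 * 2 powr (1 / p)) powr q * 2 powr q) * (weighted_mass p q \<kappa> a + weighted_mass p q \<kappa> b)"
proof -
  let ?D = "2 * 2 powr (1 / p)"
  let ?h = "\<lambda>a \<sigma>. hardy_norm p (dirichlet_shift \<sigma> a)"
  have "weighted_mass p q \<kappa> (\<lambda>n. a n + b n)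
     \<le> (\<integral>\<^sup>+\<sigma>. ennreal (?D powr q * 2 powr q) * (ennreal (?h a \<sigma> powr q) + ennreal (?h b \<sigma> powr q)) \<partial>\<kappa>)"
    unfolding weighted_mass_def
  proof (intro nn_integral_mono)
    fix \<sigma>
    have "?h (\<lambda>n. a n + b n) \<sigma> \<le> ?D * (?h a \<sigma> + ?h b \<sigma>)"
      unfolding dirichlet_shift_add using ab pq by (intro hardy_norm_add_le dirichlet_shift_polynomials)
    then have "?h (\<lambda>n. a n + b n) \<sigma> powr q \<le> (?D * (?h a \<sigma> + ?h b \<sigma>)) powr q"
      using pq by (intro powr_mono2 hardy_norm_nonneg) auto
    also have "\<dots> = ?D powr q * (?h a \<sigma> + ?h b \<sigma>) powr q"
      by (intro powr_mult)
    also have "\<dots> \<le> ?D powr q * (2 powr q * (?h a \<sigma> powr q + ?h b \<sigma> powr q))"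
      using pq by (intro mult_left_mono add_powr_le hardy_norm_nonneg) auto
    finally have "ennreal (?h (\<lambda>n. a n + b n) \<sigma> powr q)
        \<le> ennreal (?D powr q * 2 powr q * (?h a \<sigma> powr q + ?h b \<sigma> powr q))"
      by (intro ennreal_leI) (simp add: mult.assoc)
    then show "ennreal (?h (\<lambda>n. a n + b n) \<sigma> powr q)
        \<le> ennreal (?D powr q * 2 powr q) * (ennreal (?h a \<sigma> powr q) + ennreal (?h b \<sigma> powr q))"
      by (simp add: ennreal_mult)
  qed
  also have "\<dots> = ennreal (?D powr q * 2 powr q) * (weighted_mass p q \<kappa> a + weighted_mass p q \<kappa> b)"
    unfolding weighted_mass_def by (simp add: nn_integral_cmult nn_integral_add)
  finally show ?thesis .
qed

text \<open>All late terms are compared with the single polynomial \<open>P K\<close>, whose mass is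
  finite, through the quasi-triangle inequality.\<close>

lemma bounded_weighted_mass_of_Cauchy:
  fixes P :: "nat \<Rightarrow> nat \<Rightarrow> complex"
  assumes P: "\<And>k. P k \<in> dirichlet_polynomials" and pq: "0 < p" "0 < q"
    and Cauchy: "\<And>\<epsilon>. 0 < \<epsilon> \<Longrightarrow> \<exists>K. \<forall>j\<ge>K. \<forall>k\<ge>K. weighted_norm p q \<kappa> (\<lambda>n. P j n - P k n) < \<epsilon>"
  obtains B K where "\<And>k. K \<le> k \<Longrightarrow> weighted_mass p q \<kappa> (P k) \<le> ennreal B"
proof -
  obtain K where K: "\<And>j k. K \<le> j \<Longrightarrow> K \<le> k \<Longrightarrow> weighted_norm p q \<kappa> (\<lambda>n. P j n - P k n) < 1"
    using Cauchy[of 1] by auto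
  let ?C = "ennreal ((2 * 2 powr (1 / p)) powr q * 2 powr q)"
  let ?B = "?C * (1 + weighted_mass p q \<kappa> (P K))"
  have "weighted_mass p q \<kappa> (P k) \<le> ?B" if k: "K \<le> k" for k
  proof -
    let ?d = "\<lambda>n. P k n - P K n"
    have d: "?d \<in> dirichlet_polynomials" using P by (intro diff_dirichlet_polynomials)
    have "enn2real (weighted_mass p q \<kappa> ?d) \<le> 1"
    proof (rule ccontr)
      assume "\<not> ?thesis"
      then have "1 powr (1 / q) \<le> enn2real (weighted_mass p q \<kappa> ?d) powr (1 / q)"
        using pq by (intro powr_mono2) auto
      then show False using K[of k K] k by (simp add: weighted_norm_eq)
    qed
    then have "weighted_mass p q \<kappa> ?d \<le> 1"
      using weighted_mass_finite[OF d pq] by (simp add: enn2real_le)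
    then have "?C * (weighted_mass p q \<kappa> ?d + weighted_mass p q \<kappa> (P K)) \<le> ?B"
      by (intro mult_left_mono add_right_mono) auto
    then show ?thesis
      using weighted_mass_add_le[OF d P[of K] pq] by simp
  qed
  moreover have "?B < \<top>"
    using weighted_mass_finite[OF P pq] by (simp add: ennreal_mult_less_top)
  ultimately show ?thesis
    by (intro that[of K "enn2real ?B"]) auto
qed

text \<open>Encodes finiteness of the integral of the full square function. Bounding partial sums
  keeps it meaningful where the series diverges and \<open>suminf\<close> would be
  arbitrary.\<close>

definition energy_bounded :: "real \<Rightarrow> (nat \<Rightarrow> complex) \<Rightarrow> bool" where
  "energy_bounded q f \<longleftrightarrow> (\<exists>B. \<forall>N. (\<integral>\<^sup>+\<sigma>. square_fun q f {..<N} \<sigma> \<partial>\<kappa>) \<le> ennreal B)"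

lemma borel_measurable_dirichlet_shift [measurable]: "(\<lambda>\<sigma>. dirichlet_shift \<sigma> f n) \<in> borel_measurable borel"
  unfolding dirichlet_shift_def by measurable

lemma dirichlet_shift_0: "dirichlet_shift \<sigma> f 0 = 0"
  by (simp add: dirichlet_shift_def)

text \<open>For fixed \<open>N\<close> only finitely many coefficients of the approximants matter;
  their partial energy is at most their mass by Parseval, and Fatou's lemma passes to the
  limit.\<close>

lemma energy_bounded_of_completion:
  assumes f: "f \<in> dirichlet_completion (weighted_norm 2 q \<kappa>)" and q: "0 < q"
  shows "energy_bounded q f"
proof -
  obtain P where P: "\<And>k. P k \<in> dirichlet_polynomials"
    and Cauchy: "\<And>\<epsilon>. 0 < \<epsilon> \<Longrightarrow> \<exists>K. \<forall>j\<ge>K. \<forall>k\<ge>K. weighted_norm 2 q \<kappa> (\<lambda>n. P j n - P k n) < \<epsilon>"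
    and lim: "\<And>n. 1 \<le> n \<Longrightarrow> (\<lambda>k. P k n) \<longlonglongrightarrow> f n"
    using f unfolding dirichlet_completion_def by blast
  obtain B K where B: "\<And>k. K \<le> k \<Longrightarrow> weighted_mass 2 q \<kappa> (P k) \<le> ennreal B"
    using bounded_weighted_mass_of_Cauchy[OF P _ q Cauchy] by (metis zero_less_numeral)
  let ?e = "\<lambda>f N \<sigma>. square_fun q f {..<N} \<sigma>"
  have le: "(\<integral>\<^sup>+\<sigma>. ?e (P k) N \<sigma> \<partial>\<kappa>) \<le> weighted_mass 2 q \<kappa> (P k)" for k N
    unfolding weighted_mass_def
  proof (intro nn_integral_mono ennreal_leI)
    fix \<sigma>
    let ?S = "dirichlet_support (P k)"
    have S: "finite ?S" using P by (rule finite_dirichlet_support)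
    have "(\<Sum>n<N. sq_shift \<sigma> (P k) n) = (\<Sum>n\<in>{..<N} \<inter> ?S. sq_shift \<sigma> (P k) n)"
      by (intro sum.mono_neutral_right)
         (auto simp: dirichlet_support_def dirichlet_shift_def Suc_le_eq)
    also have "\<dots> \<le> (\<Sum>n\<in>?S. sq_shift \<sigma> (P k) n)"
      using S by (intro sum_mono2) auto
    finally have "(\<Sum>n<N. sq_shift \<sigma> (P k) n) powr (q / 2)
        \<le> (\<Sum>n\<in>?S. sq_shift \<sigma> (P k) n) powr (q / 2)"
      using q by (intro powr_mono2) (auto intro: sum_nonneg)
    also have "\<dots> = hardy_norm 2 (dirichlet_shift \<sigma> (P k)) powr q"
      using S by (intro hardy_norm_2_powr[symmetric]) (auto simp: dirichlet_support_def dirichlet_shift_def)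
    finally show "(\<Sum>n<N. sq_shift \<sigma> (P k) n) powr (q / 2) \<le> \<dots>" .
  qed
  have "(\<integral>\<^sup>+\<sigma>. ?e f N \<sigma> \<partial>\<kappa>) \<le> ennreal B" for N
  proof (rule nn_integral_le_of_tendsto)
    show "AE \<sigma> in \<kappa>. (\<lambda>k. ?e (P k) N \<sigma>) \<longlonglongrightarrow> ?e f N \<sigma>"
    proof (intro AE_I2)
      fix \<sigma>
      have "(\<lambda>k. dirichlet_shift \<sigma> (P k) n) \<longlonglongrightarrow> dirichlet_shift \<sigma> f n" for n
        using lim[of n] by (cases "n = 0") (auto simp: dirichlet_shift_0, auto simp: dirichlet_shift_def intro!: tendsto_intros)
      then have "(\<lambda>k. (\<Sum>n<N. sq_shift \<sigma> (P k) n)) \<longlonglongrightarrow> (\<Sum>n<N. sq_shift \<sigma> f n)"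
        by (intro tendsto_sum tendsto_power tendsto_norm)
      then show "(\<lambda>k. ?e (P k) N \<sigma>) \<longlonglongrightarrow> ?e f N \<sigma>"
        using q by (intro tendsto_ennrealI tendsto_powr') (auto intro!: always_eventually sum_nonneg)
    qed
    show "\<forall>\<^sub>F k in sequentially. (\<integral>\<^sup>+\<sigma>. ?e (P k) N \<sigma> \<partial>\<kappa>) \<le> ennreal B"
      using eventually_ge_at_top[of K] by eventually_elim (use le B order_trans in blast)
  qed measurable
  then show ?thesis unfolding energy_bounded_def by blast
qed

text \<open>Monotone convergence makes the supremum of the partial sums integrable after taking
  powers, hence finite almost everywhere.\<close>

lemma AE_summable_of_energy_bounded:
  assumes f: "energy_bounded q f" and q: "0 < q"
  shows "AE \<sigma> in \<kappa>. summable (\<lambda>n. sq_shift \<sigma> f n)"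
proof -
  let ?s = "\<lambda>N \<sigma>. \<Sum>n<N. sq_shift \<sigma> f n"
  obtain B where B: "\<And>N. (\<integral>\<^sup>+\<sigma>. ennreal (?s N \<sigma> powr (q / 2)) \<partial>\<kappa>) \<le> ennreal B"
    using f unfolding energy_bounded_def by blast
  have "(\<integral>\<^sup>+\<sigma>. (SUP N. ennreal (?s N \<sigma> powr (q / 2))) \<partial>\<kappa>) = (SUP N. \<integral>\<^sup>+\<sigma>. ennreal (?s N \<sigma> powr (q / 2)) \<partial>\<kappa>)"
    using q by (intro nn_integral_monotone_convergence_SUP)
      (auto intro!: incseq_SucI le_funI ennreal_leI powr_mono2 sum_nonneg)
  also have "\<dots> \<le> ennreal B" by (intro SUP_least B)
  finally have "AE \<sigma> in \<kappa>. (SUP N. ennreal (?s N \<sigma> powr (q / 2))) \<noteq> \<infinity>"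
    by (intro nn_integral_PInf_AE) (auto simp: top_unique)
  then show ?thesis
  proof eventually_elim
    case (elim \<sigma>)
    let ?M = "enn2real (SUP N. ennreal (?s N \<sigma> powr (q / 2)))"
    have "?s N \<sigma> \<le> ?M powr (2 / q)" for N
    proof -
      have "ennreal (?s N \<sigma> powr (q / 2)) \<le> (SUP N. ennreal (?s N \<sigma> powr (q / 2)))"
        by (rule SUP_upper) simp
      also have "\<dots> = ennreal ?M" using elim by (simp only: ennreal_enn2real_if infinity_ennreal_def if_False)
      finally have "?s N \<sigma> powr (q / 2) \<le> ?M" by simp
      then have "(?s N \<sigma> powr (q / 2)) powr (2 / q) \<le> ?M powr (2 / q)"
        using q by (intro powr_mono2) auto
      then show ?thesis using q by (simp add: powr_powr sum_nonneg)
    qed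
    then show ?case by (intro summableI_nonneg_bounded) auto
  qed
qed

text \<open>Summability holds almost everywhere, and every {..<\<sigma>} has positive mass, so it
  holds at some smaller \<tau>; the terms with n >= 1 decrease in the shift.\<close>

lemma summable_of_energy_bounded:
  assumes f: "energy_bounded q f" and q: "0 < q" and \<sigma>: "0 < \<sigma>"
  shows "summable (\<lambda>n. sq_shift \<sigma> f n)"
proof -
  have "\<exists>\<tau><\<sigma>. summable (\<lambda>n. sq_shift \<tau> f n)"
  proof (rule ccontr)
    assume none: "\<not> ?thesis"
    have "AE \<tau> in \<kappa>. \<tau> \<notin> {..<\<sigma>}"
      using AE_summable_of_energy_bounded[OF f q] by eventually_elim (use none in auto)
    then have "{..<\<sigma>} \<in> null_sets \<kappa>"
      by (subst AE_iff_null_sets) (auto simp: sets_\<kappa>)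
    then show False using zero_in_support[OF \<sigma>] by auto
  qed
  then obtain \<tau> where \<tau>: "\<tau> < \<sigma>" "summable (\<lambda>n. sq_shift \<tau> f n)" by blast
  show ?thesis by (rule summable_dirichlet_shift_mono[OF \<tau>(2)]) (use \<tau> in simp)
qed

text \<open>Dominated convergence for the tails of the square function, with the full function as
  majorant. Arbitrary finite sets beyond \<open>K\<close> are allowed because supports of
  differences need not be intervals.\<close>

lemma energy_tail_small:
  assumes f: "energy_bounded q f" and q: "0 < q" and \<epsilon>: "0 < \<epsilon>"
  obtains K where "\<And>S. finite S \<Longrightarrow> S \<subseteq> {K..} \<Longrightarrow>
    (\<integral>\<^sup>+\<sigma>. square_fun q f S \<sigma> \<partial>\<kappa>) \<le> ennreal \<epsilon>"
proof -
  let ?x = "\<lambda>\<sigma> n. sq_shift \<sigma> f n"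
  let ?T = "\<lambda>K \<sigma>. ennreal ((\<Sum>n. ?x \<sigma> (n + K)) powr (q / 2))"
  note AE = AE_summable_of_energy_bounded[OF f q]
  obtain B where B: "\<And>N. (\<integral>\<^sup>+\<sigma>. ennreal ((\<Sum>n<N. ?x \<sigma> n) powr (q / 2)) \<partial>\<kappa>) \<le> ennreal B"
    using f unfolding energy_bounded_def by blast
  have [measurable]: "?T K \<in> borel_measurable \<kappa>" for K by measurable
  have T0: "(\<integral>\<^sup>+\<sigma>. ?T 0 \<sigma> \<partial>\<kappa>) \<le> ennreal B"
  proof (rule nn_integral_le_of_tendsto)
    show "AE \<sigma> in \<kappa>. (\<lambda>N. ennreal ((\<Sum>n<N. ?x \<sigma> n) powr (q / 2))) \<longlonglongrightarrow> ?T 0 \<sigma>"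
      using AE
    proof eventually_elim
      case (elim \<sigma>)
      then show ?case using q summable_LIMSEQ[OF elim]
        by (intro tendsto_ennrealI tendsto_powr') (auto intro!: always_eventually sum_nonneg)
    qed
  qed (use B in auto)
  have "(\<lambda>K. \<integral>\<^sup>+\<sigma>. ?T K \<sigma> \<partial>\<kappa>) \<longlonglongrightarrow> (\<integral>\<^sup>+\<sigma>. 0 \<partial>\<kappa>)"
  proof (rule nn_integral_dominated_convergence[where w = "?T 0"])
    show "(\<integral>\<^sup>+\<sigma>. ?T 0 \<sigma> \<partial>\<kappa>) < \<infinity>" using T0 by (auto intro: le_less_trans)
    fix K
    show "AE \<sigma> in \<kappa>. ?T K \<sigma> \<le> ?T 0 \<sigma>"
      using AE
    proof eventually_elim
      case (elim \<sigma>)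
      have "(\<Sum>n. ?x \<sigma> (n + K)) \<le> (\<Sum>n. ?x \<sigma> n)"
        using suminf_split_initial_segment[OF elim, of K] by (simp add: sum_nonneg)
      then show ?case using q elim
        by (auto intro!: ennreal_leI powr_mono2 suminf_nonneg summable_ignore_initial_segment[OF elim])
    qed
  next
    show "AE \<sigma> in \<kappa>. (\<lambda>K. ?T K \<sigma>) \<longlonglongrightarrow> 0"
      using AE
    proof eventually_elim
      case (elim \<sigma>)
      have "(\<lambda>K. (\<Sum>n. ?x \<sigma> (n + K))) \<longlonglongrightarrow> 0" by (rule suminf_exist_split2[OF elim])
      then have "(\<lambda>K. ?T K \<sigma>) \<longlonglongrightarrow> ennreal (0 powr (q / 2))"
        using q by (intro tendsto_ennrealI tendsto_powr')
          (auto intro!: always_eventually suminf_nonneg summable_ignore_initial_segment[OF elim])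
      then show ?case by simp
    qed
  qed auto
  then have "\<forall>\<^sub>F K in sequentially. (\<integral>\<^sup>+\<sigma>. ?T K \<sigma> \<partial>\<kappa>) < ennreal \<epsilon>"
    using \<epsilon> by (intro order_tendstoD(2)) auto
  then obtain K where K: "(\<integral>\<^sup>+\<sigma>. ?T K \<sigma> \<partial>\<kappa>) < ennreal \<epsilon>"
    by (auto simp: eventually_sequentially)
  show ?thesis
  proof (rule that)
    fix S assume S: "finite S" "S \<subseteq> {K..}"
    have "(\<integral>\<^sup>+\<sigma>. ennreal ((\<Sum>n\<in>S. ?x \<sigma> n) powr (q / 2)) \<partial>\<kappa>) \<le> (\<integral>\<^sup>+\<sigma>. ?T K \<sigma> \<partial>\<kappa>)"
    proof (rule nn_integral_mono_AE)
      show "AE \<sigma> in \<kappa>. ennreal ((\<Sum>n\<in>S. ?x \<sigma> n) powr (q / 2)) \<le> ?T K \<sigma>"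
        using AE
      proof eventually_elim
        case (elim \<sigma>)
        have "(\<Sum>n\<in>S. ?x \<sigma> n) = (\<Sum>n\<in>(\<lambda>n. n - K) ` S. ?x \<sigma> (n + K))"
          using S by (subst sum.reindex) (auto intro!: inj_onI sum.cong simp: subset_iff dest: eq_diff_iff)
        also have "\<dots> \<le> (\<Sum>n. ?x \<sigma> (n + K))"
          using S by (intro sum_le_suminf summable_ignore_initial_segment[OF elim]) auto
        finally show ?case using q by (intro ennreal_leI powr_mono2) (auto intro: sum_nonneg)
      qed
    qed
    also have "\<dots> \<le> ennreal \<epsilon>" using K by simp
    finally show "(\<integral>\<^sup>+\<sigma>. ennreal ((\<Sum>n\<in>S. ?x \<sigma> n) powr (q / 2)) \<partial>\<kappa>) \<le> ennreal \<epsilon>" .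
  qed
qed

lemma weighted_norm_less:
  assumes "weighted_mass p q \<kappa> P \<le> ennreal ((\<epsilon> / 2) powr q)" "0 < q" "0 < \<epsilon>"
  shows "weighted_norm p q \<kappa> P < \<epsilon>"
proof -
  have "enn2real (weighted_mass p q \<kappa> P) \<le> (\<epsilon> / 2) powr q"
    using assms by (intro enn2real_leI) auto
  then have "weighted_norm p q \<kappa> P \<le> ((\<epsilon> / 2) powr q) powr (1 / q)"
    unfolding weighted_norm_eq using assms by (intro powr_mono2) auto
  also have "\<dots> = \<epsilon> / 2" using assms by (simp add: powr_powr)
  finally show ?thesis using assms by simp
qed

definition partial_sum :: "nat \<Rightarrow> (nat \<Rightarrow> complex) \<Rightarrow> nat \<Rightarrow> complex" where
  "partial_sum N f n = (if n < N then f n else 0)"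

lemma partial_sum_polynomials: "partial_sum N f \<in> dirichlet_polynomials"
  unfolding dirichlet_polynomials_def partial_sum_def
  by (auto intro: finite_subset[of _ "{..<N}"])

lemma partial_sum_tendsto: "(\<lambda>k. partial_sum k f n) \<longlonglongrightarrow> f n"
  by (rule tendsto_eventually, rule eventually_mono[OF eventually_gt_at_top[of n]])
     (simp add: partial_sum_def)

text \<open>For inner exponent 2 truncation is harmless by Parseval, so plain partial sums form the
  Cauchy sequence.\<close>

lemma completion_of_energy_bounded:
  assumes f: "energy_bounded q f" and q: "0 < q"
  shows "f \<in> dirichlet_completion (weighted_norm 2 q \<kappa>)"
  unfolding dirichlet_completion_def
proof (intro CollectI conjI allI impI exI[of _ "\<lambda>k. partial_sum k f"])
  fix s :: complex assume "1 / 2 < Re s"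
  then show "dirichlet_converges f s"
    using summable_of_energy_bounded[OF f q] by (intro dirichlet_converges_of_square_summable)
next
  fix \<epsilon> :: real assume \<epsilon>: "0 < \<epsilon>"
  obtain K where K: "\<And>S. finite S \<Longrightarrow> S \<subseteq> {K..} \<Longrightarrow>
    (\<integral>\<^sup>+\<sigma>. square_fun q f S \<sigma> \<partial>\<kappa>) \<le> ennreal ((\<epsilon> / 2) powr q)"
    using energy_tail_small[OF f q, of "(\<epsilon> / 2) powr q"] \<epsilon> by auto
  show "\<exists>K. \<forall>j\<ge>K. \<forall>k\<ge>K. weighted_norm 2 q \<kappa> (\<lambda>n. partial_sum j f n - partial_sum k f n) < \<epsilon>"
  \<comment> \<open>Starting at \<open>Suc K\<close> keeps the index 0 out of \<open>?S\<close>, as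
    \<open>hardy_norm_2_powr\<close> requires.\<close>
  proof (intro exI[of _ "Suc K"] allI impI)
    fix j k assume jk: "Suc K \<le> j" "Suc K \<le> k"
    let ?d = "\<lambda>n. partial_sum j f n - partial_sum k f n"
    let ?S = "{Suc K..<max j k}"
    have "weighted_mass 2 q \<kappa> ?d \<le> (\<integral>\<^sup>+\<sigma>. square_fun q f ?S \<sigma> \<partial>\<kappa>)"
      unfolding weighted_mass_def
    proof (intro nn_integral_mono ennreal_leI)
      fix \<sigma>
      have "hardy_norm 2 (dirichlet_shift \<sigma> ?d) powr q = (\<Sum>n\<in>?S. sq_shift \<sigma> ?d n) powr (q / 2)"
        using jk by (intro hardy_norm_2_powr) (auto simp: dirichlet_shift_def partial_sum_def)
      also have "\<dots> \<le> (\<Sum>n\<in>?S. sq_shift \<sigma> f n) powr (q / 2)"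
        using q by (intro powr_mono2 sum_mono power_mono)
          (auto simp: dirichlet_shift_def partial_sum_def norm_mult intro: sum_nonneg)
      finally show "hardy_norm 2 (dirichlet_shift \<sigma> ?d) powr q \<le> \<dots>" .
    qed
    also have "\<dots> \<le> ennreal ((\<epsilon> / 2) powr q)" by (rule K) auto
    finally show "weighted_norm 2 q \<kappa> ?d < \<epsilon>" using q \<epsilon> by (rule weighted_norm_less)
  qed
qed (auto intro: partial_sum_polynomials partial_sum_tendsto)

lemma completion_iff_energy_bounded:
  "0 < q \<Longrightarrow> f \<in> dirichlet_completion (weighted_norm 2 q \<kappa>) \<longleftrightarrow> energy_bounded q f"
  using energy_bounded_of_completion completion_of_energy_bounded by blast

end

section \<open>Randomized series\<close>

lemma bohr_lift_sum_polynomials: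
  assumes "finite I" "\<And>m. m \<in> I \<Longrightarrow> a m \<in> dirichlet_polynomials"
  shows "(\<lambda>n. \<Sum>m\<in>I. a m n) \<in> dirichlet_polynomials"
    and "bohr_lift (\<lambda>n. \<Sum>m\<in>I. a m n) z = (\<Sum>m\<in>I. bohr_lift (a m) z)"
proof -
  have "(\<lambda>n. \<Sum>m\<in>I. a m n) \<in> dirichlet_polynomials \<and> bohr_lift (\<lambda>n. \<Sum>m\<in>I. a m n) z = (\<Sum>m\<in>I. bohr_lift (a m) z)"
    using assms
  proof (induction I rule: finite_induct)
    case empty
    then show ?case by (simp add: dirichlet_polynomials_def bohr_lift_def)
  next
    case (insert x I)
    then show ?case
      using add_dirichlet_polynomials[of "a x" "\<lambda>n. \<Sum>m\<in>I. a m n"] bohr_lift_add[of "a x" "\<lambda>n. \<Sum>m\<in>I. a m n" z]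
      by simp
  qed
  then show "(\<lambda>n. \<Sum>m\<in>I. a m n) \<in> dirichlet_polynomials"
    "bohr_lift (\<lambda>n. \<Sum>m\<in>I. a m n) z = (\<Sum>m\<in>I. bohr_lift (a m) z)" by auto
qed

lemma dirichlet_shift_sum: "dirichlet_shift \<sigma> (\<lambda>n. \<Sum>m\<in>I. a m n) = (\<lambda>n. \<Sum>m\<in>I. dirichlet_shift \<sigma> (a m) n)"
  by (simp add: dirichlet_shift_def fun_eq_iff sum_distrib_right)

lemma dirichlet_shift_multiplier: "dirichlet_shift \<sigma> (\<lambda>n. m n * a n) = (\<lambda>n. m n * dirichlet_shift \<sigma> a n)"
  by (simp add: dirichlet_shift_def fun_eq_iff)

lemma hardy_mass_uminus: "hardy_mass p (\<lambda>n. - a n) = hardy_mass p a"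
  by (simp add: hardy_mass_def bohr_lift_def sum_negf)

context shift_weight
begin

text \<open>For q = p the inner root cancels against the outer power, leaving an iterated integral
  that can be exchanged with the expectation.\<close>

lemma weighted_mass_diag:
  assumes P: "P \<in> dirichlet_polynomials" and p: "0 < p"
  shows "weighted_mass p p \<kappa> P = (\<integral>\<^sup>+\<sigma>. hardy_mass p (dirichlet_shift \<sigma> P) \<partial>\<kappa>)"
  unfolding weighted_mass_def hardy_norm_powr[OF p]
  using hardy_mass_finite[OF dirichlet_shift_polynomials[OF P] p] by simp

lemma weighted_mass_diff_commute:
  "weighted_mass p q \<kappa> (\<lambda>n. a n - b n) = weighted_mass p q \<kappa> (\<lambda>n. b n - a n)"
proof -
  have "dirichlet_shift \<sigma> (\<lambda>n. a n - b n) = (\<lambda>n. - dirichlet_shift \<sigma> (\<lambda>n. b n - a n) n)" for \<sigma>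
    by (simp add: dirichlet_shift_def fun_eq_iff algebra_simps)
  then have "hardy_norm p (dirichlet_shift \<sigma> (\<lambda>n. a n - b n)) = hardy_norm p (dirichlet_shift \<sigma> (\<lambda>n. b n - a n))" for \<sigma>
    by (simp add: hardy_norm_eq hardy_mass_uminus)
  then show ?thesis by (simp add: weighted_mass_def)
qed

text \<open>The weights \<open>2\<^sup>m\<close> replace the triangle inequality, uniformly in \<open>p\<close> and in the number of summands.\<close>

lemma weighted_mass_sum_le:
  assumes I: "finite I" "\<And>m. m \<in> I \<Longrightarrow> a m \<in> dirichlet_polynomials" and p: "0 < p"
  shows "weighted_mass p p \<kappa> (\<lambda>n. \<Sum>m\<in>I. a m n)
     \<le> ennreal (2 powr p) * (\<Sum>m\<in>I. ennreal ((2 powr p) ^ m) * weighted_mass p p \<kappa> (a m))"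
proof -
  let ?F = "\<lambda>m \<sigma> z. bohr_lift (dirichlet_shift \<sigma> (a m)) z"
  have hm: "hardy_mass p (dirichlet_shift \<sigma> (\<lambda>n. \<Sum>m\<in>I. a m n))
     \<le> ennreal (2 powr p) * (\<Sum>m\<in>I. ennreal ((2 powr p) ^ m) * hardy_mass p (dirichlet_shift \<sigma> (a m)))" for \<sigma>
  proof -
    have "hardy_mass p (dirichlet_shift \<sigma> (\<lambda>n. \<Sum>m\<in>I. a m n))
       \<le> (\<integral>\<^sup>+z. ennreal (2 powr p) * (\<Sum>m\<in>I. ennreal ((2 powr p) ^ m) * ennreal (norm (?F m \<sigma> z) powr p)) \<partial>torus_haar)"
      unfolding hardy_mass_def
    proof (intro nn_integral_mono)
      fix z
      have "bohr_lift (dirichlet_shift \<sigma> (\<lambda>n. \<Sum>m\<in>I. a m n)) z = (\<Sum>m\<in>I. ?F m \<sigma> z)"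
        unfolding dirichlet_shift_sum using I by (intro bohr_lift_sum_polynomials dirichlet_shift_polynomials)
      also have "\<dots> = (\<Sum>m\<in>I. of_real (1 / 2) ^ m * (2 ^ m * ?F m \<sigma> z))"
        by (simp add: power_divide)
      finally have "norm (bohr_lift (dirichlet_shift \<sigma> (\<lambda>n. \<Sum>m\<in>I. a m n)) z) powr p
          \<le> (1 / (1 - 1 / 2)) powr p * (\<Sum>m\<in>I. norm (2 ^ m * ?F m \<sigma> z) powr p)"
        using norm_geometric_sum_powr_le[of I "1 / 2" p "\<lambda>m. 2 ^ m * ?F m \<sigma> z"] I p by simp
      also have "\<dots> = 2 powr p * (\<Sum>m\<in>I. (2 powr p) ^ m * norm (?F m \<sigma> z) powr p)"
      proof -
        have "(2 ^ m) powr p = (2 powr p) ^ m" for m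
          by (induction m) (simp_all add: powr_mult)
        then show ?thesis by (simp add: norm_mult norm_power powr_mult)
      qed
      finally have "ennreal (norm (bohr_lift (dirichlet_shift \<sigma> (\<lambda>n. \<Sum>m\<in>I. a m n)) z) powr p)
          \<le> ennreal (2 powr p * (\<Sum>m\<in>I. (2 powr p) ^ m * norm (?F m \<sigma> z) powr p))" by (rule ennreal_leI)
      also have "\<dots> = ennreal (2 powr p) * (\<Sum>m\<in>I. ennreal ((2 powr p) ^ m * norm (?F m \<sigma> z) powr p))"
        by (subst sum_ennreal) (auto simp: ennreal_mult sum_nonneg)
      also have "\<dots> = ennreal (2 powr p) * (\<Sum>m\<in>I. ennreal ((2 powr p) ^ m) * ennreal (norm (?F m \<sigma> z) powr p))"
        by (subst ennreal_mult) auto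
      finally show "ennreal (norm (bohr_lift (dirichlet_shift \<sigma> (\<lambda>n. \<Sum>m\<in>I. a m n)) z) powr p) \<le> \<dots>" .
    qed
    also have "\<dots> = ennreal (2 powr p) * (\<Sum>m\<in>I. ennreal ((2 powr p) ^ m) * hardy_mass p (dirichlet_shift \<sigma> (a m)))"
      unfolding hardy_mass_def by (simp add: nn_integral_cmult nn_integral_sum)
    finally show ?thesis .
  qed
  have "weighted_mass p p \<kappa> (\<lambda>n. \<Sum>m\<in>I. a m n) = (\<integral>\<^sup>+\<sigma>. hardy_mass p (dirichlet_shift \<sigma> (\<lambda>n. \<Sum>m\<in>I. a m n)) \<partial>\<kappa>)"
    using I p by (intro weighted_mass_diag bohr_lift_sum_polynomials)
  also have "\<dots> \<le> (\<integral>\<^sup>+\<sigma>. ennreal (2 powr p) * (\<Sum>m\<in>I. ennreal ((2 powr p) ^ m) * hardy_mass p (dirichlet_shift \<sigma> (a m))) \<partial>\<kappa>)"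
    by (intro nn_integral_mono hm)
  also have "\<dots> = ennreal (2 powr p) * (\<Sum>m\<in>I. ennreal ((2 powr p) ^ m) * weighted_mass p p \<kappa> (a m))"
    using I p by (simp add: nn_integral_cmult nn_integral_sum weighted_mass_diag cong: sum.cong)
  finally show ?thesis .
qed

end

locale randomized = standard_sequence M X L + w: shift_weight \<kappa>
  for M :: "'a measure" and X L and \<kappa> :: "real measure"
begin

text \<open>Nothing is known about \<open>X 0\<close>, not even measurability; index 0 never enters
  a Bohr lift, so it may be replaced by 0.\<close>

definition X' :: "nat \<Rightarrow> 'a \<Rightarrow> complex" where
  "X' n = (if 1 \<le> n then X n else (\<lambda>_. 0))"

lemma borel_measurable_X' [measurable]: "X' n \<in> borel_measurable M"
  using measurable_X by (simp add: X'_def)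

text \<open>The sum runs over the support of \<open>g\<close>, not over that of the random
  coefficients, which varies with \<omega>. This gives joint measurability in \<omega>, \<sigma> and
  z.\<close>

definition random_lift :: "(nat \<Rightarrow> complex) \<Rightarrow> 'a \<Rightarrow> real \<Rightarrow> (nat \<Rightarrow> complex) \<Rightarrow> complex" where
  "random_lift g \<omega> \<sigma> z = (\<Sum>n\<in>dirichlet_support g. dirichlet_shift \<sigma> g n * bohr_monomial n z * X' n \<omega>)"

lemma borel_measurable_random_lift [measurable (raw)]:
  assumes [measurable]: "t \<in> measurable N M" "s \<in> borel_measurable N" "Z \<in> measurable N torus_haar"
  shows "(\<lambda>x. random_lift g (t x) (s x) (Z x)) \<in> borel_measurable N"
  unfolding random_lift_def dirichlet_shift_def by measurable

lemma randomization_polynomials: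
  "g \<in> dirichlet_polynomials \<Longrightarrow> randomization X g \<omega> \<in> dirichlet_polynomials"
  using multiplier_dirichlet_polynomials[of g "\<lambda>n. X n \<omega>"] by (simp add: randomization_def mult.commute)

lemma bohr_lift_randomization:
  assumes "g \<in> dirichlet_polynomials"
  shows "bohr_lift (dirichlet_shift \<sigma> (randomization X g \<omega>)) z = random_lift g \<omega> \<sigma> z"
proof -
  have "bohr_lift (dirichlet_shift \<sigma> (randomization X g \<omega>)) z
     = (\<Sum>n\<in>dirichlet_support g. dirichlet_shift \<sigma> (randomization X g \<omega>) n * bohr_monomial n z)"
    using finite_dirichlet_support[OF assms]
    by (intro bohr_lift_sum) (auto simp: dirichlet_support_def dirichlet_shift_def randomization_def)
  also have "\<dots> = random_lift g \<omega> \<sigma> z"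
    unfolding random_lift_def
    by (intro sum.cong refl) (auto simp: dirichlet_support_def dirichlet_shift_def randomization_def X'_def)
  finally show ?thesis .
qed

lemma weighted_mass_randomization:
  assumes "g \<in> dirichlet_polynomials" "0 < p"
  shows "weighted_mass p p \<kappa> (randomization X g \<omega>)
     = (\<integral>\<^sup>+\<sigma>. (\<integral>\<^sup>+z. ennreal (norm (random_lift g \<omega> \<sigma> z) powr p) \<partial>torus_haar) \<partial>\<kappa>)"
  using assms by (simp add: w.weighted_mass_diag randomization_polynomials hardy_mass_def bohr_lift_randomization)

lemma borel_measurable_weighted_mass_randomization:
  assumes "g \<in> dirichlet_polynomials" "0 < p"
  shows "(\<lambda>\<omega>. weighted_mass p p \<kappa> (randomization X g \<omega>)) \<in> borel_measurable M"
proof -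
  interpret T: prob_space torus_haar by (rule prob_space_torus_haar)
  show ?thesis unfolding weighted_mass_randomization[OF assms] by measurable
qed

text \<open>Tonelli's theorem moves the expectation innermost, where Khinchin's inequalities act at
  fixed \<sigma> and z. The weight \<open>h\<close> is 1 for the upper bound and an indicator for
  the lower one.\<close>

lemma nn_integral_weighted_mass_randomization:
  assumes g: "g \<in> dirichlet_polynomials" and p: "0 < p" and [measurable]: "h \<in> borel_measurable M"
  shows "(\<integral>\<^sup>+\<omega>. weighted_mass p p \<kappa> (randomization X g \<omega>) * h \<omega> \<partial>M)
     = (\<integral>\<^sup>+\<sigma>. (\<integral>\<^sup>+z. (\<integral>\<^sup>+\<omega>. ennreal (norm (random_lift g \<omega> \<sigma> z) powr p) * h \<omega> \<partial>M) \<partial>torus_haar) \<partial>\<kappa>)"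
proof -
  interpret T: prob_space torus_haar by (rule prob_space_torus_haar)
  interpret MT: pair_sigma_finite M torus_haar ..
  interpret MK: pair_sigma_finite M \<kappa> ..
  have "(\<integral>\<^sup>+\<omega>. weighted_mass p p \<kappa> (randomization X g \<omega>) * h \<omega> \<partial>M)
      = (\<integral>\<^sup>+\<omega>. (\<integral>\<^sup>+\<sigma>. (\<integral>\<^sup>+z. ennreal (norm (random_lift g \<omega> \<sigma> z) powr p) * h \<omega> \<partial>torus_haar) \<partial>\<kappa>) \<partial>M)"
  proof (intro nn_integral_cong)
    fix \<omega> assume [measurable]: "\<omega> \<in> space M"
    have "(\<integral>\<^sup>+z. ennreal (norm (random_lift g \<omega> \<sigma> z) powr p) * h \<omega> \<partial>torus_haar)
        = (\<integral>\<^sup>+z. ennreal (norm (random_lift g \<omega> \<sigma> z) powr p) \<partial>torus_haar) * h \<omega>" for \<sigma>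
      by (rule nn_integral_multc) measurable
    then show "weighted_mass p p \<kappa> (randomization X g \<omega>) * h \<omega>
        = (\<integral>\<^sup>+\<sigma>. (\<integral>\<^sup>+z. ennreal (norm (random_lift g \<omega> \<sigma> z) powr p) * h \<omega> \<partial>torus_haar) \<partial>\<kappa>)"
      unfolding weighted_mass_randomization[OF g p] by (simp add: nn_integral_multc)
  qed
  also have "\<dots> = (\<integral>\<^sup>+\<sigma>. (\<integral>\<^sup>+\<omega>. (\<integral>\<^sup>+z. ennreal (norm (random_lift g \<omega> \<sigma> z) powr p) * h \<omega> \<partial>torus_haar) \<partial>M) \<partial>\<kappa>)"
    by (rule MK.Fubini'[symmetric]) measurable
  also have "\<dots> = (\<integral>\<^sup>+\<sigma>. (\<integral>\<^sup>+z. (\<integral>\<^sup>+\<omega>. ennreal (norm (random_lift g \<omega> \<sigma> z) powr p) * h \<omega> \<partial>M) \<partial>torus_haar) \<partial>\<kappa>)"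
    by (intro nn_integral_cong MT.Fubini'[symmetric]) measurable
  finally show ?thesis .
qed

lemma random_lift_X:
  "random_lift g \<omega> \<sigma> z = (\<Sum>n\<in>dirichlet_support g. (dirichlet_shift \<sigma> g n * bohr_monomial n z) * X n \<omega>)"
  unfolding random_lift_def by (intro sum.cong refl) (auto simp: X'_def dirichlet_support_def)

text \<open>Monomials are unimodular on the torus, so the variance of the random lift is independent
  of z; this is why the square function with exponent 2 appears whatever p is.\<close>

lemma sum_norm_random_lift_coeffs:
  assumes "\<And>j. norm (z j) = 1"
  shows "(\<Sum>n\<in>S. (norm (dirichlet_shift \<sigma> g n * bohr_monomial n z))\<^sup>2) = (\<Sum>n\<in>S. sq_shift \<sigma> g n)"
  using assms by (simp add: norm_mult norm_bohr_monomial)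

lemma nn_integral_weighted_mass_randomization_le:
  assumes g: "g \<in> dirichlet_polynomials" and p: "0 < p"
  shows "(\<integral>\<^sup>+\<omega>. weighted_mass p p \<kappa> (randomization X g \<omega>) \<partial>M)
     \<le> ennreal (khinchin_const p)
        * (\<integral>\<^sup>+\<sigma>. ennreal ((\<Sum>n\<in>dirichlet_support g. sq_shift \<sigma> g n) powr (p / 2)) \<partial>\<kappa>)"
proof -
  interpret T: prob_space torus_haar by (rule prob_space_torus_haar)
  let ?S = "dirichlet_support g"
  have S: "finite ?S" "?S \<subseteq> {1..}"
    using g finite_dirichlet_support by (auto simp: dirichlet_support_def)
  have K: "0 \<le> khinchin_const p" by (simp add: khinchin_const_def)
  let ?v = "\<lambda>\<sigma>. \<Sum>n\<in>?S. sq_shift \<sigma> g n"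
  have "(\<integral>\<^sup>+\<omega>. weighted_mass p p \<kappa> (randomization X g \<omega>) \<partial>M)
      = (\<integral>\<^sup>+\<sigma>. (\<integral>\<^sup>+z. (\<integral>\<^sup>+\<omega>. ennreal (norm (random_lift g \<omega> \<sigma> z) powr p) \<partial>M) \<partial>torus_haar) \<partial>\<kappa>)"
    using nn_integral_weighted_mass_randomization[OF g p, of "\<lambda>_. 1"] by simp
  also have "\<dots> \<le> (\<integral>\<^sup>+\<sigma>. (\<integral>\<^sup>+z. ennreal (khinchin_const p * ?v \<sigma> powr (p / 2)) \<partial>torus_haar) \<partial>\<kappa>)"
  proof (rule nn_integral_mono, rule nn_integral_mono_AE)
    fix \<sigma>
    show "AE z in torus_haar. (\<integral>\<^sup>+\<omega>. ennreal (norm (random_lift g \<omega> \<sigma> z) powr p) \<partial>M)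
        \<le> ennreal (khinchin_const p * ?v \<sigma> powr (p / 2))"
      using AE_torus_haar
    proof eventually_elim
      case (elim z)
      then show ?case
        using khinchin_upper[OF S p, of "\<lambda>n. dirichlet_shift \<sigma> g n * bohr_monomial n z"]
        by (simp add: random_lift_X sum_norm_random_lift_coeffs)
    qed
  qed
  also have "\<dots> = ennreal (khinchin_const p) * (\<integral>\<^sup>+\<sigma>. ennreal (?v \<sigma> powr (p / 2)) \<partial>\<kappa>)"
    using K by (simp add: T.emeasure_space_1[simplified] ennreal_mult nn_integral_cmult)
  finally show ?thesis .
qed

lemma le_nn_integral_weighted_mass_randomization:
  assumes g: "g \<in> dirichlet_polynomials" and p: "0 < p"
    and B: "B \<in> events" "1 - 1 / (4 * khinchin_const 4) \<le> prob B"
  shows "ennreal (1 / (4 * khinchin_const 4) / 2 powr p)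
        * (\<integral>\<^sup>+\<sigma>. ennreal ((\<Sum>n\<in>dirichlet_support g. sq_shift \<sigma> g n) powr (p / 2)) \<partial>\<kappa>)
     \<le> (\<integral>\<^sup>+\<omega>. weighted_mass p p \<kappa> (randomization X g \<omega>) * indicator B \<omega> \<partial>M)"
proof -
  interpret T: prob_space torus_haar by (rule prob_space_torus_haar)
  let ?S = "dirichlet_support g"
  define c where "c = 1 / (4 * khinchin_const 4) / 2 powr p"
  have S: "finite ?S" "?S \<subseteq> {1..}"
    using g finite_dirichlet_support by (auto simp: dirichlet_support_def)
  have c: "0 \<le> c" by (simp add: c_def khinchin_const_def)
  let ?v = "\<lambda>\<sigma>. \<Sum>n\<in>?S. sq_shift \<sigma> g n"
  have "ennreal c * (\<integral>\<^sup>+\<sigma>. ennreal (?v \<sigma> powr (p / 2)) \<partial>\<kappa>)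
      = (\<integral>\<^sup>+\<sigma>. (\<integral>\<^sup>+z. ennreal (c * ?v \<sigma> powr (p / 2)) \<partial>torus_haar) \<partial>\<kappa>)"
    using c by (simp add: T.emeasure_space_1[simplified] ennreal_mult nn_integral_cmult)
  also have "\<dots> \<le> (\<integral>\<^sup>+\<sigma>. (\<integral>\<^sup>+z. (\<integral>\<^sup>+\<omega>. ennreal (norm (random_lift g \<omega> \<sigma> z) powr p) * indicator B \<omega> \<partial>M) \<partial>torus_haar) \<partial>\<kappa>)"
  proof (rule nn_integral_mono, rule nn_integral_mono_AE)
    fix \<sigma>
    show "AE z in torus_haar. ennreal (c * ?v \<sigma> powr (p / 2))
       \<le> (\<integral>\<^sup>+\<omega>. ennreal (norm (random_lift g \<omega> \<sigma> z) powr p) * indicator B \<omega> \<partial>M)"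
      using AE_torus_haar
    proof eventually_elim
      case (elim z)
      then show ?case
        using khinchin_lower_restricted[OF S p B, of "\<lambda>n. dirichlet_shift \<sigma> g n * bohr_monomial n z"]
        by (simp only: c_def random_lift_X sum_norm_random_lift_coeffs)
    qed
  qed
  also have "\<dots> = (\<integral>\<^sup>+\<omega>. weighted_mass p p \<kappa> (randomization X g \<omega>) * indicator B \<omega> \<partial>M)"
    using B(1) by (intro nn_integral_weighted_mass_randomization[symmetric] g p) auto
  finally show ?thesis by (simp only: c_def)
qed

end

section \<open>Almost sure membership\<close>

context randomized
begin

text \<open>E |X_n|^2 = 1 makes the expected sum of squares finite at each shift. The shifts 1/(j +
  1) are countably many, so one null set suffices, and monotonicity reaches all positive
  shifts.\<close>

lemma AE_summable_randomization:
  assumes sq: "\<And>\<sigma>. 0 < \<sigma> \<Longrightarrow> summable (\<lambda>n. sq_shift \<sigma> f n)"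
  shows "AE \<omega> in M. \<forall>\<sigma>>0. summable (\<lambda>n. sq_shift \<sigma> (randomization X f \<omega>) n)"
proof -
  have "AE \<omega> in M. \<forall>j. summable (\<lambda>n. (norm (dirichlet_shift (inverse (real (Suc j))) (randomization X f \<omega>) n))\<^sup>2)"
    unfolding AE_all_countable
  proof
    fix j
    define \<sigma> where "\<sigma> = inverse (real (Suc j))"
    have \<sigma>: "0 < \<sigma>" by (simp add: \<sigma>_def)
    let ?u = "\<lambda>n \<omega>. sq_shift \<sigma> (\<lambda>n. f n * X' n \<omega>) n"
    have shift: "dirichlet_shift \<sigma> (\<lambda>n. f n * X' n \<omega>) n = dirichlet_shift \<sigma> f n * X' n \<omega>" for n \<omega>
      by (simp add: dirichlet_shift_def)
    have m: "(\<integral>\<^sup>+\<omega>. ennreal (?u n \<omega>) \<partial>M) \<le> ennreal (sq_shift \<sigma> f n)" for n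
    proof (cases "n = 0")
      case True
      then show ?thesis by (simp add: w.dirichlet_shift_0)
    next
      case False
      then have n: "1 \<le> n" by simp
      have "(\<integral>\<^sup>+\<omega>. ennreal (?u n \<omega>) \<partial>M)
          = ennreal (sq_shift \<sigma> f n) * (\<integral>\<^sup>+\<omega>. ennreal ((norm (X n \<omega>))\<^sup>2) \<partial>M)"
        unfolding shift using measurable_X[OF n] n
        by (simp add: norm_mult power_mult_distrib ennreal_mult nn_integral_cmult X'_def)
      also have "(\<integral>\<^sup>+\<omega>. ennreal ((norm (X n \<omega>))\<^sup>2) \<partial>M) = ennreal 1"
        using integrable_norm_X_square[OF n] integral_norm_X_square[OF n]
        by (subst nn_integral_eq_integral) auto
      finally show ?thesis by simp
    qed
    have [measurable]: "(\<lambda>\<omega>. ?u n \<omega>) \<in> borel_measurable M" for n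
      unfolding shift by measurable
    have "(\<integral>\<^sup>+\<omega>. (\<Sum>n. ennreal (?u n \<omega>)) \<partial>M) = (\<Sum>n. \<integral>\<^sup>+\<omega>. ennreal (?u n \<omega>) \<partial>M)"
      by (rule nn_integral_suminf) measurable
    also have "\<dots> \<le> (\<Sum>n. ennreal (sq_shift \<sigma> f n))"
      by (intro suminf_le m) auto
    also have "\<dots> = ennreal (\<Sum>n. sq_shift \<sigma> f n)"
      by (intro suminf_ennreal2 sq \<sigma>) auto
    finally have "AE \<omega> in M. (\<Sum>n. ennreal (?u n \<omega>)) \<noteq> \<infinity>"
      by (intro nn_integral_PInf_AE) (auto simp: top_unique)
    then show "AE \<omega> in M. summable (\<lambda>n. (norm (dirichlet_shift (inverse (real (Suc j))) (randomization X f \<omega>) n))\<^sup>2)"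
    proof eventually_elim
      case (elim \<omega>)
      then have "summable (\<lambda>n. ?u n \<omega>)" by (intro summable_suminf_not_top) auto
      moreover have "dirichlet_shift \<sigma> (\<lambda>n. f n * X' n \<omega>) n = dirichlet_shift \<sigma> (randomization X f \<omega>) n" for n
        by (cases "n = 0") (auto simp: dirichlet_shift_def randomization_def X'_def)
      ultimately show ?case by (simp add: \<sigma>_def)
    qed
  qed
  then show ?thesis
  proof eventually_elim
    case (elim \<omega>)
    show ?case
    proof (intro allI impI)
      fix \<sigma> :: real assume "0 < \<sigma>"
      then obtain j where "inverse (real (Suc j)) < \<sigma>" using reals_Archimedean by blast
      then show "summable (\<lambda>n. sq_shift \<sigma> (randomization X f \<omega>) n)"
        using elim summable_dirichlet_shift_mono less_imp_le by blast
    qed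
  qed
qed

text \<open>
  A Cauchy sequence along a subsequence of the partial sums suffices, so the mean bound from
  Khinchin's inequality can be summed and no maximal inequality is needed.
\<close>

lemma AE_completion_of_energy_bounded:
  assumes f: "w.energy_bounded p f" and p: "0 < p"
  shows "AE \<omega> in M. randomization X f \<omega> \<in> dirichlet_completion (weighted_norm p p \<kappa>)"
proof -
  define H where "H = khinchin_const p"
  have H: "0 < H" using p by (simp add: H_def khinchin_const_def)
  \<comment> \<open>Chosen so that, after multiplication by Khinchin's constant \<open>H\<close> and
    the weight (2^p)^m of \<open>weighted_mass_sum_le\<close>, exactly 2^-m remains.\<close>
  define \<epsilon> where "\<epsilon> m = (1 / 2) ^ m / ((2 powr p) ^ m * H)" for m :: nat
  have \<epsilon>: "0 < \<epsilon> m" for m using H by (simp add: \<epsilon>_def)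
  let ?Q = "\<lambda>m K. \<forall>S. finite S \<longrightarrow> S \<subseteq> {K..} \<longrightarrow>
      (\<integral>\<^sup>+\<sigma>. square_fun p f S \<sigma> \<partial>\<kappa>) \<le> ennreal (\<epsilon> m)"
  have "\<exists>K. ?Q m K" for m
    by (rule w.energy_tail_small[OF f p \<epsilon>[of m]]) blast
  then obtain K where "\<forall>m. ?Q m (K m)" using choice[of ?Q] by blast
  then have K: "(\<integral>\<^sup>+\<sigma>. square_fun p f S \<sigma> \<partial>\<kappa>) \<le> ennreal (\<epsilon> m)"
    if "finite S" "S \<subseteq> {K m..}" for m S
    using that by blast
  \<comment> \<open>\<open>N m\<close> dominates both \<open>K m\<close> and \<open>m\<close>, and
    the accumulated sum makes it increasing; so the block \<open>d m\<close> is supported on indices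
    from \<open>N m\<close> up to below \<open>N (Suc m)\<close>.\<close>
  define N where "N m = m + (\<Sum>i\<le>m. K i)" for m
  have N: "K m \<le> N m" "m \<le> N m" for m by (auto simp: N_def intro: trans_le_add2 member_le_sum)
  define d where "d m n = w.partial_sum (N (Suc m)) f n - w.partial_sum (N m) f n" for m n
  have d: "d m \<in> dirichlet_polynomials" for m
    unfolding d_def by (intro diff_dirichlet_polynomials w.partial_sum_polynomials)
  define J where "J m \<omega> = weighted_mass p p \<kappa> (randomization X (d m) \<omega>)" for m \<omega>
  have [measurable]: "J m \<in> borel_measurable M" for m
    unfolding J_def by (rule borel_measurable_weighted_mass_randomization[OF d p])
  have EJ: "(\<integral>\<^sup>+\<omega>. J m \<omega> \<partial>M) \<le> ennreal (H * \<epsilon> m)" for m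
  proof -
    let ?S = "dirichlet_support (d m)"
    have dm: "n \<in> ?S \<Longrightarrow> N m \<le> n" "norm (d m n) \<le> norm (f n)" for n
      by (auto simp: dirichlet_support_def d_def w.partial_sum_def N_def split: if_splits)
    have "(\<integral>\<^sup>+\<omega>. J m \<omega> \<partial>M) \<le> ennreal H * (\<integral>\<^sup>+\<sigma>. square_fun p (d m) ?S \<sigma> \<partial>\<kappa>)"
      unfolding J_def H_def by (rule nn_integral_weighted_mass_randomization_le[OF d p])
    also have "\<dots> \<le> ennreal H * (\<integral>\<^sup>+\<sigma>. square_fun p f ?S \<sigma> \<partial>\<kappa>)"
      using p dm(2) by (intro mult_left_mono nn_integral_mono ennreal_leI powr_mono2 sum_mono power_mono)
        (auto simp: dirichlet_shift_def norm_mult intro: sum_nonneg mult_right_mono)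
    also have "\<dots> \<le> ennreal H * ennreal (\<epsilon> m)"
      using dm(1) N(1)[of m] finite_dirichlet_support[OF d[of m]] by (intro mult_left_mono K) force+
    finally show ?thesis using H by (simp add: ennreal_mult[symmetric] less_imp_le[OF \<epsilon>])
  qed
  have "(\<integral>\<^sup>+\<omega>. (\<Sum>m. ennreal ((2 powr p) ^ m) * J m \<omega>) \<partial>M) = (\<Sum>m. \<integral>\<^sup>+\<omega>. ennreal ((2 powr p) ^ m) * J m \<omega> \<partial>M)"
    by (rule nn_integral_suminf) measurable
  also have "\<dots> \<le> (\<Sum>m. ennreal ((1 / 2) ^ m))"
  proof (intro suminf_le)
    fix m
    have "(\<integral>\<^sup>+\<omega>. ennreal ((2 powr p) ^ m) * J m \<omega> \<partial>M) \<le> ennreal ((2 powr p) ^ m) * ennreal (H * \<epsilon> m)"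
      by (simp add: nn_integral_cmult mult_left_mono EJ)
    also have "\<dots> = ennreal ((2 powr p) ^ m * (H * \<epsilon> m))" using H \<epsilon>[of m] by (simp add: ennreal_mult)
    also have "(2 powr p) ^ m * (H * \<epsilon> m) = (1 / 2) ^ m" using H by (simp add: \<epsilon>_def)
    finally show "(\<integral>\<^sup>+\<omega>. ennreal ((2 powr p) ^ m) * J m \<omega> \<partial>M) \<le> ennreal ((1 / 2) ^ m)" .
  qed auto
  also have "\<dots> = ennreal (\<Sum>m. (1 / 2) ^ m)"
    by (intro suminf_ennreal2 summable_geometric) auto
  finally have "AE \<omega> in M. (\<Sum>m. ennreal ((2 powr p) ^ m) * J m \<omega>) \<noteq> \<infinity>"
    by (intro nn_integral_PInf_AE) (auto simp: top_unique)
  moreover have "AE \<omega> in M. \<forall>\<sigma>>0. summable (\<lambda>n. sq_shift \<sigma> (randomization X f \<omega>) n)"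
    by (rule AE_summable_randomization[OF w.summable_of_energy_bounded[OF f p]])
  ultimately show ?thesis
  proof eventually_elim
    case (elim \<omega>)
    let ?P = "\<lambda>k. w.partial_sum (N k) (randomization X f \<omega>)"
    define y where "y m = enn2real (ennreal ((2 powr p) ^ m) * J m \<omega>)" for m
    have y: "ennreal ((2 powr p) ^ m) * J m \<omega> = ennreal (y m)" for m
    proof -
      have "ennreal ((2 powr p) ^ m) * J m \<omega> \<noteq> \<infinity>"
        using elim(1) sum_le_suminf[of "\<lambda>m. ennreal ((2 powr p) ^ m) * J m \<omega>" "{m}"] by (auto simp: top_unique)
      then show ?thesis unfolding y_def by (simp only: ennreal_enn2real_if infinity_ennreal_def if_False)
    qed
    have y0: "0 \<le> y m" for m by (simp add: y_def)
    have sum_y: "summable y"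
      using elim(1) unfolding y by (intro summable_suminf_not_top y0) auto
    have mass: "weighted_mass p p \<kappa> (\<lambda>n. ?P l n - ?P k n) \<le> ennreal (2 powr p * (\<Sum>m=k..<l. y m))" if "k \<le> l" for k l
    proof -
      have "?P l n - ?P k n = (\<Sum>m=k..<l. randomization X (d m) \<omega> n)" for n
      proof -
        have "(\<Sum>m=k..<l. randomization X (d m) \<omega> n) = (\<Sum>m=k..<l. ?P (Suc m) n - ?P m n)"
          by (intro sum.cong refl) (simp add: randomization_def d_def w.partial_sum_def)
        also have "\<dots> = ?P l n - ?P k n" using that by (rule sum_Suc_diff')
        finally show ?thesis ..
      qed
      then have "weighted_mass p p \<kappa> (\<lambda>n. ?P l n - ?P k n) = weighted_mass p p \<kappa> (\<lambda>n. \<Sum>m=k..<l. randomization X (d m) \<omega> n)"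
        by simp
      also have "\<dots> \<le> ennreal (2 powr p) * (\<Sum>m=k..<l. ennreal ((2 powr p) ^ m) * J m \<omega>)"
        unfolding J_def using p by (intro w.weighted_mass_sum_le randomization_polynomials d) auto
      also have "\<dots> = ennreal (2 powr p * (\<Sum>m=k..<l. y m))"
        unfolding y using y0 by (simp add: ennreal_mult sum_nonneg)
      finally show ?thesis .
    qed
    show ?case
      unfolding dirichlet_completion_def
    proof (intro CollectI conjI allI impI exI[of _ ?P])
      fix s :: complex assume "1 / 2 < Re s"
      then show "dirichlet_converges (randomization X f \<omega>) s"
        using elim(2) by (intro dirichlet_converges_of_square_summable) auto
    next
      fix e :: real assume e: "0 < e"
      \<comment> \<open>The divisor 2^p cancels the constant in \<open>mass\<close>; the half of
        \<open>e\<close> leaves room for the strict inequality.\<close>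
      have "0 < (e / 2) powr p / 2 powr p" using e by simp
      then obtain K' where K': "\<And>m n. K' \<le> m \<Longrightarrow> norm (\<Sum>k=m..<n. y k) < (e / 2) powr p / 2 powr p"
        using sum_y unfolding summable_Cauchy by blast
      have less: "weighted_norm p p \<kappa> (\<lambda>n. ?P l n - ?P k n) < e"
        and less': "weighted_norm p p \<kappa> (\<lambda>n. ?P k n - ?P l n) < e" if "K' \<le> k" "k \<le> l" for k l
      proof -
        have "(\<Sum>m=k..<l. y m) \<le> (e / 2) powr p / 2 powr p"
          using K'[OF that(1), of l] by (auto simp: abs_less_iff intro: less_imp_le)
        then have "2 powr p * (\<Sum>m=k..<l. y m) \<le> (e / 2) powr p"
          by (simp add: field_simps)
        then have "weighted_mass p p \<kappa> (\<lambda>n. ?P l n - ?P k n) \<le> ennreal ((e / 2) powr p)"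
          using mass[OF that(2)] by (meson ennreal_leI order_trans)
        then show "weighted_norm p p \<kappa> (\<lambda>n. ?P l n - ?P k n) < e" "weighted_norm p p \<kappa> (\<lambda>n. ?P k n - ?P l n) < e"
          using p e w.weighted_mass_diff_commute[of p p "?P k" "?P l"] by (auto intro!: w.weighted_norm_less)
      qed
      show "\<exists>K. \<forall>j\<ge>K. \<forall>k\<ge>K. weighted_norm p p \<kappa> (\<lambda>n. ?P j n - ?P k n) < e"
        using less less' by (meson nle_le)
    next
      fix n :: nat
      have "filterlim N at_top sequentially"
        using N(2) by (intro filterlim_at_top_mono[OF filterlim_ident]) auto
      then show "(\<lambda>k. ?P k n) \<longlonglongrightarrow> randomization X f \<omega> n"
        by (rule filterlim_compose[OF w.partial_sum_tendsto])
    qed (rule w.partial_sum_polynomials)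
  qed
qed

text \<open>A multiplier keeps finitely many coefficients, on which the approximants converge, so
  Fatou's lemma applies on the torus and again over \<kappa>. Multipliers commute with shifts, hence
  the torus bound holds at every \<sigma>, with the same constant for all \<open>i\<close>.\<close>

lemma bounded_multiplier_mass_of_completion:
  fixes W :: "nat \<Rightarrow> nat \<Rightarrow> real"
  assumes p: "0 < p" and g: "g \<in> dirichlet_completion (weighted_norm p p \<kappa>)"
    and fin: "\<And>i. finite {n. 1 \<le> n \<and> W i n \<noteq> 0}"
    and W: "\<And>i a. a \<in> dirichlet_polynomials \<Longrightarrow> hardy_mass p (\<lambda>n. of_real (W i n) * a n) \<le> ennreal C * hardy_mass p a"
  obtains B where "\<And>i. weighted_mass p p \<kappa> (\<lambda>n. of_real (W i n) * g n) \<le> ennreal B"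
proof -
  obtain P where P: "\<And>k. P k \<in> dirichlet_polynomials"
    and Cauchy: "\<And>\<epsilon>. 0 < \<epsilon> \<Longrightarrow> \<exists>K. \<forall>j\<ge>K. \<forall>k\<ge>K. weighted_norm p p \<kappa> (\<lambda>n. P j n - P k n) < \<epsilon>"
    and lim: "\<And>n. 1 \<le> n \<Longrightarrow> (\<lambda>k. P k n) \<longlonglongrightarrow> g n"
    using g unfolding dirichlet_completion_def by blast
  obtain B K where B: "\<And>k. K \<le> k \<Longrightarrow> weighted_mass p p \<kappa> (P k) \<le> ennreal B"
    using w.bounded_weighted_mass_of_Cauchy[OF P p p Cauchy] by metis
  let ?m = "\<lambda>i a n. of_real (W i n) * a n :: complex"
  have poly: "?m i a \<in> dirichlet_polynomials" for i a
    unfolding dirichlet_polynomials_def using fin[of i] by (auto elim: rev_finite_subset)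
  have bound: "weighted_mass p p \<kappa> (?m i (P k)) \<le> ennreal C * ennreal B" if "K \<le> k" for i k
  proof -
    have "weighted_mass p p \<kappa> (?m i (P k)) = (\<integral>\<^sup>+\<sigma>. hardy_mass p (?m i (dirichlet_shift \<sigma> (P k))) \<partial>\<kappa>)"
      using w.weighted_mass_diag[OF poly p] by (simp only: dirichlet_shift_multiplier)
    also have "\<dots> \<le> (\<integral>\<^sup>+\<sigma>. ennreal C * hardy_mass p (dirichlet_shift \<sigma> (P k)) \<partial>\<kappa>)"
      by (intro nn_integral_mono W dirichlet_shift_polynomials P)
    also have "\<dots> = ennreal C * weighted_mass p p \<kappa> (P k)"
      by (simp add: nn_integral_cmult w.weighted_mass_diag[OF P p])
    also have "\<dots> \<le> ennreal C * ennreal B" by (intro mult_left_mono B that) simp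
    finally show ?thesis .
  qed
  have "weighted_mass p p \<kappa> (?m i g) \<le> ennreal C * ennreal B" for i
  proof -
    have hm: "hardy_mass p (dirichlet_shift \<sigma> (?m i g)) \<le> liminf (\<lambda>k. hardy_mass p (dirichlet_shift \<sigma> (?m i (P k))))" for \<sigma>
    proof -
      have lift: "bohr_lift (dirichlet_shift \<sigma> (?m i a)) z
          = (\<Sum>n | 1 \<le> n \<and> W i n \<noteq> 0. dirichlet_shift \<sigma> (?m i a) n * bohr_monomial n z)" for a z
        using fin[of i] by (intro bohr_lift_sum) (auto simp: dirichlet_shift_def)
      have "(\<lambda>k. bohr_lift (dirichlet_shift \<sigma> (?m i (P k))) z) \<longlonglongrightarrow> bohr_lift (dirichlet_shift \<sigma> (?m i g)) z" for z
        unfolding lift dirichlet_shift_def by (intro tendsto_sum tendsto_mult tendsto_const lim) auto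
      then have lim_norm: "(\<lambda>k. ennreal (norm (bohr_lift (dirichlet_shift \<sigma> (?m i (P k))) z) powr p))
          \<longlonglongrightarrow> ennreal (norm (bohr_lift (dirichlet_shift \<sigma> (?m i g)) z) powr p)" for z
        using p by (intro tendsto_ennrealI tendsto_powr' tendsto_norm) auto
      have "hardy_mass p (dirichlet_shift \<sigma> (?m i g))
          = (\<integral>\<^sup>+z. liminf (\<lambda>k. ennreal (norm (bohr_lift (dirichlet_shift \<sigma> (?m i (P k))) z) powr p)) \<partial>torus_haar)"
        unfolding hardy_mass_def by (intro nn_integral_cong lim_imp_Liminf[symmetric] lim_norm) simp
      also have "\<dots> \<le> liminf (\<lambda>k. hardy_mass p (dirichlet_shift \<sigma> (?m i (P k))))"
        unfolding hardy_mass_def by (rule nn_integral_liminf) measurable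
      finally show ?thesis .
    qed
    have "weighted_mass p p \<kappa> (?m i g) \<le> (\<integral>\<^sup>+\<sigma>. liminf (\<lambda>k. hardy_mass p (dirichlet_shift \<sigma> (?m i (P k)))) \<partial>\<kappa>)"
      unfolding w.weighted_mass_diag[OF poly p] by (intro nn_integral_mono hm)
    also have "\<dots> \<le> liminf (\<lambda>k. weighted_mass p p \<kappa> (?m i (P k)))"
      unfolding w.weighted_mass_diag[OF poly p] by (rule nn_integral_liminf) measurable
    also have "\<dots> \<le> ennreal C * ennreal B"
      by (intro Liminf_le eventually_mono[OF eventually_ge_at_top[of K]] bound) auto
    finally show ?thesis .
  qed
  then show ?thesis by (intro that[of "enn2real (ennreal C * ennreal B)"]) (simp add: ennreal_mult_less_top)
qed

text \<open>The almost sure bound over all multipliers depends on \<omega>; restricting to the event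
  where it is at most a fixed m yields a bounded expectation, and the restricted Khinchin inequality
  turns this into a deterministic energy bound for every multiplied series.\<close>

lemma energy_bounded_of_AE_completion:
  assumes p: "0 < p" and AE: "AE \<omega> in M. randomization X f \<omega> \<in> dirichlet_completion (weighted_norm p p \<kappa>)"
  shows "w.energy_bounded p f"
proof -
  obtain W :: "nat \<Rightarrow> nat \<Rightarrow> real" where W: "\<And>i. finite {n. 1 \<le> n \<and> W i n \<noteq> 0}"
    "\<And>n. (\<lambda>i. W i n) \<longlonglongrightarrow> 1"
    "\<And>i a. a \<in> dirichlet_polynomials \<Longrightarrow>
       hardy_mass p (\<lambda>n. of_real (W i n) * a n) \<le> ennreal (2 powr p * 2) * hardy_mass p a"
    using bounded_summation_method[OF p] by blast
  define g where "g i n = of_real (W i n) * f n" for i n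
  have g: "g i \<in> dirichlet_polynomials" for i
    unfolding dirichlet_polynomials_def g_def using W(1)[of i] by (auto elim: rev_finite_subset)
  define J where "J i \<omega> = weighted_mass p p \<kappa> (randomization X (g i) \<omega>)" for i \<omega>
  have [measurable]: "J i \<in> borel_measurable M" for i
    unfolding J_def by (rule borel_measurable_weighted_mass_randomization[OF g p])
  \<comment> \<open>The supremum over \<open>i\<close> makes one event serve all multipliers. These
    sets are measurable, while no measurability of the membership event itself is used.\<close>
  define A where "A m = {\<omega> \<in> space M. (SUP i. J i \<omega>) \<le> ennreal (real m)}" for m :: nat
  have A: "A m \<in> events" for m unfolding A_def by measurable
  have AE_A: "AE \<omega> in M. \<omega> \<in> (\<Union>m. A m)"
    using AE AE_space
  proof eventually_elim
    case (elim \<omega>)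
    obtain B where B: "\<And>i. weighted_mass p p \<kappa> (\<lambda>n. of_real (W i n) * randomization X f \<omega> n) \<le> ennreal B"
      by (rule bounded_multiplier_mass_of_completion[of p _ W "2 powr p * 2"],
          rule p, rule elim(1), rule W(1), rule W(3), assumption) blast
    obtain m :: nat where m: "B \<le> real m" using real_arch_simple by blast
    have "(\<lambda>n. of_real (W i n) * randomization X f \<omega> n) = randomization X (g i) \<omega>" for i
      by (simp add: g_def randomization_def fun_eq_iff)
    then have "J i \<omega> \<le> ennreal (real m)" for i
      using B[of i] m unfolding J_def by (metis ennreal_leI order_trans)
    then have "\<omega> \<in> A m" using elim(2) by (auto simp: A_def intro: SUP_least)
    then show ?case by blast
  qed
  have "incseq A"
    unfolding incseq_def A_def by (auto intro: order_trans ennreal_leI)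
  then have "(\<lambda>m. prob (A m)) \<longlonglongrightarrow> prob (\<Union>m. A m)"
    using A by (intro finite_Lim_measure_incseq) auto
  also have "prob (\<Union>m. A m) = 1"
    using AE_A A by (subst prob_eq_1) auto
  finally have "(\<lambda>m. prob (A m)) \<longlonglongrightarrow> 1" .
  moreover have "1 - 1 / (4 * khinchin_const 4) < 1" by (simp add: khinchin_const_def)
  ultimately have "\<forall>\<^sub>F m in sequentially. 1 - 1 / (4 * khinchin_const 4) < prob (A m)"
    by (rule order_tendstoD)
  then obtain m where m: "1 - 1 / (4 * khinchin_const 4) < prob (A m)"
    by (auto simp: eventually_sequentially)
  define c where "c = 1 / (4 * khinchin_const 4) / 2 powr p"
  have c: "0 < c" by (simp add: c_def khinchin_const_def)
  let ?e = "\<lambda>N h \<sigma>. square_fun p h {..<N} \<sigma>"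
  have bound: "(\<integral>\<^sup>+\<sigma>. ?e N (g i) \<sigma> \<partial>\<kappa>) \<le> ennreal (real m / c)" for N i
  proof -
    let ?S = "dirichlet_support (g i)"
    have "ennreal c * (\<integral>\<^sup>+\<sigma>. square_fun p (g i) ?S \<sigma> \<partial>\<kappa>)
       \<le> (\<integral>\<^sup>+\<omega>. J i \<omega> * indicator (A m) \<omega> \<partial>M)"
      unfolding J_def c_def using m by (intro le_nn_integral_weighted_mass_randomization g p A) auto
    also have "\<dots> \<le> (\<integral>\<^sup>+\<omega>. ennreal (real m) \<partial>M)"
    proof (intro nn_integral_mono)
      fix \<omega>
      show "J i \<omega> * indicator (A m) \<omega> \<le> ennreal (real m)"
      proof (cases "\<omega> \<in> A m")
        case True
        have "J i \<omega> \<le> (SUP i. J i \<omega>)" by (rule SUP_upper) simp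
        also have "\<dots> \<le> ennreal (real m)" using True by (simp add: A_def)
        finally show ?thesis using True by simp
      qed simp
    qed
    also have "\<dots> = ennreal (real m)" by (simp add: emeasure_space_1)
    finally have "ennreal c * (\<integral>\<^sup>+\<sigma>. square_fun p (g i) ?S \<sigma> \<partial>\<kappa>) \<le> ennreal (real m)" .
    moreover have "(\<integral>\<^sup>+\<sigma>. ?e N (g i) \<sigma> \<partial>\<kappa>) \<le> (\<integral>\<^sup>+\<sigma>. square_fun p (g i) ?S \<sigma> \<partial>\<kappa>)"
    proof (intro nn_integral_mono ennreal_leI powr_mono2)
      fix \<sigma>
      have "(\<Sum>n<N. sq_shift \<sigma> (g i) n) = (\<Sum>n\<in>{..<N} \<inter> ?S. sq_shift \<sigma> (g i) n)"
        by (intro sum.mono_neutral_right) (auto simp: dirichlet_support_def dirichlet_shift_def Suc_le_eq)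
      also have "\<dots> \<le> (\<Sum>n\<in>?S. sq_shift \<sigma> (g i) n)"
        using finite_dirichlet_support[OF g[of i]] by (intro sum_mono2) auto
      finally show "(\<Sum>n<N. sq_shift \<sigma> (g i) n) \<le> \<dots>" .
    qed (use p in \<open>auto intro: sum_nonneg\<close>)
    ultimately have "ennreal c * (\<integral>\<^sup>+\<sigma>. ?e N (g i) \<sigma> \<partial>\<kappa>) \<le> ennreal (real m)"
      by (meson mult_left_mono order_trans zero_le)
    then have "ennreal (1 / c) * (ennreal c * (\<integral>\<^sup>+\<sigma>. ?e N (g i) \<sigma> \<partial>\<kappa>)) \<le> ennreal (1 / c) * ennreal (real m)"
      by (intro mult_left_mono) auto
    then show ?thesis
      using c by (simp add: mult.assoc[symmetric] ennreal_mult[symmetric])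
  qed
  \<comment> \<open>With \<open>N\<close> fixed, only the finitely many weights \<open>W i n\<close>
    for n < N matter as \<open>i\<close> grows, and all tend to 1; the bound is free of both
    \<open>i\<close> and \<open>N\<close>.\<close>
  have "(\<integral>\<^sup>+\<sigma>. ?e N f \<sigma> \<partial>\<kappa>) \<le> ennreal (real m / c)" for N
  proof (rule nn_integral_le_of_tendsto)
    show "AE \<sigma> in \<kappa>. (\<lambda>i. ?e N (g i) \<sigma>) \<longlonglongrightarrow> ?e N f \<sigma>"
    proof (intro AE_I2)
      fix \<sigma>
      have "(\<lambda>i. dirichlet_shift \<sigma> (g i) n) \<longlonglongrightarrow> of_real 1 * f n * of_real (real n powr - \<sigma>)" for n
        unfolding dirichlet_shift_def g_def by (intro tendsto_mult tendsto_of_real W(2) tendsto_const)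
      then have "(\<lambda>i. dirichlet_shift \<sigma> (g i) n) \<longlonglongrightarrow> dirichlet_shift \<sigma> f n" for n
        by (simp add: dirichlet_shift_def)
      then have "(\<lambda>i. (\<Sum>n<N. sq_shift \<sigma> (g i) n)) \<longlonglongrightarrow> (\<Sum>n<N. sq_shift \<sigma> f n)"
        by (intro tendsto_sum tendsto_power tendsto_norm)
      then show "(\<lambda>i. ?e N (g i) \<sigma>) \<longlonglongrightarrow> ?e N f \<sigma>"
        using p by (intro tendsto_ennrealI tendsto_powr') (auto intro!: always_eventually sum_nonneg)
    qed
    show "\<forall>\<^sub>F i in sequentially. (\<integral>\<^sup>+\<sigma>. ?e N (g i) \<sigma> \<partial>\<kappa>) \<le> ennreal (real m / c)"
      using bound by simp
  qed measurable
  then show ?thesis unfolding w.energy_bounded_def by blast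
qed

theorem AE_completion_iff:
  assumes "0 < p"
  shows "(AE \<omega> in M. randomization X f \<omega> \<in> dirichlet_completion (weighted_norm p p \<kappa>))
     \<longleftrightarrow> f \<in> dirichlet_completion (weighted_norm 2 p \<kappa>)"
  using assms energy_bounded_of_AE_completion AE_completion_of_energy_bounded
  by (auto simp: w.completion_iff_energy_bounded)

end

section \<open>The two instances: point mass at 0 and \<open>mu_measure\<close>\<close>

lemma randomizedI:
  assumes "standard_random_sequence M X" "shift_weight \<kappa>"
  shows "\<exists>L. randomized M X L \<kappa>"
proof -
  obtain L where L: "L \<in> {bernoulli_law, circle_law, gaussian_law}" "\<And>n. 1 \<le> n \<Longrightarrow> distr M borel (X n) = L"
    and M: "prob_space M" "prob_space.indep_vars M (\<lambda>_. borel) X {1..}"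
    using assms(1) unfolding standard_random_sequence_def by blast
  have "standard_law L"
    using L(1) standard_law_bernoulli standard_law_circle standard_law_gaussian by blast
  then show ?thesis
    using M L(2) assms(2) by (auto simp: randomized_def standard_sequence_def standard_sequence_axioms_def)
qed

lemma shift_weight_dirac: "shift_weight (return borel 0)"
proof -
  interpret prob_space "return borel (0 :: real)" by (rule prob_space_return) simp
  show ?thesis
    by unfold_locales (auto simp: AE_return)
qed

lemma weighted_norm_dirac:
  assumes "0 < q"
  shows "weighted_norm p q (return borel 0) P = hardy_norm p P"
proof -
  have eq: "{n. 1 \<le> n \<and> dirichlet_shift 0 P n \<noteq> 0} = {n. 1 \<le> n \<and> P n \<noteq> 0}"
    by (auto simp: dirichlet_shift_def)
  have "bohr_lift (dirichlet_shift 0 P) z = bohr_lift P z" for z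
    unfolding bohr_lift_def eq by (intro sum.cong refl) (auto simp: dirichlet_shift_def)
  then have "hardy_norm p (dirichlet_shift 0 P) = hardy_norm p P"
    by (simp add: hardy_norm_def)
  then have "weighted_norm p q (return borel 0) P = (hardy_norm p P powr q) powr (1 / q)"
    unfolding weighted_norm_def by (subst integral_return) auto
  then show ?thesis using assms by (simp add: powr_powr hardy_norm_nonneg)
qed

lemma weighted_norm_mu_measure: "weighted_norm p q (mu_measure \<alpha>) = mixed_norm p q \<alpha>"
  by (simp add: fun_eq_iff weighted_norm_def mixed_norm_def)

text \<open>Finiteness is a Gamma integral, convergent because \<alpha> > -1; 0 lies in the support
  because the density is positive on (0, \<epsilon>).\<close>

lemma shift_weight_mu_measure:
  assumes \<alpha>: "- 1 < \<alpha>"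
  shows "shift_weight (mu_measure \<alpha>)"
proof -
  define c where "c = 2 powr (\<alpha> + 1) / Gamma (\<alpha> + 1)"
  have c: "0 < c" using \<alpha> by (simp add: c_def Gamma_real_pos)
  define h where "h \<sigma> = ennreal (indicator {0<..} \<sigma> * (c * \<sigma> powr \<alpha> * exp (- 2 * \<sigma>)))" for \<sigma> :: real
  have [measurable]: "h \<in> borel_measurable borel" unfolding h_def by measurable
  have mu: "mu_measure \<alpha> = density lborel h"
    by (simp add: mu_measure_def h_def[abs_def] c_def)
  have em: "emeasure (mu_measure \<alpha>) A = (\<integral>\<^sup>+\<sigma>. h \<sigma> * indicator A \<sigma> \<partial>lborel)" if "A \<in> sets borel" for A
    using that by (simp add: mu emeasure_density)
  have fin: "emeasure (mu_measure \<alpha>) (space (mu_measure \<alpha>)) < \<top>"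
  proof -
    have "emeasure (mu_measure \<alpha>) (space (mu_measure \<alpha>)) = (\<integral>\<^sup>+\<sigma>. h \<sigma> \<partial>lborel)"
      by (simp add: mu emeasure_density)
    \<comment> \<open>Weakening exp (-2 \<sigma>) to exp (-\<sigma>) avoids a change of variables,
      as only finiteness matters; the exponent \<alpha> + 1 - 1 matches the Gamma integrand at
      \<alpha> + 1.\<close>
    also have "\<dots> \<le> (\<integral>\<^sup>+\<sigma>. ennreal c * ennreal (indicator {0..} \<sigma> * (\<sigma> powr (\<alpha> + 1 - 1) / exp \<sigma>)) \<partial>lborel)"
    proof (intro nn_integral_mono)
      fix \<sigma> :: real
      have "exp (- 2 * \<sigma>) \<le> 1 / exp \<sigma>" if "0 < \<sigma>"
        using that by (simp add: exp_minus[symmetric] divide_inverse)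
      then have "indicator {0<..} \<sigma> * (c * \<sigma> powr \<alpha> * exp (- 2 * \<sigma>)) \<le> c * (indicator {0..} \<sigma> * (\<sigma> powr \<alpha> * (1 / exp \<sigma>)))"
        using c mult_left_mono[of "exp (- 2 * \<sigma>)" "1 / exp \<sigma>" "c * \<sigma> powr \<alpha>"]
        by (cases "0 < \<sigma>") (auto simp: indicator_def mult.assoc)
      then show "h \<sigma> \<le> ennreal c * ennreal (indicator {0..} \<sigma> * (\<sigma> powr (\<alpha> + 1 - 1) / exp \<sigma>))"
        using c unfolding h_def by (subst ennreal_mult[symmetric]) (auto intro!: ennreal_leI)
    qed
    also have "\<dots> = ennreal c * ennreal (Gamma (\<alpha> + 1))"
      using \<alpha> Gamma_conv_nn_integral_real[of "\<alpha> + 1"] by (simp add: nn_integral_cmult)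
    also have "\<dots> < \<top>" by (simp add: ennreal_mult_less_top)
    finally show ?thesis .
  qed
  interpret finite_measure "mu_measure \<alpha>"
    by (rule finite_measureI) (use fin in simp)
  show ?thesis
  proof unfold_locales
    show "sets (mu_measure \<alpha>) = sets borel" by (simp add: mu)
    show "AE \<sigma> in mu_measure \<alpha>. 0 \<le> \<sigma>"
      unfolding mu by (subst AE_density) (auto simp: h_def indicator_def)
    fix \<epsilon> :: real assume \<epsilon>: "0 < \<epsilon>"
    show "emeasure (mu_measure \<alpha>) {..<\<epsilon>} \<noteq> 0"
    proof
      assume "emeasure (mu_measure \<alpha>) {..<\<epsilon>} = 0"
      then have "(\<integral>\<^sup>+\<sigma>. h \<sigma> * indicator {..<\<epsilon>} \<sigma> \<partial>lborel) = 0" by (simp add: em)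
      then have "AE \<sigma> in lborel. h \<sigma> * indicator {..<\<epsilon>} \<sigma> = 0"
        by (subst (asm) nn_integral_0_iff_AE) auto
      then have "AE \<sigma> in lborel. \<sigma> \<notin> {0<..<\<epsilon>}"
      proof eventually_elim
        case (elim \<sigma>)
        have "0 < c * \<sigma> powr \<alpha> * exp (- 2 * \<sigma>)" if "0 < \<sigma>" using c that by simp
        then have "0 < h \<sigma>" if "0 < \<sigma>" using that by (simp add: h_def)
        then show ?case using elim by (auto simp: indicator_def split: if_splits)
      qed
      then have "{0<..<\<epsilon>} \<in> null_sets lborel"
        by (subst AE_iff_null_sets) auto
      then have "emeasure lborel {0<..<\<epsilon>} = 0" by blast
      then show False using \<epsilon> by simp
    qed
  qed
qed

theorem theorem1p5:
  fixes M :: "'a measure" and X :: "nat \<Rightarrow> 'a \<Rightarrow> complex"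
    and f :: "nat \<Rightarrow> complex" and p \<alpha> :: real
  assumes "0 < p" and "- 1 < \<alpha>"
    and "standard_random_sequence M X"
    and "f \<in> dirichlet_series_space"
  shows "((AE \<omega> in M. randomization X f \<omega> \<in> hardy_space p) \<longleftrightarrow> f \<in> hardy_space 2) \<and>
         ((AE \<omega> in M. randomization X f \<omega> \<in> bergman_space p \<alpha>) \<longleftrightarrow> f \<in> mixed_norm_space 2 p \<alpha>)"
proof
  obtain L where "randomized M X L (return borel 0)"
    using randomizedI[OF assms(3) shift_weight_dirac] by blast
  then interpret H: randomized M X L "return borel 0" .
  have "weighted_norm r p (return borel 0) = hardy_norm r" for r
    using weighted_norm_dirac[OF assms(1)] by blast
  with H.AE_completion_iff[OF assms(1), of f]
  show "(AE \<omega> in M. randomization X f \<omega> \<in> hardy_space p) \<longleftrightarrow> f \<in> hardy_space 2"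
    by (simp add: hardy_space_def)
  obtain L' where "randomized M X L' (mu_measure \<alpha>)"
    using randomizedI[OF assms(3) shift_weight_mu_measure[OF assms(2)]] by blast
  then interpret B: randomized M X L' "mu_measure \<alpha>" .
  show "(AE \<omega> in M. randomization X f \<omega> \<in> bergman_space p \<alpha>) \<longleftrightarrow> f \<in> mixed_norm_space 2 p \<alpha>"
    using B.AE_completion_iff[OF assms(1), of f]
    by (simp add: bergman_space_def mixed_norm_space_def weighted_norm_mu_measure)
qed

end
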